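(* Let $F(x;\tau,\gamma)$ be the limiting one-point distribution function of the periodic TASEP with periodic step initial condition, defined in the context. For every $x_0\in\mathbb R$ there exist constants $C,c,\epsilon>0$ and $\tau_0>0$ such that $$\left|F(\tau^{1/3}x;\tau,0)-F_{\rm GUE}(x)\right|\le Ce^{-\epsilon\tau^{-2/3}}e^{-c(x-x_0)},\qquad 0<\tau<\tau_0,\ x\ge x_0 .$$ In particular, $\lim_{\tau\to0}F(\tau^{1/3}x;\tau,0)=F_{\rm GUE}(x)$ uniformly for $x\ge x_0$.
   Context: Roots and logarithms are principal. $F_{\rm GUE}$ is the GUE Tracy–Widom distribution, $F_{\rm GUE}(x)=\det(\mathbf I-\mathbf A_x^2)_{L^2(0,\infty)}$ with $\mathbf A_x$ having kernel $\mathrm{Ai}(s+x+t)$. $\mathrm{Li}_s(z)=\sum_{k\ge1}z^k/k^s$ for $|z|<1$, continued analytically to $\mathbb C\setminus[1,\infty)$. For $|z|<1$: $A_1(z)=-\frac1{\sqrt{2\pi}}\mathrm{Li}_{3/2}(z)$, $A_2(z)=-\frac1{\sqrt{2\pi}}\mathrm{Li}_{5/2}(z)$, $B(z)=\frac1{4\pi}\int_0^z\frac{(\mathrm{Li}_{1/2}(y))^2}{y}dy$. For $0<|z|<1$, $\mathcal S_-=\{\xi\in\mathbb C:e^{-\xi^2/2}=z,\ \mathrm{Re}\,\xi<0\}$, a subset of the sector $3\pi/4<\arg\xi<5\pi/4$; in that sector $Q(\xi)=\sqrt{2/\pi}\int_{-\infty}^\xi\mathrm{Li}_{1/2}(e^{-s^2/2})ds$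 (path in the sector) and $\Phi(\xi)=\Phi(\xi;\tau,x)=-\frac13\tau\xi^3+x\xi-Q(\xi)$. $\mathbf K_z$ is the trace class operator on $\ell^2(\mathcal S_-)$ with kernel $$\mathbf K_z(\xi_1,\xi_2)=\sum_{\eta\in\mathcal S_-}\frac{e^{\frac12\Phi(\xi_1)+\Phi(\eta)+\frac12\Phi(\xi_2)+\frac\gamma4(\xi_1^2-2\eta^2+\xi_2^2)}}{\sqrt{-\xi_1}(-\eta)(\xi_1+\eta)(\eta+\xi_2)\sqrt{-\xi_2}}.$$ For $\tau>0$, $x,\gamma\in\mathbb R$, $$F(x;\tau,\gamma)=\oint_{|z|=R}e^{xA_1(z)+\tau A_2(z)+2B(z)}\det(\mathbf I-\mathbf K_z)\frac{dz}{2\pi iz},$$ with any $0<R<1$, counterclockwise. *)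

theory Defs
  imports "HOL-Complex_Analysis.Complex_Analysis" "Jordan_Normal_Form.Determinant"
begin

section \<open>Fredholm determinants\<close>

text \<open>The determinant \<open>det (I - K)\<close> on \<open>L\<^sup>2(M)\<close> of the integral operator with kernel \<open>K\<close>,
  as the Fredholm series
  \<open>\<Sum>n. (-1)^n / n! * \<integral> det [K (x\<^sub>i) (x\<^sub>j)]\<^sub>i\<^sub>,\<^sub>j\<^sub><\<^sub>n dM(x\<^sub>0) \<dots> dM(x\<^sub>n\<^sub>-\<^sub>1)\<close>.
  For \<open>M = count_space S\<close> with \<open>S\<close> countable, this is the determinant on \<open>\<ell>\<^sup>2(S)\<close>.\<close>

definition fredholm_det ::
  "'a measure \<Rightarrow> ('a \<Rightarrow> 'a \<Rightarrow> 'b) \<Rightarrow> 'b :: {real_normed_field, banach, second_countable_topology}"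
  where "fredholm_det M K =
    (\<Sum>n. (-1) ^ n / fact n *
       (LINT x | PiM {..<n} (\<lambda>_. M). Determinant.det (mat n n (\<lambda>(i, j). K (x i) (x j)))))"

definition kernel_comp ::
  "'a measure \<Rightarrow> ('a \<Rightarrow> 'a \<Rightarrow> real) \<Rightarrow> ('a \<Rightarrow> 'a \<Rightarrow> real) \<Rightarrow> 'a \<Rightarrow> 'a \<Rightarrow> real"
  where "kernel_comp M K L s t = (LINT u | M. K s u * L u t)"


section \<open>The GUE Tracy--Widom distribution\<close>

text \<open>The defining integral converges only conditionally, hence the explicit limit.\<close>

definition Airy :: "real \<Rightarrow> real"
  where "Airy x = 1 / pi * Lim at_top (\<lambda>T. integral {0..T} (\<lambda>t. cos (t ^ 3 / 3 + x * t)))"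

definition airy_kernel :: "real \<Rightarrow> real \<Rightarrow> real \<Rightarrow> real"
  where "airy_kernel x s t = Airy (s + x + t)"

definition F_GUE :: "real \<Rightarrow> real"
  where "F_GUE x =
    (let M = restrict_space lborel {0<..}
     in fredholm_det M (kernel_comp M (airy_kernel x) (airy_kernel x)))"


section \<open>Polylogarithms and the functions built from them\<close>

definition polylog_series :: "real \<Rightarrow> complex \<Rightarrow> complex"
  where "polylog_series s z = (\<Sum>k. z ^ Suc k / of_real (real (Suc k) powr s))"

text \<open>Outside the unit disc this is the analytic continuation to the plane slit along
  \<open>[1, \<infinity>)\<close>; that domain is connected, so any choice gives the same values there.
  The functions below only evaluate polylogarithms inside the unit disc.\<close>

definition polylog :: "real \<Rightarrow> complex \<Rightarrow> complex"
  where "polylog s z =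
    (if norm z < 1 then polylog_series s z
     else (SOME f. f holomorphic_on - (complex_of_real ` {1..}) \<and>
                   (\<forall>w\<in>ball 0 1. f w = polylog_series s w)) z)"

definition A1 :: "complex \<Rightarrow> complex"
  where "A1 z = - (1 / of_real (sqrt (2 * pi))) * polylog (3/2) z"

definition A2 :: "complex \<Rightarrow> complex"
  where "A2 z = - (1 / of_real (sqrt (2 * pi))) * polylog (5/2) z"

definition B :: "complex \<Rightarrow> complex"
  where "B z = 1 / (4 * of_real pi) *
    contour_integral (linepath 0 z) (\<lambda>y. (polylog (1/2) y)\<^sup>2 / y)"

text \<open>The path from \<open>-\<infinity>\<close> to \<open>\<xi>\<close> is the horizontal half-line ending at \<open>\<xi>\<close>. It stays in the
  sector \<open>3\<pi>/4 < arg < 5\<pi>/4\<close> if \<open>\<xi>\<close> lies there, and there \<open>exp (- s\<^sup>2 / 2)\<close> has modulus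
  less than 1.\<close>

definition Q :: "complex \<Rightarrow> complex"
  where "Q \<xi> = of_real (sqrt (2 / pi)) *
    (LINT t:{..0}|lborel. polylog (1/2) (exp (- (\<xi> + complex_of_real t)\<^sup>2 / 2)))"

definition Phi :: "real \<Rightarrow> real \<Rightarrow> complex \<Rightarrow> complex"
  where "Phi \<tau> x \<xi> = - (1/3) * of_real \<tau> * \<xi> ^ 3 + of_real x * \<xi> - Q \<xi>"


section \<open>The one-point distribution function of periodic TASEP\<close>

definition S_minus :: "complex \<Rightarrow> complex set"
  where "S_minus z = {\<xi>. exp (- \<xi>\<^sup>2 / 2) = z \<and> Re \<xi> < 0}"

definition K_kernel ::
  "real \<Rightarrow> real \<Rightarrow> real \<Rightarrow> complex \<Rightarrow> complex \<Rightarrow> complex \<Rightarrow> complex"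
  where "K_kernel x \<tau> \<gamma> z \<xi>1 \<xi>2 =
    (\<Sum>\<^sub>\<infinity>\<eta>\<in>S_minus z.
       exp (1/2 * Phi \<tau> x \<xi>1 + Phi \<tau> x \<eta> + 1/2 * Phi \<tau> x \<xi>2
            + of_real \<gamma> / 4 * (\<xi>1\<^sup>2 - 2 * \<eta>\<^sup>2 + \<xi>2\<^sup>2))
       / (csqrt (- \<xi>1) * (- \<eta>) * (\<xi>1 + \<eta>) * (\<eta> + \<xi>2) * csqrt (- \<xi>2)))"

text \<open>The value is the same for all radii \<open>0 < R < 1\<close>; the radius is kept as a parameter.\<close>

definition F :: "real \<Rightarrow> real \<Rightarrow> real \<Rightarrow> real \<Rightarrow> complex"
  where "F R x \<tau> \<gamma> =
    contour_integral (circlepath 0 R)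
      (\<lambda>z. exp (of_real x * A1 z + of_real \<tau> * A2 z + 2 * B z)
           * fredholm_det (count_space (S_minus z)) (K_kernel x \<tau> \<gamma> z)
           / (2 * of_real pi * \<i> * z))"

end

theory Submission
  imports Defs "Jordan_Normal_Form.Schur_Decomposition"
begin

text \<open>Put \<open>\<delta> = \<tau> powr (1/3)\<close>. Writing \<open>1 / (\<xi> + \<eta>)\<close> as minus the integral of \<open>exp ((\<xi> + \<eta>) s)\<close> over \<open>s > 0\<close>
  factorises the kernel on \<open>S_minus z\<close>, and \<open>det (I - V W) = det (I - W V)\<close> turns its determinant into that of
  the square of the Hankel operator on the half-line with symbol
  \<open>h(y) = \<delta> \<Sum> exp (- \<tau> \<xi>\<^sup>3 / 3 + \<delta> y \<xi> - Q \<xi>) / (- \<xi>)\<close>, where \<open>\<xi>\<close> ranges over \<open>S_minus z\<close>.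
  In the variable \<open>w = - \<xi>\<^sup>2 / 2\<close> this is a sum over a translate of \<open>2 \<pi> \<i> \<int>\<close> of a function analytic for
  \<open>Re w < 0\<close>, hence, up to the contribution of \<open>Q\<close>, a trapezoidal sum for an integral that equals \<open>Ai(y)\<close>.
  On the circle \<open>|z| = exp (- 1 / \<delta>\<^sup>2)\<close> the error of the trapezoidal rule and the contribution of \<open>Q\<close> are of order
  \<open>exp (- 1 / (2 \<delta>\<^sup>2))\<close>, with a factor \<open>exp (x0 - y)\<close>, and Hadamard's inequality carries this over to the
  Fredholm determinants. All radii give the same contour integral because the determinant is analytic in
  \<open>0 < |z| < 1\<close>, and the prefactor, which is analytic at \<open>0\<close> with value \<open>1\<close>, integrates \<open>F_GUE x\<close> to itself.\<close>

text \<open>The scaled roots u = \<delta> \<xi> lie on the hyperbola (Re u)^2 - (Im u)^2 = - 2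
  \<delta>^2 Re w. For |z| = exp (- 1 / \<delta>^2), that is Re w = - 1 / \<delta>^2, this curve
  does not depend on \<delta>, which singles out the circle: the Airy integrand decays along it
  uniformly in \<delta>, and Q is of order |z|. The obstacle is uniformity in \<delta> and x at
  once. About 1 / \<delta>^2 roots contribute, each with weight \<delta>^2, so this weight is
  carried explicitly through all lattice sums. The prefactor may grow like exp |\<delta> x|; each of
  the two symbols in the kernel supplies a factor exp (x0 - x), one of which absorbs the growth and
  the other of which survives as c = 1. Operator theory is replaced by Fredholm series of kernels
  bounded by c q(s) q(t) with q square integrable. The integral defining \<open>Airy\<close>
  converges only conditionally; it is reached through limits of a primitive, and decay and
  measurability of \<open>Airy\<close> are read off from the approximation itself.\<close>

section \<open>Hadamard's inequality\<close>

lemma similar_mat_wit_trace: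
  fixes B0 T :: "'a :: comm_ring_1 mat"
  assumes B0: "B0 \<in> carrier_mat n n" and sim: "similar_mat_wit B0 T P0 Q0"
  shows "(\<Sum>i<n. B0 $$ (i, i)) = (\<Sum>i<n. T $$ (i, i))"
proof -
  note w = similar_mat_witD2[OF B0 sim]
  have carr: "T \<in> carrier_mat n n" "P0 \<in> carrier_mat n n" "Q0 \<in> carrier_mat n n"
    and QP: "Q0 * P0 = 1\<^sub>m n" and Beq: "B0 = P0 * T * Q0"
    using w by auto
  have entry: "(X * Y) $$ (i, i) = (\<Sum>j<n. X $$ (i, j) * Y $$ (j, i))"
    if "X \<in> carrier_mat n n" "Y \<in> carrier_mat n n" "i < n" for X Y :: "'a mat" and i
    using that by (auto simp: scalar_prod_def intro!: sum.cong)
  have PT: "P0 * T \<in> carrier_mat n n" using carr by auto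
  have "(\<Sum>i<n. B0 $$ (i, i)) = (\<Sum>i<n. \<Sum>j<n. (P0 * T) $$ (i, j) * Q0 $$ (j, i))"
    unfolding Beq by (intro sum.cong refl entry PT carr) auto
  also have "\<dots> = (\<Sum>j<n. \<Sum>i<n. Q0 $$ (j, i) * (P0 * T) $$ (i, j))"
    by (subst sum.swap) (simp add: mult.commute)
  also have "\<dots> = (\<Sum>j<n. (Q0 * (P0 * T)) $$ (j, j))"
    by (intro sum.cong refl entry[symmetric] PT carr) auto
  also have "Q0 * (P0 * T) = T"
    using carr QP by (metis assoc_mult_mat left_mult_one_mat)
  finally show ?thesis .
qed

(* This is Hadamard's inequality: the product of the eigenvalues of A A^* is bounded by l <= exp (l - 1)
   instead of the inequality of arithmetic and geometric means. *)
lemma det_gram_le: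
  fixes A :: "complex mat"
  assumes A: "A \<in> carrier_mat n n"
  shows "(norm (Determinant.det A))\<^sup>2 \<le> exp ((\<Sum>i<n. \<Sum>j<n. (norm (A $$ (i, j)))\<^sup>2) - real n)"
proof -
  define C where "C = mat n n (\<lambda>(i, j). cnj (A $$ (j, i)))"
  define G where "G = A * C"
  have C: "C \<in> carrier_mat n n" by (simp add: C_def)
  have G: "G \<in> carrier_mat n n" using A C by (simp add: G_def)
  obtain es where es: "char_poly G = (\<Prod>a\<leftarrow>es. [:- a, 1:])" "length es = n"
    using char_poly_factorized[OF G] by blast
  obtain T P0 Q0 where T: "schur_decomposition G es = (T, P0, Q0)" by (metis prod_cases3)
  from schur_decomposition[OF G es(1) T]
  have sim: "similar_mat_wit G T P0 Q0" and ut: "upper_triangular T" and diag: "diag_mat T = es" by auto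
  have Tc: "T \<in> carrier_mat n n" using similar_mat_witD2[OF G sim] by auto
  have Tii: "T $$ (i, i) = es ! i" if "i < n" for i
    using diag that Tc by (auto simp: diag_mat_def)
  have "similar_mat G T" using sim unfolding similar_mat_def by auto
  then have detG: "Determinant.det G = prod_list es"
    using det_similar det_upper_triangular[OF ut Tc] diag by metis
  have trG: "(\<Sum>i<n. G $$ (i, i)) = (\<Sum>i<n. es ! i)"
    using similar_mat_wit_trace[OF G sim] Tii by simp
  \<comment> \<open>For an eigenvector v of A A^* the eigenvalue is the Rayleigh quotient |A^* v|^2
    / |v|^2; here u = A^* v.\<close>
  have nonneg: "\<exists>r\<ge>0. e = complex_of_real r" if "e \<in> set es" for e
  proof -
    have "poly (char_poly G) e = 0"
      unfolding es(1) poly_prod_list using that by (auto simp: prod_list_zero_iff)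
    then obtain v where v: "v \<in> carrier_vec n" "v \<noteq> 0\<^sub>v n" "G *\<^sub>v v = e \<cdot>\<^sub>v v"
      using eigenvalue_root_char_poly[OF G] G unfolding eigenvalue_def eigenvector_def by auto
    define u where "u j = (\<Sum>i<n. C $$ (j, i) * v $ i)" for j
    have Gv: "(\<Sum>j<n. A $$ (i, j) * u j) = e * v $ i" if i: "i < n" for i
    proof -
      have "(G *\<^sub>v v) $ i = (A *\<^sub>v (C *\<^sub>v v)) $ i"
        using A C v(1) by (simp add: G_def assoc_mult_mat_vec)
      also have "\<dots> = (\<Sum>j<n. A $$ (i, j) * u j)"
        using A C v(1) i by (auto simp: scalar_prod_def u_def mult_mat_vec_def intro!: sum.cong)
      finally show ?thesis using v i by auto
    qed
    have "(\<Sum>j<n. cnj (u j) * u j) = (\<Sum>j<n. \<Sum>i<n. cnj (v $ i) * (A $$ (i, j) * u j))"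
      by (intro sum.cong refl) (simp add: u_def C_def sum_distrib_right sum_distrib_left mult_ac)
    also have "\<dots> = (\<Sum>i<n. cnj (v $ i) * (\<Sum>j<n. A $$ (i, j) * u j))"
      by (subst sum.swap) (simp add: sum_distrib_left)
    also have "\<dots> = e * (\<Sum>i<n. cnj (v $ i) * v $ i)"
      unfolding sum_distrib_left[of e] by (intro sum.cong refl, subst Gv) auto
    finally have eq: "complex_of_real (\<Sum>j<n. (norm (u j))\<^sup>2) = e * complex_of_real (\<Sum>i<n. (norm (v $ i))\<^sup>2)"
      unfolding of_real_sum complex_norm_square by (simp add: mult.commute)
    have "\<exists>i<n. v $ i \<noteq> 0" using v by (metis eq_vecI carrier_vecD index_zero_vec)
    then have pos: "(\<Sum>i<n. (norm (v $ i))\<^sup>2) > 0"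
      by (auto intro!: sum_pos2)
    have "e = complex_of_real ((\<Sum>j<n. (norm (u j))\<^sup>2) / (\<Sum>i<n. (norm (v $ i))\<^sup>2))"
      using eq pos unfolding of_real_divide by (metis less_irrefl nonzero_mult_div_cancel_right of_real_eq_0_iff)
    then show ?thesis using pos by (intro exI[of _ "(\<Sum>j<n. (norm (u j))\<^sup>2) / (\<Sum>i<n. (norm (v $ i))\<^sup>2)"])
        (auto intro!: divide_nonneg_pos sum_nonneg)
  qed
  then obtain r where r: "\<And>e. e \<in> set es \<Longrightarrow> r e \<ge> 0 \<and> e = complex_of_real (r e)" by metis
  define l where "l i = r (es ! i)" for i
  have l: "l i \<ge> 0" "es ! i = complex_of_real (l i)" if "i < n" for i
    using r that es(2) by (auto simp: l_def)
  have "Determinant.det C = cnj (Determinant.det A)"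
  proof -
    have "C = map_mat cnj (transpose_mat A)" using A by (auto simp: C_def)
    moreover have "comm_ring_hom cnj" by unfold_locales auto
    ultimately show ?thesis using A by (simp add: comm_ring_hom.hom_det det_transpose)
  qed
  then have "complex_of_real ((norm (Determinant.det A))\<^sup>2) = Determinant.det G"
    using det_mult[OF A C] unfolding G_def complex_norm_square by simp
  also have "\<dots> = (\<Prod>i<n. es ! i)"
    by (simp add: detG prod.list_conv_set_nth es(2) atLeast0LessThan)
  also have "\<dots> = complex_of_real (\<Prod>i<n. l i)" by (simp add: l)
  finally have d: "(norm (Determinant.det A))\<^sup>2 = (\<Prod>i<n. l i)" using of_real_eq_iff by blast
  have "complex_of_real (\<Sum>i<n. l i) = (\<Sum>i<n. es ! i)" by (simp add: l)
  also have "\<dots> = (\<Sum>i<n. G $$ (i, i))" by (simp add: trG)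
  also have "\<dots> = (\<Sum>i<n. \<Sum>j<n. A $$ (i, j) * cnj (A $$ (i, j)))"
    using A C by (auto simp: G_def scalar_prod_def C_def intro!: sum.cong)
  also have "\<dots> = complex_of_real (\<Sum>i<n. \<Sum>j<n. (norm (A $$ (i, j)))\<^sup>2)"
    unfolding of_real_sum complex_norm_square ..
  finally have t: "(\<Sum>i<n. l i) = (\<Sum>i<n. \<Sum>j<n. (norm (A $$ (i, j)))\<^sup>2)" using of_real_eq_iff by blast
  have "(\<Prod>i<n. l i) \<le> (\<Prod>i<n. exp (l i - 1))"
  proof (intro prod_mono conjI)
    show "l i \<le> exp (l i - 1)" if "i \<in> {..<n}" for i
      using exp_ge_add_one_self[of "l i - 1"] by simp
  qed (use l in auto)
  also have "\<dots> = exp ((\<Sum>i<n. l i) - real n)" by (simp add: exp_sum[symmetric] sum_subtractf)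
  finally show ?thesis by (simp add: d t)
qed

text \<open>Dividing row i by sqrt n p_i and column j by q_j leaves entries of modulus at most 1 /
  sqrt n, whose squares sum to at most n; \<open>det_gram_le\<close> then bounds the scaled
  determinant by 1.\<close>

lemma hadamard_bound:
  fixes K :: "nat \<Rightarrow> nat \<Rightarrow> complex"
  assumes K: "\<And>i j. i < n \<Longrightarrow> j < n \<Longrightarrow> norm (K i j) \<le> p i * q j"
    and p: "\<And>i. i < n \<Longrightarrow> p i \<ge> 0" and q: "\<And>i. i < n \<Longrightarrow> q i \<ge> 0"
  shows "norm (Determinant.det (mat n n (\<lambda>(i, j). K i j))) \<le> sqrt (real n) ^ n * (\<Prod>i<n. p i) * (\<Prod>i<n. q i)"
proof (cases "n = 0")
  case True
  then show ?thesis by simp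
next
  case False
  define s where "s = sqrt (real n)"
  have s: "s > 0" "s\<^sup>2 = real n" using False by (auto simp: s_def)
  define A where "A = mat n n (\<lambda>(i, j). K i j / (s * p i * q j))"
  have A: "A \<in> carrier_mat n n" by (simp add: A_def)
  have Abd: "norm (A $$ (i, j)) \<le> 1 / s" if "i < n" "j < n" for i j
  proof (cases "p i * q j = 0")
    case True
    then show ?thesis using s that by (auto simp: A_def)
  next
    case False
    then have "p i * q j > 0" using p[OF that(1)] q[OF that(2)] by (simp add: zero_less_mult_iff less_le)
    moreover have "norm (A $$ (i, j)) = norm (K i j) / (s * (p i * q j))"
      using that p q s by (simp add: A_def norm_divide norm_mult)
    ultimately show ?thesis using K[OF that] s by (simp add: field_simps)
  qed
  have "(\<Sum>i<n. \<Sum>j<n. (norm (A $$ (i, j)))\<^sup>2) \<le> (\<Sum>i<n. \<Sum>j<n. (1 / s)\<^sup>2)"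
    by (intro sum_mono power_mono Abd) auto
  also have "\<dots> = real n" using s False by (simp add: power_divide)
  finally have "(\<Sum>i<n. \<Sum>j<n. (norm (A $$ (i, j)))\<^sup>2) - real n \<le> 0" by simp
  then have "(norm (Determinant.det A))\<^sup>2 \<le> 1"
    using det_gram_le[OF A] by (smt (verit) exp_le_one_iff)
  then have dA: "norm (Determinant.det A) \<le> 1" by (simp add: power2_le_iff_abs_le abs_square_le_1)
  \<comment> \<open>If p i or q j vanishes then so does K i j, and division by zero makes the entry
    of A equal to 0, so the equation survives.\<close>
  have scale: "K i j = (s * p i * q j) * A $$ (i, j)" if "i < n" "j < n" for i j
    using K[OF that] that s by (auto simp: A_def)
  have "Determinant.det (mat n n (\<lambda>(i, j). K i j)) =
      (\<Sum>\<pi> | \<pi> permutes {0..<n}. signof \<pi> * (\<Prod>i = 0..<n. K i (\<pi> i)))"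
    by (subst det_def') (auto intro!: sum.cong prod.cong simp: permutes_in_image)
  also have "\<dots> = (\<Sum>\<pi> | \<pi> permutes {0..<n}.
      complex_of_real (s ^ n * (\<Prod>i<n. p i) * (\<Prod>i<n. q i)) * (signof \<pi> * (\<Prod>i = 0..<n. A $$ (i, \<pi> i))))"
  proof (intro sum.cong refl)
    fix \<pi> assume "\<pi> \<in> {\<pi>. \<pi> permutes {0..<n}}"
    then have perm: "\<pi> permutes {0..<n}" by simp
    have "(\<Prod>i = 0..<n. K i (\<pi> i)) = (\<Prod>i = 0..<n. (s * p i * q (\<pi> i)) * A $$ (i, \<pi> i))"
      using permutes_in_image[OF perm] by (intro prod.cong refl scale) auto
    also have "\<dots> = complex_of_real (s ^ n * (\<Prod>i=0..<n. p i) * (\<Prod>i=0..<n. q (\<pi> i))) * (\<Prod>i = 0..<n. A $$ (i, \<pi> i))"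
      by (simp add: prod.distrib)
    also have "(\<Prod>i=0..<n. q (\<pi> i)) = (\<Prod>i=0..<n. q i)"
      using prod.permute[OF perm, of q] by (simp add: o_def)
    finally show "signof \<pi> * (\<Prod>i = 0..<n. K i (\<pi> i)) =
       complex_of_real (s ^ n * (\<Prod>i<n. p i) * (\<Prod>i<n. q i)) * (signof \<pi> * (\<Prod>i = 0..<n. A $$ (i, \<pi> i)))"
      by (simp add: atLeast0LessThan mult_ac)
  qed
  also have "\<dots> = complex_of_real (s ^ n * (\<Prod>i<n. p i) * (\<Prod>i<n. q i)) * Determinant.det A"
    unfolding sum_distrib_left[symmetric] by (subst det_def'[OF A]) simp
  finally have "norm (Determinant.det (mat n n (\<lambda>(i, j). K i j))) =
      (s ^ n * (\<Prod>i<n. p i) * (\<Prod>i<n. q i)) * norm (Determinant.det A)"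
    using p q s by (simp add: norm_mult norm_power abs_mult abs_prod flip: of_real_prod)
  also have "\<dots> \<le> (s ^ n * (\<Prod>i<n. p i) * (\<Prod>i<n. q i)) * 1"
    using p q s by (intro mult_left_mono dA mult_nonneg_nonneg prod_nonneg) auto
  finally show ?thesis by (simp add: s_def)
qed

lemma prod_diff_telescope:
  fixes a b :: "nat \<Rightarrow> 'a :: comm_ring_1"
  shows "(\<Prod>i=0..<n. a i) - (\<Prod>i=0..<n. b i) =
    (\<Sum>k<n. \<Prod>i=0..<n. if i < k then b i else if i = k then a i - b i else a i)"
proof (induction n)
  case 0
  then show ?case by simp
next
  case (Suc n)
  have "(\<Sum>k<Suc n. \<Prod>i=0..<Suc n. if i < k then b i else if i = k then a i - b i else a i) =
      (\<Sum>k<n. (\<Prod>i=0..<n. if i < k then b i else if i = k then a i - b i else a i) * a n)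
       + (\<Prod>i=0..<n. b i) * (a n - b n)"
  proof -
    have "(\<Prod>i=0..<n. if i < n then b i else if i = n then a i - b i else a i) = (\<Prod>i=0..<n. b i)"
      by (intro prod.cong) auto
    moreover have "(\<Sum>k<n. \<Prod>i=0..<Suc n. if i < k then b i else if i = k then a i - b i else a i) =
      (\<Sum>k<n. (\<Prod>i=0..<n. if i < k then b i else if i = k then a i - b i else a i) * a n)"
      by (intro sum.cong) auto
    ultimately show ?thesis by simp
  qed
  also have "\<dots> = ((\<Prod>i=0..<n. a i) - (\<Prod>i=0..<n. b i)) * a n + (\<Prod>i=0..<n. b i) * (a n - b n)"
    by (simp add: Suc.IH sum_distrib_right)
  finally show ?case by (simp add: algebra_simps)
qed

text \<open>Applied to every Leibniz product, \<open>prod_diff_telescope\<close> writes the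
  difference as a sum of n determinants. The k-th has rows of L before row k, the difference in row
  k and rows of K after it, so Hadamard's inequality yields \<eta> from that row and M from each of
  the other n - 1.\<close>

lemma hadamard_diff_bound:
  fixes K L :: "nat \<Rightarrow> nat \<Rightarrow> complex"
  assumes K: "\<And>i j. i < n \<Longrightarrow> j < n \<Longrightarrow> norm (K i j) \<le> M * (q i * q j)"
    and L: "\<And>i j. i < n \<Longrightarrow> j < n \<Longrightarrow> norm (L i j) \<le> M * (q i * q j)"
    and KL: "\<And>i j. i < n \<Longrightarrow> j < n \<Longrightarrow> norm (K i j - L i j) \<le> \<eta> * (q i * q j)"
    and q: "\<And>i. i < n \<Longrightarrow> q i \<ge> 0" and M: "M \<ge> 0" and \<eta>: "\<eta> \<ge> 0"
  shows "norm (Determinant.det (mat n n (\<lambda>(i, j). K i j)) - Determinant.det (mat n n (\<lambda>(i, j). L i j)))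
    \<le> \<eta> * (real n * sqrt (real n) ^ n * M ^ (n - 1)) * (\<Prod>i<n. (q i)\<^sup>2)"
proof -
  define R where "R k i j = (if i < k then L i j else if i = k then K i j - L i j else K i j)" for k i j
  have leib: "Determinant.det (mat n n (\<lambda>(i, j). X i j)) =
      (\<Sum>\<pi> | \<pi> permutes {0..<n}. signof \<pi> * (\<Prod>i = 0..<n. X i (\<pi> i)))" for X :: "nat \<Rightarrow> nat \<Rightarrow> complex"
    by (subst det_def') (auto intro!: sum.cong prod.cong simp: permutes_in_image)
  have "Determinant.det (mat n n (\<lambda>(i, j). K i j)) - Determinant.det (mat n n (\<lambda>(i, j). L i j)) =
      (\<Sum>\<pi> | \<pi> permutes {0..<n}. signof \<pi> * (\<Sum>k<n. \<Prod>i = 0..<n. R k i (\<pi> i)))"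
    unfolding leib sum_subtractf[symmetric] right_diff_distrib[symmetric] prod_diff_telescope R_def ..
  also have "\<dots> = (\<Sum>k<n. Determinant.det (mat n n (\<lambda>(i, j). R k i j)))"
    unfolding leib sum_distrib_left by (rule sum.swap)
  finally have eq: "Determinant.det (mat n n (\<lambda>(i, j). K i j)) - Determinant.det (mat n n (\<lambda>(i, j). L i j)) = \<dots>" .
  have bd: "norm (Determinant.det (mat n n (\<lambda>(i, j). R k i j)))
      \<le> \<eta> * (sqrt (real n) ^ n * M ^ (n - 1)) * (\<Prod>i<n. (q i)\<^sup>2)" if k: "k < n" for k
  proof -
    have "norm (Determinant.det (mat n n (\<lambda>(i, j). R k i j)))
      \<le> sqrt (real n) ^ n * (\<Prod>i<n. (if i = k then \<eta> else M) * q i) * (\<Prod>i<n. q i)"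
      using q M \<eta> K L KL by (intro hadamard_bound) (auto simp: R_def mult.assoc)
    also have "(\<Prod>i<n. (if i = k then \<eta> else M) * q i) = \<eta> * M ^ (n - 1) * (\<Prod>i<n. q i)"
    proof -
      have "(\<Prod>i<n. (if i = k then \<eta> else M)) = \<eta> * (\<Prod>i\<in>{..<n} - {k}. (if i = k then \<eta> else M))"
        using k by (subst prod.remove[of _ k]) auto
      also have "(\<Prod>i\<in>{..<n} - {k}. (if i = k then \<eta> else M)) = (\<Prod>i\<in>{..<n} - {k}. M)"
        by (intro prod.cong) auto
      also have "\<dots> = M ^ (n - 1)" using k by simp
      finally show ?thesis by (simp add: prod.distrib)
    qed
    finally show ?thesis by (simp add: power2_eq_square prod.distrib mult_ac)
  qed
  show ?thesis unfolding eq
    by (rule order_trans[OF norm_sum], rule order_trans[OF sum_mono[OF bd]]) (auto simp: mult_ac)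
qed

section \<open>Fredholm determinants\<close>

abbreviation point_det :: "nat \<Rightarrow> ('a \<Rightarrow> 'a \<Rightarrow> 'b :: comm_ring_1) \<Rightarrow> (nat \<Rightarrow> 'a) \<Rightarrow> 'b"
  where "point_det n K x \<equiv> Determinant.det (mat n n (\<lambda>(i, j). K (x i) (x j)))"

definition fredholm_term ::
  "nat \<Rightarrow> 'a measure \<Rightarrow> ('a \<Rightarrow> 'a \<Rightarrow> 'b) \<Rightarrow> 'b :: {real_normed_field, banach, second_countable_topology}"
  where "fredholm_term n M K =
    (LINT x | PiM {..<n} (\<lambda>_. M). point_det n K x)"

lemma fredholm_det_terms: "fredholm_det M K = (\<Sum>n. (-1) ^ n / fact n * fredholm_term n M K)"
  by (simp add: fredholm_det_def fredholm_term_def)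

lemma det_leibniz:
  fixes K :: "nat \<Rightarrow> nat \<Rightarrow> 'a :: comm_ring_1"
  shows "Determinant.det (mat n n (\<lambda>(i, j). K i j)) =
    (\<Sum>\<pi> | \<pi> permutes {..<n}. of_int (sign \<pi>) * (\<Prod>i<n. K i (\<pi> i)))"
  by (subst det_def') (auto intro!: sum.cong prod.cong simp: permutes_in_image atLeast0LessThan)

lemma det_leibniz_col:
  fixes K :: "nat \<Rightarrow> nat \<Rightarrow> 'a :: comm_ring_1"
  shows "Determinant.det (mat n n (\<lambda>(i, j). K i j)) =
    (\<Sum>\<pi> | \<pi> permutes {..<n}. of_int (sign \<pi>) * (\<Prod>i<n. K (\<pi> i) i))"
  by (subst det_col) (auto intro!: sum.cong prod.cong simp: permutes_in_image atLeast0LessThan)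

section \<open>Exchanging the two factors of a kernel, term by term in the Fredholm series\<close>

lemma integrable_prod_mult:
  fixes f :: "'a \<Rightarrow> real" and g :: "'b \<Rightarrow> real"
  assumes "sigma_finite_measure M" "sigma_finite_measure N"
    and f: "integrable M f" and g: "integrable N g"
  shows "integrable (M \<Otimes>\<^sub>M N) (\<lambda>z. f (fst z) * g (snd z))"
proof -
  interpret M: sigma_finite_measure M by fact
  interpret N: sigma_finite_measure N by fact
  interpret pair_sigma_finite M N ..
  have [measurable]: "f \<in> borel_measurable M" "g \<in> borel_measurable N" using f g by auto
  show ?thesis
  proof (rule Fubini_integrable)
    show "(\<lambda>z. f (fst z) * g (snd z)) \<in> borel_measurable (M \<Otimes>\<^sub>M N)" by measurable
    show "integrable M (\<lambda>x. LINT y|N. norm (f (fst (x, y)) * g (snd (x, y))))"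
      using f g by (simp add: abs_mult)
    show "AE x in M. integrable N (\<lambda>y. f (fst (x, y)) * g (snd (x, y)))"
      using g by simp
  qed
qed

lemma measurable_kernel_compose:
  assumes "(\<lambda>(x, y). V x y) \<in> borel_measurable (X \<Otimes>\<^sub>M Y)" "f \<in> M \<rightarrow>\<^sub>M X" "g \<in> M \<rightarrow>\<^sub>M Y"
  shows "(\<lambda>z. V (f z) (g z)) \<in> borel_measurable M"
  using measurable_compose[OF measurable_Pair[OF assms(2,3)] assms(1)] by simp

(* After a Leibniz expansion of both sides, Fubini matches the summand of a permutation on the left with that of
   the inverse permutation on the right. *)
lemma fredholm_term_commute:
  fixes V :: "'a \<Rightarrow> 'b \<Rightarrow> 'c :: {real_normed_field, banach, second_countable_topology}"
  assumes X: "sigma_finite_measure X" and Y: "sigma_finite_measure Y"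
    and V [measurable]: "(\<lambda>(x, y). V x y) \<in> borel_measurable (X \<Otimes>\<^sub>M Y)"
    and W [measurable]: "(\<lambda>(y, x). W y x) \<in> borel_measurable (Y \<Otimes>\<^sub>M X)"
    and p: "integrable X (\<lambda>x. (p x)\<^sup>2)" and q: "integrable Y (\<lambda>y. (q y)\<^sup>2)"
    and p0: "\<And>x. x \<in> space X \<Longrightarrow> p x \<ge> 0" and q0: "\<And>y. y \<in> space Y \<Longrightarrow> q y \<ge> 0"
    and Vb: "\<And>x y. x \<in> space X \<Longrightarrow> y \<in> space Y \<Longrightarrow> norm (V x y) \<le> c * (p x * q y)"
    and Wb: "\<And>x y. x \<in> space X \<Longrightarrow> y \<in> space Y \<Longrightarrow> norm (W y x) \<le> d * (p x * q y)"
    and c: "c \<ge> 0" and d: "d \<ge> 0"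
  shows "fredholm_term n X (\<lambda>x x'. LINT y|Y. V x y * W y x') =
         fredholm_term n Y (\<lambda>y y'. LINT x|X. W y x * V x y')"
proof -
  interpret X: sigma_finite_measure X by fact
  interpret Y: sigma_finite_measure Y by fact
  interpret PX: product_sigma_finite "\<lambda>_. X" ..
  interpret PY: product_sigma_finite "\<lambda>_. Y" ..
  let ?I = "{..<n}"
  let ?PX = "PiM ?I (\<lambda>_. X)" and ?PY = "PiM ?I (\<lambda>_. Y)"
  interpret SX: sigma_finite_measure ?PX by (rule PX.sigma_finite) simp
  interpret SY: sigma_finite_measure ?PY by (rule PY.sigma_finite) simp
  interpret XY: pair_sigma_finite ?PX ?PY ..
  let ?S = "{\<pi>. \<pi> permutes ?I}"
  have finS: "finite ?S" by (rule finite_permutations) simp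
  define g where "g \<pi> x y = (\<Prod>i<n. V (x i) (y i) * W (y i) (x (\<pi> i)))" for \<pi> x y
  note Vc [measurable (raw)] = measurable_kernel_compose[OF V]
  note Wc [measurable (raw)] = measurable_kernel_compose[OF W]
  have intY: "integrable Y (\<lambda>y. V x y * W y x')" if x: "x \<in> space X" "x' \<in> space X" for x x'
  proof (rule Bochner_Integration.integrable_bound)
    show "integrable Y (\<lambda>y. (c * d * p x * p x') * (q y)\<^sup>2)" using q by simp
    show "(\<lambda>y. V x y * W y x') \<in> borel_measurable Y" using x by measurable
    show "AE y in Y. norm (V x y * W y x') \<le> norm ((c * d * p x * p x') * (q y)\<^sup>2)"
    proof (rule AE_I2)
      fix y assume y: "y \<in> space Y"
      have "norm (V x y * W y x') \<le> (c * (p x * q y)) * (d * (p x' * q y))"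
        unfolding norm_mult using x y p0 q0 c d by (intro mult_mono Vb Wb) auto
      also have "\<dots> = (c * d * p x * p x') * (q y)\<^sup>2" by (simp add: power2_eq_square)
      finally show "norm (V x y * W y x') \<le> norm ((c * d * p x * p x') * (q y)\<^sup>2)" by simp
    qed
  qed
  have intX: "integrable X (\<lambda>x. W y x * V x y')" if y: "y \<in> space Y" "y' \<in> space Y" for y y'
  proof (rule Bochner_Integration.integrable_bound)
    show "integrable X (\<lambda>x. (c * d * q y * q y') * (p x)\<^sup>2)" using p by simp
    show "(\<lambda>x. W y x * V x y') \<in> borel_measurable X" using y by measurable
    show "AE x in X. norm (W y x * V x y') \<le> norm ((c * d * q y * q y') * (p x)\<^sup>2)"
    proof (rule AE_I2)
      fix x assume x: "x \<in> space X"
      have "norm (W y x * V x y') \<le> (d * (p x * q y)) * (c * (p x * q y'))"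
        unfolding norm_mult using x y p0 q0 c d by (intro mult_mono Vb Wb) auto
      also have "\<dots> = (c * d * q y * q y') * (p x)\<^sup>2" by (simp add: power2_eq_square)
      finally show "norm (W y x * V x y') \<le> norm ((c * d * q y * q y') * (p x)\<^sup>2)" by simp
    qed
  qed
  have spX: "x i \<in> space X" if "x \<in> space ?PX" "i < n" for x i using that by (auto simp: space_PiM)
  have spY: "y i \<in> space Y" if "y \<in> space ?PY" "i < n" for y i using that by (auto simp: space_PiM)
  have perm_lt: "\<pi> i < n" if "\<pi> permutes ?I" "i < n" for \<pi> i
    using permutes_in_image[OF that(1), of i] that(2) by simp
  have gx: "(\<Prod>i<n. LINT y|Y. V (x i) y * W y (x (\<pi> i))) = (LINT y|?PY. g \<pi> x y)"
    if "\<pi> permutes ?I" "x \<in> space ?PX" for \<pi> x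
    unfolding g_def using that perm_lt
    by (subst PY.product_integral_prod) (auto intro!: intY spX)
  have gy: "(\<Prod>i<n. LINT x|X. W (y (Hilbert_Choice.inv \<pi> i)) x * V x (y i)) = (LINT x|?PX. g \<pi> x y)"
    if \<pi>: "\<pi> permutes ?I" and y: "y \<in> space ?PY" for \<pi> y
  proof -
    have inv: "Hilbert_Choice.inv \<pi> permutes ?I" by (rule permutes_inv[OF \<pi>])
    \<comment> \<open>Reindexing the W factors by the inverse of \<pi> brings the two factors that
      contain x i together, so that the integral over x splits into n single integrals.\<close>
    have "g \<pi> x y = (\<Prod>i<n. W (y (Hilbert_Choice.inv \<pi> i)) (x i) * V (x i) (y i))" for x
    proof -
      have "(\<Prod>i<n. W (y i) (x (\<pi> i))) = (\<Prod>i<n. W (y (Hilbert_Choice.inv \<pi> i)) (x (\<pi> (Hilbert_Choice.inv \<pi> i))))"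
        using prod.permute[OF inv, of "\<lambda>i. W (y i) (x (\<pi> i))"] by (simp add: o_def)
      then show ?thesis unfolding g_def prod.distrib
        by (simp add: permutes_inverses(1)[OF \<pi>] mult.commute)
    qed
    then show ?thesis using y perm_lt[OF inv]
      by (subst PX.product_integral_prod[symmetric]) (auto intro!: intX spY)
  qed
  have g_meas: "(\<lambda>(x, y). g \<pi> x y) \<in> borel_measurable (?PX \<Otimes>\<^sub>M ?PY)" if \<pi>: "\<pi> permutes ?I" for \<pi>
  proof -
    have "(\<lambda>z. fst z i) \<in> ?PX \<Otimes>\<^sub>M ?PY \<rightarrow>\<^sub>M X" "(\<lambda>z. snd z i) \<in> ?PX \<Otimes>\<^sub>M ?PY \<rightarrow>\<^sub>M Y" if "i < n" for i
      using that by (auto intro: measurable_compose[OF measurable_fst measurable_component_singleton]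
        measurable_compose[OF measurable_snd measurable_component_singleton])
    then show ?thesis
      unfolding g_def split_beta' using perm_lt[OF \<pi>] by (intro borel_measurable_prod borel_measurable_times Vc Wc) auto
  qed
  have g_int: "integrable (?PX \<Otimes>\<^sub>M ?PY) (\<lambda>(x, y). g \<pi> x y)" if \<pi>: "\<pi> permutes ?I" for \<pi>
  proof (rule Bochner_Integration.integrable_bound[OF _ g_meas[OF \<pi>]])
    have "integrable ?PX (\<lambda>x. \<Prod>i<n. (p (x i))\<^sup>2)" by (rule PX.product_integrable_prod) (use p in auto)
    moreover have "integrable ?PY (\<lambda>y. \<Prod>i<n. (q (y i))\<^sup>2)" by (rule PY.product_integrable_prod) (use q in auto)
    ultimately have "integrable (?PX \<Otimes>\<^sub>M ?PY) (\<lambda>z. (\<Prod>i<n. (p (fst z i))\<^sup>2) * (\<Prod>i<n. (q (snd z i))\<^sup>2))"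
      by (intro integrable_prod_mult SX.sigma_finite_measure_axioms SY.sigma_finite_measure_axioms)
    then show "integrable (?PX \<Otimes>\<^sub>M ?PY) (\<lambda>z. (c * d) ^ n * ((\<Prod>i<n. (p (fst z i))\<^sup>2) * (\<Prod>i<n. (q (snd z i))\<^sup>2)))"
      by simp
    show "AE z in ?PX \<Otimes>\<^sub>M ?PY. norm (case z of (x, y) \<Rightarrow> g \<pi> x y) \<le>
        norm ((c * d) ^ n * ((\<Prod>i<n. (p (fst z i))\<^sup>2) * (\<Prod>i<n. (q (snd z i))\<^sup>2)))"
    proof (rule AE_I2, clarsimp simp: space_pair_measure simp del: abs_mult)
      fix x y assume x: "x \<in> space ?PX" and y: "y \<in> space ?PY"
      have "norm (g \<pi> x y) = (\<Prod>i<n. norm (V (x i) (y i) * W (y i) (x (\<pi> i))))"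
        by (simp add: g_def prod_norm)
      also have "\<dots> \<le> (\<Prod>i<n. (c * (p (x i) * q (y i))) * (d * (p (x (\<pi> i)) * q (y i))))"
        unfolding norm_mult using spX[OF x] spY[OF y] perm_lt[OF \<pi>] p0 q0 c d
        by (intro prod_mono conjI mult_mono Vb Wb mult_nonneg_nonneg) auto
      also have "\<dots> = (c * d) ^ n * ((\<Prod>i<n. p (x i)) * (\<Prod>i<n. p (x (\<pi> i))) * (\<Prod>i<n. (q (y i))\<^sup>2))"
        by (simp add: prod.distrib power2_eq_square power_mult_distrib)
      also have "(\<Prod>i<n. p (x (\<pi> i))) = (\<Prod>i<n. p (x i))"
        using prod.permute[OF \<pi>, of "\<lambda>i. p (x i)"] by (simp add: o_def)
      finally have "norm (g \<pi> x y) \<le> (c * d) ^ n * ((\<Prod>i<n. (p (x i))\<^sup>2) * (\<Prod>i<n. (q (y i))\<^sup>2))"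
        by (simp add: power2_eq_square prod.distrib)
      then show "norm (g \<pi> x y) \<le> \<bar>(c * d) ^ n * ((\<Prod>i<n. (p (x i))\<^sup>2) * (\<Prod>i<n. (q (y i))\<^sup>2))\<bar>"
        by linarith
    qed
  qed
  have "fredholm_term n X (\<lambda>x x'. LINT y|Y. V x y * W y x') =
      (LINT x|?PX. (\<Sum>\<pi>\<in>?S. of_int (sign \<pi>) * (LINT y|?PY. g \<pi> x y)))"
    unfolding fredholm_term_def
    by (intro Bochner_Integration.integral_cong refl, subst det_leibniz, intro sum.cong refl) (simp add: gx)
  also have "\<dots> = (\<Sum>\<pi>\<in>?S. of_int (sign \<pi>) * (LINT x|?PX. LINT y|?PY. g \<pi> x y))"
    using XY.integrable_fst'[OF g_int] by (subst Bochner_Integration.integral_sum) (auto simp: split_beta')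
  also have "\<dots> = (\<Sum>\<pi>\<in>?S. of_int (sign \<pi>) * (LINT y|?PY. LINT x|?PX. g \<pi> x y))"
    by (intro sum.cong refl arg_cong2[of _ _ _ _ "(*)"], rule XY.Fubini_integral[symmetric]) (use g_int in auto)
  also have "\<dots> = (LINT y|?PY. (\<Sum>\<pi>\<in>?S. of_int (sign \<pi>) * (LINT x|?PX. g \<pi> x y)))"
    using XY.integrable_snd[OF g_int] by (subst Bochner_Integration.integral_sum) (auto simp: split_beta')
  also have "\<dots> = fredholm_term n Y (\<lambda>y y'. LINT x|X. W y x * V x y')"
    unfolding fredholm_term_def
  proof (intro Bochner_Integration.integral_cong refl)
    fix y assume y: "y \<in> space ?PY"
    have "(\<Sum>\<pi>\<in>?S. of_int (sign \<pi>) * (LINT x|?PX. g \<pi> x y)) =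
        (\<Sum>\<pi>\<in>?S. of_int (sign (Hilbert_Choice.inv \<pi>)) * (\<Prod>i<n. LINT x|X. W (y (Hilbert_Choice.inv \<pi> i)) x * V x (y i)))"
      by (intro sum.cong refl) (auto simp: gy y sign_inverse[OF permutes_imp_permutation[OF finite_lessThan]])
    also have "\<dots> = (\<Sum>\<pi>\<in>?S. of_int (sign \<pi>) * (\<Prod>i<n. LINT x|X. W (y (\<pi> i)) x * V x (y i)))"
      by (rule sum_permutations_inverse[symmetric])
    finally show "(\<Sum>\<pi>\<in>?S. of_int (sign \<pi>) * (LINT x|?PX. g \<pi> x y)) =
      Determinant.det (mat n n (\<lambda>(i, j). LINT x|X. W (y i) x * V x (y j)))"
      by (simp add: det_leibniz_col)
  qed
  finally show ?thesis .
qed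

section \<open>Domination and analyticity of integrals with a parameter\<close>

lemma norm_integral_le:
  fixes f :: "'a \<Rightarrow> 'b :: {real_normed_field, banach, second_countable_topology}"
  assumes g: "integrable M g" and le: "\<And>x. x \<in> space M \<Longrightarrow> norm (f x) \<le> g x"
  shows "norm (LINT x|M. f x) \<le> (LINT x|M. g x)"
proof (cases "integrable M f")
  case True
  have "norm (LINT x|M. f x) \<le> (LINT x|M. norm (f x))" by (rule integral_norm_bound)
  also have "\<dots> \<le> (LINT x|M. g x)"
    using True g le by (intro integral_mono) auto
  finally show ?thesis .
next
  case False
  \<comment> \<open>A function that is not integrable has integral 0 by convention, so here the
    claim is that the majorant has a nonnegative integral.\<close>
  have "0 \<le> (LINT x|M. g x)"
    using le norm_ge_zero order_trans by (intro Bochner_Integration.integral_nonneg_AE AE_I2) blast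
  then show ?thesis using False by (simp add: not_integrable_integral_eq)
qed

text \<open>On discs of half the radius, Cauchy's inequality turns the majorant g into the Lipschitz
  constant 2 g / r, which dominates the difference quotients; dominated convergence along sequences
  gives the derivative. With a counting measure for M this also covers series.\<close>

lemma holomorphic_on_integral:
  fixes f :: "complex \<Rightarrow> 'a \<Rightarrow> complex"
  assumes A: "open A"
    and hol: "\<And>x. x \<in> space M \<Longrightarrow> (\<lambda>z. f z x) holomorphic_on A"
    and meas: "\<And>z. z \<in> A \<Longrightarrow> f z \<in> borel_measurable M"
    and dom: "\<And>z. z \<in> A \<Longrightarrow> \<exists>r>0. \<exists>g. cball z r \<subseteq> A \<and> integrable M g \<and>
        (\<forall>w\<in>cball z r. \<forall>x\<in>space M. norm (f w x) \<le> g x)"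
  shows "(\<lambda>z. LINT x|M. f z x) holomorphic_on A"
proof -
  have "\<exists>D. ((\<lambda>z. LINT x|M. f z x) has_field_derivative D) (at z)" if z: "z \<in> A" for z
  proof -
    obtain r g where r: "r > 0" "cball z r \<subseteq> A" and g: "integrable M g"
      and fg: "\<And>w x. w \<in> cball z r \<Longrightarrow> x \<in> space M \<Longrightarrow> norm (f w x) \<le> g x"
      using dom[OF z] by blast
    have int: "integrable M (f w)" if "w \<in> cball z r" for w
      using fg[OF that] r that
      by (intro Bochner_Integration.integrable_bound[OF g meas]) (auto intro!: AE_I2 order_trans[OF _ abs_ge_self])
    define f' where "f' x = deriv (\<lambda>w. f w x) z" for x
    define dq where "dq w x = (f w x - f z x) / (w - z)" for w x
    have lip: "norm (f w x - f z x) \<le> (2 / r * g x) * norm (w - z)"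
      if w: "w \<in> cball z (r / 2)" and x: "x \<in> space M" for w x
    proof (rule field_differentiable_bound[of "cball z (r / 2)" "\<lambda>w. f w x" "\<lambda>w. deriv (\<lambda>w. f w x) w"])
      fix u assume u: "u \<in> cball z (r / 2)"
      have sub: "cball u (r / 2) \<subseteq> cball z r"
      proof
        fix w assume "w \<in> cball u (r / 2)"
        then show "w \<in> cball z r" using u dist_triangle[of z w u] by simp
      qed
      have hu: "(\<lambda>w. f w x) holomorphic_on cball u (r / 2)"
        by (rule holomorphic_on_subset[OF hol[OF x]]) (use sub r in auto)
      have "u \<in> A" using u r by (auto simp: subset_iff)
      then show "((\<lambda>w. f w x) has_field_derivative deriv (\<lambda>w. f w x) u) (at u within cball z (r / 2))"
        using holomorphic_derivI[OF hol[OF x] A] by (meson has_field_derivative_at_within)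
      have "norm ((deriv ^^ 1) (\<lambda>w. f w x) u) \<le> fact 1 * g x / (r / 2) ^ 1"
        using r hu sub x
        by (intro Cauchy_inequality holomorphic_on_imp_continuous_on fg)
           (auto intro: holomorphic_on_subset simp: dist_norm subset_iff)
      then show "norm (deriv (\<lambda>w. f w x) u) \<le> 2 / r * g x" by (simp add: mult.commute)
    qed (use w r in auto)
    have "((\<lambda>w. LINT x|M. dq w x) \<longlongrightarrow> (LINT x|M. f' x)) (at z)"
      unfolding tendsto_at_iff_sequentially
    proof -
      show "\<forall>X. (\<forall>i. X i \<in> UNIV - {z}) \<longrightarrow> X \<longlonglongrightarrow> z \<longrightarrow>
          ((\<lambda>w. LINT x|M. dq w x) \<circ> X) \<longlonglongrightarrow> (LINT x|M. f' x)"
      proof (intro allI impI)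
        fix X :: "nat \<Rightarrow> complex" assume X: "\<forall>i. X i \<in> UNIV - {z}" "X \<longlonglongrightarrow> z"
        have "\<forall>\<^sub>F i in sequentially. X i \<in> ball z (r / 2)"
          using X(2) r by (intro topological_tendstoD) auto
        then obtain N where N: "\<And>i. i \<ge> N \<Longrightarrow> X i \<in> ball z (r / 2)"
          by (auto simp: eventually_sequentially)
        \<comment> \<open>Dropping the first N terms puts every term into the disc where the
          Lipschitz bound holds.\<close>
        define X' where "X' i = X (i + N)" for i
        have X': "X' i \<in> cball z (r / 2)" "X' i \<noteq> z" "X' i \<in> cball z r" "X' i \<in> A" for i
          using N[of "i + N"] X(1) r by (auto simp: X'_def)
        have X'lim: "X' \<longlonglongrightarrow> z" unfolding X'_def using X(2) by (rule LIMSEQ_ignore_initial_segment)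
        have ptw: "(\<lambda>i. dq (X' i) x) \<longlonglongrightarrow> f' x" if x: "x \<in> space M" for x
        proof -
          have "((\<lambda>w. f w x) has_field_derivative f' x) (at z)"
            unfolding f'_def by (rule holomorphic_derivI[OF hol[OF x] A z])
          then have "((\<lambda>w. dq w x) \<longlongrightarrow> f' x) (at z)"
            by (simp add: has_field_derivative_iff dq_def)
          then show ?thesis
            using X'lim X'(2) by (auto simp: tendsto_at_iff_sequentially o_def)
        qed
        have measdq: "dq (X' i) \<in> borel_measurable M" for i
          unfolding dq_def using meas[OF X'(4)] meas[OF z] by measurable
        have "(\<lambda>i. LINT x|M. dq (X' i) x) \<longlonglongrightarrow> (LINT x|M. f' x)"
        proof (rule integral_dominated_convergence[where w = "\<lambda>x. 2 / r * g x"])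
          show "f' \<in> borel_measurable M"
            by (rule borel_measurable_LIMSEQ_metric[OF measdq ptw])
          show "AE x in M. norm (dq (X' i) x) \<le> 2 / r * g x" for i
            using lip[OF X'(1)[of i]] X'(2)[of i]
            by (intro AE_I2) (simp add: dq_def norm_divide divide_le_eq)
        qed (use g ptw measdq in auto)
        then have "(\<lambda>i. ((\<lambda>w. LINT x|M. dq w x) \<circ> X) (i + N)) \<longlonglongrightarrow> (LINT x|M. f' x)"
          by (simp add: X'_def o_def)
        then show "((\<lambda>w. LINT x|M. dq w x) \<circ> X) \<longlonglongrightarrow> (LINT x|M. f' x)"
          by (rule LIMSEQ_offset)
      qed
    qed
    moreover have "\<forall>\<^sub>F w in at z. (LINT x|M. dq w x) = ((LINT x|M. f w x) - (LINT x|M. f z x)) / (w - z)"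
    proof -
      have "\<forall>\<^sub>F w in at z. w \<in> ball z r"
        using r by (intro eventually_at_in_open') auto
      then show ?thesis
      proof eventually_elim
        case (elim w)
        then show ?case using int[of w] int[of z] r by (simp add: dq_def)
      qed
    qed
    ultimately have "((\<lambda>w. ((LINT x|M. f w x) - (LINT x|M. f z x)) / (w - z)) \<longlongrightarrow> (LINT x|M. f' x)) (at z)"
      using tendsto_cong by fast
    then show ?thesis by (auto simp: has_field_derivative_iff)
  qed
  then show ?thesis
    using A by (auto simp: holomorphic_on_open field_differentiable_def)
qed

section \<open>Convergence, continuity and analyticity of Fredholm series\<close>

lemma measurable_kernel_PiM:
  assumes K: "(\<lambda>(s, t). K s t) \<in> borel_measurable (M \<Otimes>\<^sub>M M)" and ij: "i \<in> I" "j \<in> I"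
  shows "(\<lambda>x. K (x i) (x j)) \<in> borel_measurable (PiM I (\<lambda>_. M))"
proof -
  have "(\<lambda>x. (x i, x j)) \<in> PiM I (\<lambda>_. M) \<rightarrow>\<^sub>M M \<Otimes>\<^sub>M M"
    using ij by (intro measurable_Pair measurable_component_singleton)
  from measurable_compose[OF this K] show ?thesis by simp
qed

lemma permutes_lessThan: "\<pi> permutes {..<n} \<Longrightarrow> i < n \<Longrightarrow> \<pi> i < (n :: nat)"
  using permutes_in_image[of \<pi> "{..<n}" i] by simp

lemma measurable_det_kernel:
  fixes K :: "'a \<Rightarrow> 'a \<Rightarrow> 'b :: {real_normed_field, second_countable_topology}"
  assumes K: "(\<lambda>(s, t). K s t) \<in> borel_measurable (M \<Otimes>\<^sub>M M)"
  shows "(\<lambda>x. point_det n K x) \<in> borel_measurable (PiM {..<n} (\<lambda>_. M))"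
  unfolding det_leibniz
  by (intro borel_measurable_sum borel_measurable_times borel_measurable_const borel_measurable_prod
      measurable_kernel_PiM[OF K]) (auto simp: permutes_lessThan)

text \<open>Majorant of the n-th term of a Fredholm series: n^(n/2) is the Hadamard factor, and a is
  the kernel bound times the mass of the weight.\<close>

definition hadamard_coeff :: "real \<Rightarrow> nat \<Rightarrow> real"
  where "hadamard_coeff a n = sqrt (real n) ^ n * a ^ n / fact n"

lemma power_le_fact_exp: "real n ^ n \<le> fact n * exp (real n)"
proof -
  have "real n ^ n / fact n \<le> exp (real n)"
    using summable_exp_generic[of "real n"]
    by (subst exp_def) (rule order_trans[OF _ sum_le_suminf[of _ "{n}"]], auto simp: divide_inverse mult.commute)
  then show ?thesis by (simp add: field_simps)
qed

lemma summable_power_div_sqrt_fact: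
  assumes "x \<ge> 0"
  shows "summable (\<lambda>n. x ^ n / sqrt (fact n :: real))"
proof -
  obtain N :: nat where N: "N > (2 * x)\<^sup>2" using reals_Archimedean2 by blast
  show ?thesis
  proof (rule summable_ratio_test[of "1/2" N])
    fix n assume "n \<ge> N"
    then have "(2 * x)\<^sup>2 \<le> real (Suc n)" using N by simp
    then have le: "2 * x \<le> sqrt (real (Suc n))" by (rule real_le_rsqrt)
    have "norm (x ^ Suc n / sqrt (fact (Suc n))) = x / sqrt (real (Suc n)) * (x ^ n / sqrt (fact n))"
      using assms by (simp add: real_sqrt_mult)
    also have "\<dots> \<le> 1 / 2 * (x ^ n / sqrt (fact n))"
      using assms le by (intro mult_right_mono) (auto simp: field_simps)
    finally show "norm (x ^ Suc n / sqrt (fact (Suc n))) \<le> 1 / 2 * norm (x ^ n / sqrt (fact n))"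
      using assms by simp
  qed simp
qed

text \<open>By \<open>power_le_fact_exp\<close> the Hadamard factor costs only a square root of n!,
  and the other square root still makes the series converge for every a.\<close>

lemma summable_hadamard_coeff:
  assumes "a \<ge> 0"
  shows "summable (hadamard_coeff a)"
proof (rule summable_comparison_test')
  show "summable (\<lambda>n. (exp (1/2) * a) ^ n / sqrt (fact n :: real))"
    using assms by (intro summable_power_div_sqrt_fact) simp
  fix n :: nat
  have "sqrt (real n) ^ n \<le> sqrt (fact n * exp (real n))"
    unfolding real_sqrt_power[symmetric] using power_le_fact_exp by (rule real_sqrt_le_mono)
  also have "\<dots> = sqrt (fact n) * exp (1/2) ^ n"
    by (simp add: real_sqrt_mult exp_of_nat_mult[symmetric] real_sqrt_unique flip: exp_double)
  finally have *: "sqrt (real n) ^ n \<le> sqrt (fact n) * exp (1/2) ^ n" .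
  have "norm (hadamard_coeff a n) = sqrt (real n) ^ n * a ^ n / fact n"
    using assms by (simp add: hadamard_coeff_def)
  also have "\<dots> \<le> sqrt (fact n) * exp (1/2) ^ n * a ^ n / fact n"
    using assms by (intro divide_right_mono mult_right_mono *) auto
  also have "\<dots> = (exp (1/2) * a) ^ n * (sqrt (fact n) / fact n)" by (simp add: power_mult_distrib)
  also have "sqrt (fact n :: real) / fact n = 1 / sqrt (fact n)"
    by (simp add: real_divide_square_eq field_simps)
  finally show "norm (hadamard_coeff a n) \<le> (exp (1/2) * a) ^ n / sqrt (fact n)" by simp
qed

text \<open>Stands in for trace class theory: a kernel bounded by c q(s) q(t) has an absolutely
  convergent Fredholm series, controlled by c times the squared L^2 norm of q, which is
  \<open>mass\<close>.\<close>

locale fredholm_weight = sigma_finite_measure M for M :: "'a measure" +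
  fixes q :: "'a \<Rightarrow> real"
  assumes q_int: "integrable M (\<lambda>x. (q x)\<^sup>2)" and q_nonneg: "\<And>x. x \<in> space M \<Longrightarrow> q x \<ge> 0"
begin

definition mass :: real where "mass = (LINT x|M. (q x)\<^sup>2)"

definition dominated :: "real \<Rightarrow> ('a \<Rightarrow> 'a \<Rightarrow> complex) \<Rightarrow> bool"
  where "dominated c K \<longleftrightarrow> (\<lambda>(s, t). K s t) \<in> borel_measurable (M \<Otimes>\<^sub>M M) \<and>
    (\<forall>s\<in>space M. \<forall>t\<in>space M. norm (K s t) \<le> c * (q s * q t))"

lemma mass_nonneg: "mass \<ge> 0"
  unfolding mass_def by simp

lemma integrable_weight:
  fixes n :: nat
  shows "integrable (PiM {..<n} (\<lambda>_. M)) (\<lambda>x. \<Prod>i<n. (q (x i))\<^sup>2)"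
proof -
  interpret product_sigma_finite "\<lambda>_::nat. M" ..
  show ?thesis by (rule product_integrable_prod) (use q_int in auto)
qed

lemma integral_weight:
  fixes n :: nat
  shows "(LINT x|PiM {..<n} (\<lambda>_. M). (\<Prod>i<n. (q (x i))\<^sup>2)) = mass ^ n"
proof -
  interpret product_sigma_finite "\<lambda>_::nat. M" ..
  show ?thesis using q_int by (subst product_integral_prod) (auto simp: mass_def)
qed

lemma det_bound:
  assumes K: "dominated c K" and c: "c \<ge> 0" and x: "x \<in> space (PiM {..<n} (\<lambda>_. M))"
  shows "norm (point_det n K x)
    \<le> sqrt (real n) ^ n * c ^ n * (\<Prod>i<n. (q (x i))\<^sup>2)"
proof -
  have xi: "x i \<in> space M" if "i < n" for i using x that by (auto simp: space_PiM)
  have "norm (point_det n K x)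
    \<le> sqrt (real n) ^ n * (\<Prod>i<n. c * q (x i)) * (\<Prod>i<n. q (x i))"
    using K c xi q_nonneg by (intro hadamard_bound) (auto simp: dominated_def mult.assoc)
  then show ?thesis by (simp add: prod.distrib power2_eq_square mult_ac)
qed

lemma integrable_det:
  assumes K: "dominated c K" and c: "c \<ge> 0"
  shows "integrable (PiM {..<n} (\<lambda>_. M)) (\<lambda>x. point_det n K x)"
proof (rule Bochner_Integration.integrable_bound)
  show "integrable (PiM {..<n} (\<lambda>_. M)) (\<lambda>x. sqrt (real n) ^ n * c ^ n * (\<Prod>i<n. (q (x i))\<^sup>2))"
    by (intro Bochner_Integration.integrable_mult_right integrable_weight)
  show "(\<lambda>x. point_det n K x) \<in> borel_measurable (PiM {..<n} (\<lambda>_. M))"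
    using K by (intro measurable_det_kernel) (simp add: dominated_def)
qed (use det_bound[OF K c] in \<open>auto intro!: AE_I2 intro: order_trans[OF _ abs_ge_self]\<close>)

lemma fredholm_term_bound:
  assumes K: "dominated c K" and c: "c \<ge> 0"
  shows "norm (fredholm_term n M K) \<le> sqrt (real n) ^ n * c ^ n * mass ^ n"
proof -
  have "norm (fredholm_term n M K) \<le>
    (LINT x|PiM {..<n} (\<lambda>_. M). sqrt (real n) ^ n * c ^ n * (\<Prod>i<n. (q (x i))\<^sup>2))"
    unfolding fredholm_term_def
    using integrable_weight by (intro norm_integral_le det_bound[OF K c]) auto
  then show ?thesis by (simp add: integral_weight)
qed

lemma fredholm_summand_bound:
  assumes K: "dominated c K" and c: "c \<ge> 0"
  shows "norm ((-1) ^ n / fact n * fredholm_term n M K) \<le> hadamard_coeff (c * mass) n"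
  using fredholm_term_bound[OF K c, of n]
  by (simp add: norm_mult norm_divide norm_power hadamard_coeff_def power_mult_distrib divide_right_mono mult_ac)

lemma summable_fredholm:
  assumes K: "dominated c K" and c: "c \<ge> 0"
  shows "summable (\<lambda>n. (-1) ^ n / fact n * fredholm_term n M K)"
  by (rule summable_comparison_test'[OF summable_hadamard_coeff fredholm_summand_bound[OF K c]])
     (use c mass_nonneg in auto)

text \<open>Replacing rows costs a factor n \<le> 2^n, whence the 2 in the argument of
  \<open>hadamard_coeff\<close>; the n - 1 unchanged rows supply c^(n-1) = c^n / c, whence \<eta> /
  c.\<close>

lemma fredholm_det_diff:
  assumes K: "dominated c K" and L: "dominated c L" and c: "c > 0"
    and KL: "\<And>s t. s \<in> space M \<Longrightarrow> t \<in> space M \<Longrightarrow> norm (K s t - L s t) \<le> \<eta> * (q s * q t)" and \<eta>: "\<eta> \<ge> 0"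
  shows "norm (fredholm_det M K - fredholm_det M L) \<le> \<eta> / c * (\<Sum>n. hadamard_coeff (2 * c * mass) n)"
proof -
  have c0: "c \<ge> 0" using c by simp
  have term_le: "norm ((-1) ^ n / fact n * fredholm_term n M K - (-1) ^ n / fact n * fredholm_term n M L)
      \<le> \<eta> / c * hadamard_coeff (2 * c * mass) n" for n
  proof -
    have "fredholm_term n M K - fredholm_term n M L = (LINT x|PiM {..<n} (\<lambda>_. M).
        (point_det n K x - point_det n L x))"
      unfolding fredholm_term_def
      by (intro Bochner_Integration.integral_diff[symmetric] integrable_det[OF K c0] integrable_det[OF L c0])
    also have "norm \<dots> \<le> (LINT x|PiM {..<n} (\<lambda>_. M).
        \<eta> * (real n * sqrt (real n) ^ n * c ^ (n - 1)) * (\<Prod>i<n. (q (x i))\<^sup>2))"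
    proof (intro norm_integral_le Bochner_Integration.integrable_mult_right integrable_weight)
      fix x assume "x \<in> space (PiM {..<n} (\<lambda>_. M))"
      then have xi: "x i \<in> space M" if "i < n" for i using that by (auto simp: space_PiM)
      show "norm (point_det n K x - point_det n L x)
        \<le> \<eta> * (real n * sqrt (real n) ^ n * c ^ (n - 1)) * (\<Prod>i<n. (q (x i))\<^sup>2)"
        using xi K L KL \<eta> c0 q_nonneg by (intro hadamard_diff_bound) (auto simp: dominated_def)
    qed
    also have "\<dots> = \<eta> / c * (real n * sqrt (real n) ^ n * (c * mass) ^ n)"
      unfolding Bochner_Integration.integral_mult_right_zero integral_weight
      using c by (cases n) (auto simp: power_mult_distrib)
    also have "\<dots> \<le> \<eta> / c * (2 ^ n * sqrt (real n) ^ n * (c * mass) ^ n)"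
      using \<eta> c mass_nonneg by (intro mult_left_mono mult_right_mono) (auto simp: of_nat_less_two_power less_imp_le)
    finally have "norm (fredholm_term n M K - fredholm_term n M L) / fact n
        \<le> \<eta> / c * (2 ^ n * sqrt (real n) ^ n * (c * mass) ^ n) / fact n"
      by (rule divide_right_mono) simp
    then show ?thesis
      unfolding right_diff_distrib[symmetric] norm_mult
      by (simp add: norm_divide norm_power hadamard_coeff_def power_mult_distrib mult_ac)
  qed
  have sm: "summable (\<lambda>n. \<eta> / c * hadamard_coeff (2 * c * mass) n)"
    using c mass_nonneg by (intro summable_mult summable_hadamard_coeff) auto
  have "norm (fredholm_det M K - fredholm_det M L) =
     norm (\<Sum>n. (-1) ^ n / fact n * fredholm_term n M K - (-1) ^ n / fact n * fredholm_term n M L)"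
    unfolding fredholm_det_terms by (subst suminf_diff[OF summable_fredholm[OF K c0] summable_fredholm[OF L c0]]) simp
  also have "\<dots> \<le> (\<Sum>n. \<eta> / c * hadamard_coeff (2 * c * mass) n)"
    by (rule norm_suminf_le[OF term_le sm])
  also have "\<dots> = \<eta> / c * (\<Sum>n. hadamard_coeff (2 * c * mass) n)"
    using c mass_nonneg by (intro suminf_mult summable_hadamard_coeff) auto
  finally show ?thesis .
qed

end

text \<open>The terms are analytic by \<open>holomorphic_on_integral\<close>, and the Hadamard
  majorants give uniform convergence on small discs. Weight and bound may change with the disc,
  because the decay of the symbol used later degenerates as |z| tends to 1.\<close>

lemma fredholm_det_holomorphic:
  fixes K :: "complex \<Rightarrow> 'a \<Rightarrow> 'a \<Rightarrow> complex"
  assumes M: "sigma_finite_measure M" and A: "open A"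
    and hol: "\<And>s t. s \<in> space M \<Longrightarrow> t \<in> space M \<Longrightarrow> (\<lambda>z. K z s t) holomorphic_on A"
    and dom: "\<And>z. z \<in> A \<Longrightarrow> \<exists>r>0. \<exists>q c. cball z r \<subseteq> A \<and> fredholm_weight M q \<and> c \<ge> 0 \<and>
        (\<forall>w\<in>cball z r. fredholm_weight.dominated M q c (K w))"
  shows "(\<lambda>z. fredholm_det M (K z)) holomorphic_on A"
proof -
  have term_hol: "(\<lambda>z. fredholm_term n M (K z)) holomorphic_on A" for n
    unfolding fredholm_term_def
  proof (rule holomorphic_on_integral[OF A])
    fix x assume "x \<in> space (PiM {..<n} (\<lambda>_. M))"
    then have xi: "x i \<in> space M" if "i < n" for i using that by (auto simp: space_PiM)
    show "(\<lambda>z. point_det n (K z) x) holomorphic_on A"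
      unfolding det_leibniz
      by (intro holomorphic_intros hol xi) (auto simp: permutes_lessThan)
  next
    fix z assume z: "z \<in> A"
    from dom[OF z] obtain r q c where r: "r > 0" "cball z r \<subseteq> A" "fredholm_weight M q" "c \<ge> 0"
      and d: "\<And>w. w \<in> cball z r \<Longrightarrow> fredholm_weight.dominated M q c (K w)" by blast
    interpret fredholm_weight M q by fact
    show "(\<lambda>x. point_det n (K z) x) \<in> borel_measurable (PiM {..<n} (\<lambda>_. M))"
      using d[of z] r by (intro measurable_det_kernel) (simp add: dominated_def)
    show "\<exists>r>0. \<exists>g. cball z r \<subseteq> A \<and> integrable (PiM {..<n} (\<lambda>_. M)) g \<and>
        (\<forall>w\<in>cball z r. \<forall>x\<in>space (PiM {..<n} (\<lambda>_. M)).
           norm (point_det n (K w) x) \<le> g x)"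
      using r integrable_weight[of n] det_bound[OF d r(4)]
      by (intro exI[of _ r] exI[of _ "\<lambda>x. sqrt (real n) ^ n * c ^ n * (\<Prod>i<n. (q (x i))\<^sup>2)"] conjI ballI) auto
  qed
  show ?thesis
  proof (rule holomorphic_uniform_sequence[OF A])
    show "(\<lambda>z. \<Sum>n<N. (-1) ^ n / fact n * fredholm_term n M (K z)) holomorphic_on A" for N
      by (intro holomorphic_intros term_hol)
    fix z assume z: "z \<in> A"
    from dom[OF z] obtain r q c where r: "r > 0" "cball z r \<subseteq> A" "fredholm_weight M q" "c \<ge> 0"
      and d: "\<And>w. w \<in> cball z r \<Longrightarrow> fredholm_weight.dominated M q c (K w)" by blast
    interpret fredholm_weight M q by fact
    have "uniform_limit (cball z r) (\<lambda>N w. \<Sum>n<N. (-1) ^ n / fact n * fredholm_term n M (K w))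
       (\<lambda>w. \<Sum>n. (-1) ^ n / fact n * fredholm_term n M (K w)) sequentially"
      using r mass_nonneg
      by (intro Weierstrass_m_test[OF fredholm_summand_bound[OF d] summable_hadamard_coeff]) auto
    then show "\<exists>d>0. cball z d \<subseteq> A \<and> uniform_limit (cball z d)
        (\<lambda>N w. \<Sum>n<N. (-1) ^ n / fact n * fredholm_term n M (K w)) (\<lambda>z. fredholm_det M (K z)) sequentially"
      using r unfolding fredholm_det_terms by blast
  qed
qed

section \<open>Sums over the roots of exp (- \<xi>^2 / 2) = z\<close>

(* The root is parametrised by w with exp w = z; shifting w by 2 \<pi> i runs through S_minus z. *)
definition xi :: "complex \<Rightarrow> complex"
  where "xi w = - csqrt (- 2 * w)"

lemma xi_square: "(xi w)\<^sup>2 = - 2 * w"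
  by (simp add: xi_def)

lemma Re_xi_neg:
  assumes "Re w < 0"
  shows "Re (xi w) < 0"
proof (rule ccontr)
  assume "\<not> Re (xi w) < 0"
  then have "Re (csqrt (- 2 * w)) = 0" using csqrt_principal[of "- 2 * w"] by (auto simp: xi_def)
  then have "Re ((csqrt (- 2 * w))\<^sup>2) \<le> 0" by (simp add: power2_eq_square)
  then show False using assms by simp
qed

lemma xi_nonzero: "Re w < 0 \<Longrightarrow> xi w \<noteq> 0"
  using Re_xi_neg by fastforce

lemma xi_eqI:
  assumes "u\<^sup>2 = - 2 * w" "Re u < 0"
  shows "u = xi w"
  using csqrt_unique[of "- u" "- 2 * w"] assms by (simp add: xi_def)

lemma xi_not_nonpos: "Re w < 0 \<Longrightarrow> - 2 * w \<notin> \<real>\<^sub>\<le>\<^sub>0"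
  by (auto simp: complex_nonpos_Reals_iff)

lemma xi_deriv:
  assumes "Re w < 0"
  shows "(xi has_field_derivative - 1 / xi w) (at w)"
proof -
  have "(xi has_field_derivative - (- 2 / (2 * csqrt (- 2 * w)))) (at w)"
    unfolding xi_def using xi_not_nonpos[OF assms]
    by (intro DERIV_minus has_field_derivative_csqrt' DERIV_cmult_Id)
  then show ?thesis using xi_nonzero[OF assms] by (simp add: xi_def)
qed

lemma xi_holomorphic: "xi holomorphic_on {w. Re w < 0}"
  unfolding xi_def by (intro holomorphic_intros) (auto simp: complex_nonpos_Reals_iff)

abbreviation shift :: "complex \<Rightarrow> int \<Rightarrow> complex"
  where "shift w k \<equiv> w + of_int (2 * k) * pi * \<i>"

abbreviation all_ints :: "int measure"
  where "all_ints \<equiv> count_space UNIV"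

lemma S_minus_bij:
  assumes w: "Re w < 0"
  shows "bij_betw (\<lambda>k::int. xi (shift w k)) UNIV (S_minus (exp w))"
proof (rule bij_betwI')
  fix k l :: int
  show "(xi (shift w k) = xi (shift w l)) = (k = l)"
  proof
    assume "xi (shift w k) = xi (shift w l)"
    then have "- 2 * (shift w k) = - 2 * (shift w l)"
      by (metis xi_square)
    then show "k = l" by (simp add: complex_eq_iff)
  qed simp
next
  fix k :: int
  have "exp (- (xi (shift w k))\<^sup>2 / 2) = exp w"
    unfolding xi_square exp_eq by (auto intro!: exI[of _ k])
  then show "xi (shift w k) \<in> S_minus (exp w)"
    using w by (auto simp: S_minus_def intro!: Re_xi_neg)
next
  fix u assume "u \<in> S_minus (exp w)"
  then have u: "exp (- u\<^sup>2 / 2) = exp w" "Re u < 0" by (auto simp: S_minus_def)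
  then obtain k where "- u\<^sup>2 / 2 = shift w k" unfolding exp_eq by auto
  then have "u\<^sup>2 = - 2 * (shift w k)"
    by (metis (no_types, lifting) divide_eq_eq_numeral1(1) minus_equation_iff mult.commute mult_minus_left zero_neq_numeral)
  then show "\<exists>k\<in>UNIV. u = xi (shift w k)" using xi_eqI u(2) by blast
qed

lemma countable_S_minus: "Re w < 0 \<Longrightarrow> countable (S_minus (exp w))"
  using S_minus_bij[of w] by (metis bij_betw_imp_surj_on countable_image countableI_type)

section \<open>Lattice sums and periodisation\<close>

lemma integral_exp_abs_int:
  fixes c :: real
  assumes c: "c > 0"
  shows "integrable (all_ints) (\<lambda>k. exp (- c * \<bar>of_int k\<bar>))"
    and "(LINT k|all_ints. exp (- c * \<bar>of_int k\<bar>)) \<le> 2 * (1 + 1 / c)"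
proof -
  let ?f = "\<lambda>k::int. exp (- c * \<bar>of_int k\<bar>) :: real"
  let ?A = "range int" and ?B = "range (\<lambda>n. - int (Suc n))"
  have UN: "UNIV = ?A \<union> ?B"
    using int_cases by blast
  have disj: "?A \<inter> ?B = {}" by auto
  define x where "x = exp (- c)"
  have x: "0 < x" "x < 1" using c by (auto simp: x_def)
  have fA: "?f (int n) = x ^ n" for n
    by (simp add: x_def exp_of_nat_mult[symmetric] mult.commute)
  have fB: "?f (- int (Suc n)) = x * x ^ n" for n
    by (simp add: x_def exp_of_nat_mult[symmetric] exp_add[symmetric] algebra_simps)
  have bA: "bij_betw int UNIV ?A" and bB: "bij_betw (\<lambda>n. - int (Suc n)) UNIV ?B"
    by (auto simp: bij_betw_def inj_on_def)
  have gs: "summable (\<lambda>n. x ^ n)" using x by (intro summable_geometric) simp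
  have iA: "integrable (count_space ?A) ?f"
    using gs x unfolding integrable_bij_count_space[OF bA, symmetric] fA
    by (simp add: integrable_count_space_nat_iff)
  have iB: "integrable (count_space ?B) ?f"
    using gs x unfolding integrable_bij_count_space[OF bB, symmetric] fB
    by (simp add: integrable_count_space_nat_iff summable_mult)
  show int: "integrable (count_space UNIV) ?f"
    using iA iB unfolding UN abs_summable_on_def[symmetric] by (rule abs_summable_on_union)
  have "(LINT k|count_space UNIV. ?f k) = (LINT k|count_space ?A. ?f k) + (LINT k|count_space ?B. ?f k)"
    using infsetsum_Un_disjoint[OF iA[folded abs_summable_on_def] iB[folded abs_summable_on_def] disj]
    unfolding infsetsum_def UN[symmetric] .
  also have "(LINT k|count_space ?A. ?f k) = 1 / (1 - x)"
    using gs x unfolding integral_bij_count_space[OF bA, symmetric] fA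
    by (subst integral_count_space_nat) (auto simp: integrable_count_space_nat_iff suminf_geometric)
  also have "(LINT k|count_space ?B. ?f k) = x * (1 / (1 - x))"
    using gs x unfolding integral_bij_count_space[OF bB, symmetric] fB
    by (subst integral_count_space_nat)
       (auto simp: integrable_count_space_nat_iff suminf_geometric suminf_mult summable_mult)
  also have "1 / (1 - x) + x * (1 / (1 - x)) \<le> 2 * (1 / (1 - x))"
    using x mult_right_mono[of x 1 "1 / (1 - x)"] by simp
  also have "1 / (1 - x) \<le> 1 + 1 / c"
  proof -
    have "x * (1 + c) \<le> x * exp c" using x by (intro mult_left_mono) auto
    also have "\<dots> = 1" by (simp add: x_def exp_minus)
    finally show ?thesis using x c by (simp add: field_simps)
  qed
  finally show "(LINT k|count_space UNIV. ?f k) \<le> 2 * (1 + 1 / c)" by simp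
qed

text \<open>Rounding \<theta> / (2 pi) reduces the offset to at most pi, at the cost of a factor exp
  (pi \<beta>); two geometric series remain. About 1 / \<beta> lattice points count, so \<beta>
  times the sum is bounded uniformly in \<beta> \<le> 1 and \<theta>.\<close>

lemma lattice_sum:
  fixes \<beta> \<theta> :: real
  assumes \<beta>: "0 < \<beta>"
  shows "integrable (all_ints) (\<lambda>k. exp (- \<beta> * \<bar>\<theta> + 2 * pi * of_int k\<bar>))"
    and "\<beta> \<le> 1 \<Longrightarrow> \<beta> * (LINT k|all_ints. exp (- \<beta> * \<bar>\<theta> + 2 * pi * of_int k\<bar>)) \<le> 4 * exp pi"
proof -
  define c where "c = 2 * pi * \<beta>"
  have c: "c > 0" using \<beta> by (simp add: c_def)
  define m where "m = round (\<theta> / (2 * pi))"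
  have m: "\<bar>\<theta> - 2 * pi * of_int m\<bar> \<le> pi"
  proof -
    have "\<bar>of_int m - \<theta> / (2 * pi)\<bar> \<le> 1 / 2" unfolding m_def by (rule of_int_round_abs_le)
    then have "2 * pi * \<bar>of_int m - \<theta> / (2 * pi)\<bar> \<le> 2 * pi * (1 / 2)" by (intro mult_left_mono) auto
    also have "2 * pi * \<bar>of_int m - \<theta> / (2 * pi)\<bar> = \<bar>2 * pi * (of_int m - \<theta> / (2 * pi))\<bar>" by (simp add: abs_mult)
    also have "2 * pi * (of_int m - \<theta> / (2 * pi)) = 2 * pi * of_int m - \<theta>" by (simp add: field_simps)
    finally show ?thesis by simp
  qed
  have bij: "bij_betw (\<lambda>k. k + m) UNIV (UNIV :: int set)"
    by (rule bij_betw_byWitness[where f' = "\<lambda>k. k - m"]) auto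
  note geo = integral_exp_abs_int[OF c]
  have le: "exp (- \<beta> * \<bar>\<theta> + 2 * pi * of_int k\<bar>) \<le> exp (pi * \<beta>) * exp (- c * \<bar>of_int (k + m)\<bar>)" for k
  proof -
    have "2 * pi * \<bar>of_int (k + m)\<bar> = \<bar>(\<theta> + 2 * pi * of_int k) - (\<theta> - 2 * pi * of_int m)\<bar>"
    proof -
      have "(\<theta> + 2 * pi * of_int k) - (\<theta> - 2 * pi * of_int m) = 2 * pi * of_int (k + m)"
        by (simp add: algebra_simps)
      then show ?thesis by (simp add: abs_mult)
    qed
    also have "\<dots> \<le> \<bar>\<theta> + 2 * pi * of_int k\<bar> + pi" using m by linarith
    finally have "\<beta> * (2 * pi * \<bar>of_int (k + m)\<bar>) \<le> \<beta> * (\<bar>\<theta> + 2 * pi * of_int k\<bar> + pi)"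
      using \<beta> by (intro mult_left_mono) auto
    then show ?thesis by (simp add: exp_add[symmetric] c_def algebra_simps)
  qed
  have g: "integrable (all_ints) (\<lambda>k. exp (pi * \<beta>) * exp (- c * \<bar>of_int (k + m)\<bar>))"
    using geo(1) integrable_bij_count_space[OF bij, of "\<lambda>k. exp (- c * \<bar>of_int k\<bar>)"] by simp
  show int: "integrable (all_ints) (\<lambda>k. exp (- \<beta> * \<bar>\<theta> + 2 * pi * of_int k\<bar>))"
    by (rule Bochner_Integration.integrable_bound[OF g]) (use le in auto)
  assume \<beta>1: "\<beta> \<le> 1"
  have "(LINT k|all_ints. exp (- \<beta> * \<bar>\<theta> + 2 * pi * of_int k\<bar>))
      \<le> (LINT k|count_space UNIV. exp (pi * \<beta>) * exp (- c * \<bar>of_int (k + m)\<bar>))"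
    by (intro integral_mono int g le)
  also have "\<dots> = exp (pi * \<beta>) * (LINT k|all_ints. exp (- c * \<bar>of_int k\<bar>))"
    using integral_bij_count_space[OF bij, of "\<lambda>k. exp (- c * \<bar>of_int k\<bar>)"] by simp
  also have "\<dots> \<le> exp pi * (2 * (1 + 1 / c))"
    using \<beta>1 \<beta> geo(2) by (intro mult_mono) (auto intro: order_trans[OF _ geo(2)])
  finally have "\<beta> * (LINT k|all_ints. exp (- \<beta> * \<bar>\<theta> + 2 * pi * of_int k\<bar>))
      \<le> \<beta> * (exp pi * (2 * (1 + 1 / c)))" using \<beta> by (intro mult_left_mono) auto
  also have "\<dots> = exp pi * (2 * \<beta> + 1 / pi)" using \<beta> by (simp add: c_def field_simps)
  also have "\<dots> \<le> exp pi * 4"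
  proof (intro mult_left_mono)
    have "1 / pi \<le> 1" using pi_gt3 by simp
    then show "2 * \<beta> + 1 / pi \<le> 4" using \<beta>1 by linarith
  qed simp
  finally show "\<beta> * (LINT k|all_ints. exp (- \<beta> * \<bar>\<theta> + 2 * pi * of_int k\<bar>)) \<le> 4 * exp pi"
    by (simp add: mult.commute)
qed

text \<open>Periodisation of G; by \<open>S_minus_bij\<close> a sum over the roots is of this form.
  As an integral over counting measure it is open to dominated convergence and to
  \<open>holomorphic_on_integral\<close>.\<close>

definition psum :: "(complex \<Rightarrow> complex) \<Rightarrow> complex \<Rightarrow> complex"
  where "psum G w = (LINT k|all_ints. G (shift w k))"

definition strip_decay :: "real \<Rightarrow> real \<Rightarrow> real \<Rightarrow> real \<Rightarrow> (complex \<Rightarrow> complex) \<Rightarrow> bool"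
  where "strip_decay \<beta> l1 l2 c G \<longleftrightarrow> (\<forall>w. - l2 \<le> Re w \<and> Re w \<le> - l1 \<longrightarrow> norm (G w) \<le> c * exp (- \<beta> * \<bar>Im w\<bar>))"

lemma strip_decayD:
  assumes "strip_decay \<beta> l1 l2 c G" "- l2 \<le> Re w" "Re w \<le> - l1"
  shows "norm (G (shift w k)) \<le> c * exp (- \<beta> * \<bar>Im w + 2 * pi * of_int k\<bar>)"
proof -
  have "Re (shift w k) = Re w" "Im (shift w k) = Im w + 2 * pi * of_int k"
    by simp_all
  then show ?thesis using assms unfolding strip_decay_def by metis
qed

lemma psum_summable:
  assumes "strip_decay \<beta> l1 l2 c G" "\<beta> > 0" "- l2 \<le> Re w" "Re w \<le> - l1"
  shows "integrable (all_ints) (\<lambda>k. G (shift w k))"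
proof (rule Bochner_Integration.integrable_bound)
  show "integrable (all_ints) (\<lambda>k. c * exp (- \<beta> * \<bar>Im w + 2 * pi * of_int k\<bar>))"
    using lattice_sum(1)[OF assms(2), of "Im w"] by simp
  show "AE k in count_space UNIV. norm (G (shift w k)) \<le> norm (c * exp (- \<beta> * \<bar>Im w + 2 * pi * of_int k\<bar>))"
    using strip_decayD[OF assms(1,3,4)] by (intro AE_I2) (auto intro: order_trans[OF _ abs_ge_self])
qed simp

text \<open>The factor \<beta> in the hypothesis pays for the roughly 1 / \<beta> lattice points
  within the decay length. It is used with \<beta> = \<delta>^2 and makes the bounds uniform in
  \<delta>.\<close>

lemma psum_bound:
  assumes G: "strip_decay \<beta> l1 l2 (\<beta> * c) G" and \<beta>: "0 < \<beta>" "\<beta> \<le> 1" and w: "- l2 \<le> Re w" "Re w \<le> - l1" and c: "c \<ge> 0"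
  shows "norm (psum G w) \<le> 4 * exp pi * c"
proof -
  have "norm (psum G w) \<le> (LINT k|all_ints. (\<beta> * c) * exp (- \<beta> * \<bar>Im w + 2 * pi * of_int k\<bar>))"
    unfolding psum_def
  proof (rule norm_integral_le)
    show "integrable (all_ints) (\<lambda>k. (\<beta> * c) * exp (- \<beta> * \<bar>Im w + 2 * pi * of_int k\<bar>))"
      using lattice_sum(1)[OF \<beta>(1), of "Im w"] by simp
  qed (rule strip_decayD[OF G w])
  also have "\<dots> = c * (\<beta> * (LINT k|all_ints. exp (- \<beta> * \<bar>Im w + 2 * pi * of_int k\<bar>)))"
    by simp
  also have "\<dots> \<le> c * (4 * exp pi)" by (intro mult_left_mono lattice_sum(2) \<beta> c)
  finally show ?thesis by (simp add: mult.commute)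
qed

lemma psum_periodic: "psum G (shift w m) = psum G w"
proof -
  have bij: "bij_betw (\<lambda>k. k + m) UNIV (UNIV :: int set)"
    by (rule bij_betw_byWitness[where f' = "\<lambda>k. k - m"]) auto
  show ?thesis
    using integral_bij_count_space[OF bij, of "\<lambda>k. G (shift w k)"]
    by (simp add: psum_def algebra_simps)
qed

lemma open_left_half_plane: "open {w. Re w < 0}"
  by (rule open_halfspace_Re_lt)

lemma psum_holomorphic:
  assumes G: "G holomorphic_on {w. Re w < 0}" and \<beta>: "\<beta> > 0"
    and decay: "\<And>l1 l2. 0 < l1 \<Longrightarrow> \<exists>c. strip_decay \<beta> l1 l2 c G"
  shows "psum G holomorphic_on {w. Re w < 0}"
  unfolding psum_def
proof (rule holomorphic_on_integral[OF open_left_half_plane])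
  fix k :: int
  show "(\<lambda>w. G (shift w k)) holomorphic_on {w. Re w < 0}"
    by (rule holomorphic_on_compose_gen[OF _ G, unfolded o_def]) (auto intro!: holomorphic_intros)
next
  fix z assume "z \<in> {w. Re w < 0}"
  then have z: "Re z < 0" by simp
  \<comment> \<open>Half the distance to the imaginary axis: the disc stays in the strip - 3 r \<le>
    Re w \<le> - r, and on it Im w moves by at most r, which costs exp (\<beta> r).\<close>
  define r where "r = - Re z / 2"
  have r: "r > 0" using z by (simp add: r_def)
  obtain c where c: "strip_decay \<beta> r (3 * r) c G" using decay[OF r] by blast
  have strip: "- (3 * r) \<le> Re w \<and> Re w \<le> - r \<and> \<bar>Im z - Im w\<bar> \<le> r" if "w \<in> cball z r" for w
  proof -
    have "\<bar>Re (z - w)\<bar> \<le> r" "\<bar>Im (z - w)\<bar> \<le> r"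
      using that abs_Re_le_cmod[of "z - w"] abs_Im_le_cmod[of "z - w"] by (auto simp: dist_norm)
    then show ?thesis by (auto simp: r_def)
  qed
  show "\<exists>r>0. \<exists>g. cball z r \<subseteq> {w. Re w < 0} \<and> integrable (all_ints) g \<and>
      (\<forall>w\<in>cball z r. \<forall>k\<in>space (count_space UNIV). norm (G (shift w k)) \<le> g k)"
  proof (intro exI[of _ r] exI[of _ "\<lambda>k. \<bar>c\<bar> * exp (\<beta> * r) * exp (- \<beta> * \<bar>Im z + 2 * pi * of_int k\<bar>)"] conjI r ballI)
    show "cball z r \<subseteq> {w. Re w < 0}" using strip r by fastforce
    show "integrable (all_ints) (\<lambda>k. \<bar>c\<bar> * exp (\<beta> * r) * exp (- \<beta> * \<bar>Im z + 2 * pi * of_int k\<bar>))"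
      using lattice_sum(1)[OF \<beta>, of "Im z"] by simp
    fix w k assume w: "w \<in> cball z r"
    have "norm (G (shift w k)) \<le> c * exp (- \<beta> * \<bar>Im w + 2 * pi * of_int k\<bar>)"
      using strip[OF w] by (intro strip_decayD[OF c]) auto
    also have "\<dots> \<le> \<bar>c\<bar> * exp (- \<beta> * \<bar>Im w + 2 * pi * of_int k\<bar>)"
      by (intro mult_right_mono) auto
    also have "\<dots> \<le> \<bar>c\<bar> * (exp (\<beta> * r) * exp (- \<beta> * \<bar>Im z + 2 * pi * of_int k\<bar>))"
    proof (intro mult_left_mono)
      have "\<bar>Im z + 2 * pi * of_int k\<bar> \<le> r + \<bar>Im w + 2 * pi * of_int k\<bar>" using strip[OF w] by linarith
      then have "\<beta> * \<bar>Im z + 2 * pi * of_int k\<bar> \<le> \<beta> * (r + \<bar>Im w + 2 * pi * of_int k\<bar>)"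
        using \<beta> by (intro mult_left_mono) auto
      then show "exp (- \<beta> * \<bar>Im w + 2 * pi * of_int k\<bar>) \<le> exp (\<beta> * r) * exp (- \<beta> * \<bar>Im z + 2 * pi * of_int k\<bar>)"
        by (simp add: exp_add[symmetric] algebra_simps)
    qed simp
    finally show "norm (G (shift w k)) \<le> \<bar>c\<bar> * exp (\<beta> * r) * exp (- \<beta> * \<bar>Im z + 2 * pi * of_int k\<bar>)"
      by (simp add: mult.assoc)
  qed
qed simp

text \<open>\<open>Ln\<close> jumps across the negative axis by 2 pi \<i>, which f does not see.
  Near z0 it may be replaced by the branch Ln (z / z0) + Ln z0, which is analytic there.\<close>

lemma periodic_Ln_holomorphic:
  assumes f: "f holomorphic_on {w. Re w < 0}"
    and per: "\<And>w m. f (shift w m) = f w"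
  shows "(\<lambda>z. f (Ln z)) holomorphic_on ball 0 1 - {0}"
proof -
  have op: "open (ball 0 1 - {0 :: complex})" by auto
  have "(\<lambda>z. f (Ln z)) field_differentiable at z0" if z0: "z0 \<in> ball 0 1 - {0}" for z0
  proof -
    let ?l = "\<lambda>z. Ln (z / z0) + Ln z0"
    have ev: "\<forall>\<^sub>F z in nhds z0. z \<in> ball 0 1 - {0}"
      using op z0 by (rule eventually_nhds_in_open)
    have eq: "f (Ln z) = f (?l z)" if z: "z \<in> ball 0 1 - {0}" for z
    proof -
      have "exp (Ln z) = exp (?l z)" using z z0 by (simp add: exp_add)
      then obtain m where "Ln z = shift (?l z) m" unfolding exp_eq by auto
      then show ?thesis using per by simp
    qed
    have "f field_differentiable at (?l z0)"
      using z0 by (intro holomorphic_on_imp_differentiable_at[OF f open_left_half_plane]) auto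
    moreover have "?l field_differentiable at z0"
    proof -
      have "(?l has_field_derivative inverse (z0 / z0) * (1 / z0) + 0) (at z0)"
        using z0 by (intro DERIV_add DERIV_const DERIV_chain2[where f = Ln] has_field_derivative_Ln DERIV_cdivide DERIV_ident) auto
      then show ?thesis unfolding field_differentiable_def by blast
    qed
    ultimately have "(\<lambda>z. f (?l z)) field_differentiable at z0"
      using field_differentiable_compose[of ?l z0 f] by (simp add: o_def)
    moreover have "\<forall>\<^sub>F z in nhds z0. f (Ln z) = f (?l z)" using eventually_mono[OF ev eq] .
    note DERIV_cong_ev[OF refl this refl]
    ultimately show ?thesis unfolding field_differentiable_def by simp
  qed
  then show ?thesis by (simp add: holomorphic_on_def field_differentiable_at_within)
qed

section \<open>Means over circles and the unfolding of periodised sums\<close>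

lemma contour_integral_bound_circlepath:
  assumes "f contour_integrable_on circlepath z r" "0 \<le> b" "0 < r"
    and "\<And>x. norm (x - z) = r \<Longrightarrow> norm (f x) \<le> b"
  shows "norm (contour_integral (circlepath z r) f) \<le> b * (2 * pi * r)"
  using has_contour_integral_bound_circlepath[OF has_contour_integral_integral[OF assms(1)]] assms by blast

text \<open>The mean is the zeroth Laurent coefficient of p. Cauchy's formula in the annulus gives p
  z0 as an integral over the outer circle minus one over the inner circle. Subtracting the mean
  turns the outer kernel into 1 / (z - z0) - 1 / z, which yields the first fraction; the inner
  circle yields the second.\<close>

lemma circle_mean_bound:
  fixes p :: "complex \<Rightarrow> complex"
  assumes p: "p holomorphic_on ball 0 1 - {0}"
    and r: "0 < r1" "r1 < norm z0" "norm z0 < r2" "r2 < 1"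
    and M: "\<And>z. norm z = r1 \<or> norm z = r2 \<Longrightarrow> norm (p z) \<le> M"
  shows "norm (p z0 - 1 / (2 * pi * \<i>) * contour_integral (circlepath 0 r2) (\<lambda>z. p z / z))
    \<le> M * (norm z0 / (r2 - norm z0) + r1 / (norm z0 - r1))"
proof -
  \<comment> \<open>The quotient has a removable singularity at z0, so its integrals over the two
    circles agree; splitting it gives Cauchy's formula in the annulus.\<close>
  define q where "q z = (if z = z0 then deriv p z0 else (p z - p z0) / (z - z0))" for z
  have op: "open (ball 0 1 - {0 :: complex})" by auto
  have q: "q holomorphic_on ball 0 1 - {0}"
    unfolding q_def by (rule pole_lemma_open[OF p op])
  have z0: "z0 \<noteq> 0" using r by auto
  have eq: "contour_integral (circlepath 0 r2) q = contour_integral (circlepath 0 r1) q"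
    using r by (intro contour_integral_circlepath_eq[OF _ q]) auto
  have cont: "continuous_on (sphere 0 \<rho>) p" if "\<rho> = r1 \<or> \<rho> = r2" for \<rho>
    by (rule continuous_on_subset[OF holomorphic_on_imp_continuous_on[OF p]]) (use r that in auto)
  have ne: "z \<noteq> z0" "z \<noteq> 0" if "norm z = \<rho>" "\<rho> = r1 \<or> \<rho> = r2" for z \<rho>
    using that r by auto
  have int1: "(\<lambda>z. p z / (z - z0)) contour_integrable_on circlepath 0 \<rho>" if "\<rho> = r1 \<or> \<rho> = r2" for \<rho>
    using that r ne[OF _ that] cont[OF that]
    by (intro contour_integrable_continuous_circlepath continuous_intros) auto
  have int2: "(\<lambda>z. p z0 / (z - z0)) contour_integrable_on circlepath 0 \<rho>" if "\<rho> = r1 \<or> \<rho> = r2" for \<rho>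
    using that r ne[OF _ that] by (intro contour_integrable_continuous_circlepath continuous_intros) auto
  have int3: "(\<lambda>z. p z / z) contour_integrable_on circlepath 0 r2"
    using r ne cont by (intro contour_integrable_continuous_circlepath continuous_intros) auto
  have split: "contour_integral (circlepath 0 \<rho>) q =
      contour_integral (circlepath 0 \<rho>) (\<lambda>z. p z / (z - z0)) - contour_integral (circlepath 0 \<rho>) (\<lambda>z. p z0 / (z - z0))"
    if "\<rho> = r1 \<or> \<rho> = r2" for \<rho>
  proof -
    have "contour_integral (circlepath 0 \<rho>) q = contour_integral (circlepath 0 \<rho>) (\<lambda>z. p z / (z - z0) - p z0 / (z - z0))"
      using r that ne[OF _ that] by (intro contour_integral_cong) (auto simp: q_def diff_divide_distrib)
    then show ?thesis by (simp add: contour_integral_diff int1 int2 that)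
  qed
  have c2: "contour_integral (circlepath 0 r2) (\<lambda>z. p z0 / (z - z0)) = 2 * pi * \<i> * p z0"
    using r Cauchy_integral_circlepath_simple[of "\<lambda>_. p z0" 0 r2 z0] by (intro contour_integral_unique) auto
  have c1: "contour_integral (circlepath 0 r1) (\<lambda>z. p z0 / (z - z0)) = 0"
    using r by (intro contour_integral_unique Cauchy_theorem_disc_simple[where a = 0 and e = "norm z0"])
      (auto intro!: holomorphic_intros)
  have "contour_integral (circlepath 0 r2) (\<lambda>z. p z / (z - z0)) - contour_integral (circlepath 0 r2) (\<lambda>z. p z / z)
      = contour_integral (circlepath 0 r2) (\<lambda>z. p z / (z - z0) - p z / z)"
    by (simp add: contour_integral_diff int1 int3)
  also have "\<dots> = contour_integral (circlepath 0 r2) (\<lambda>z. p z * z0 / (z * (z - z0)))"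
    using r ne by (intro contour_integral_cong) (auto simp: field_simps)
  finally have main: "2 * pi * \<i> * p z0 - contour_integral (circlepath 0 r2) (\<lambda>z. p z / z) =
      contour_integral (circlepath 0 r2) (\<lambda>z. p z * z0 / (z * (z - z0))) - contour_integral (circlepath 0 r1) (\<lambda>z. p z / (z - z0))"
    using eq split[of r1] split[of r2] c1 c2 by (simp add: algebra_simps)
  have M0: "M \<ge> 0" using r by (intro order_trans[OF norm_ge_zero M[of "of_real r1"]]) simp
  have b2: "norm (contour_integral (circlepath 0 r2) (\<lambda>z. p z * z0 / (z * (z - z0))))
      \<le> M * norm z0 / (r2 * (r2 - norm z0)) * (2 * pi * r2)"
  proof (rule contour_integral_bound_circlepath)
    show "(\<lambda>z. p z * z0 / (z * (z - z0))) contour_integrable_on circlepath 0 r2"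
      using r ne cont by (intro contour_integrable_continuous_circlepath continuous_intros) auto
    fix z :: complex assume "norm (z - 0) = r2"
    then have z: "norm z = r2" by simp
    have "norm (z - z0) \<ge> r2 - norm z0" using norm_triangle_ineq2[of z z0] z by simp
    then have "norm (p z) * norm z0 / (norm z * norm (z - z0)) \<le> M * norm z0 / (r2 * (r2 - norm z0))"
      using r z M[of z] M0 by (intro frac_le mult_mono mult_nonneg_nonneg) auto
    then show "norm (p z * z0 / (z * (z - z0))) \<le> M * norm z0 / (r2 * (r2 - norm z0))"
      by (simp add: norm_mult norm_divide)
  qed (use r M0 in auto)
  have b1: "norm (contour_integral (circlepath 0 r1) (\<lambda>z. p z / (z - z0))) \<le> M / (norm z0 - r1) * (2 * pi * r1)"
  proof (rule contour_integral_bound_circlepath)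
    fix z :: complex assume "norm (z - 0) = r1"
    then have z: "norm z = r1" by simp
    have "norm (z - z0) \<ge> norm z0 - r1" using norm_triangle_ineq2[of z0 z] z by (simp add: norm_minus_commute)
    then show "norm (p z / (z - z0)) \<le> M / (norm z0 - r1)"
      unfolding norm_divide using r z M[of z] M0 by (intro frac_le) auto
  qed (use r M0 int1 in auto)
  have "norm (2 * pi * \<i> * (p z0 - 1 / (2 * pi * \<i>) * contour_integral (circlepath 0 r2) (\<lambda>z. p z / z)))
      = norm (2 * pi * \<i> * p z0 - contour_integral (circlepath 0 r2) (\<lambda>z. p z / z))"
    by (simp add: right_diff_distrib)
  also have "\<dots> \<le> M * norm z0 / (r2 * (r2 - norm z0)) * (2 * pi * r2) + M / (norm z0 - r1) * (2 * pi * r1)"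
    unfolding main using b1 b2 by (intro order_trans[OF norm_triangle_ineq4]) auto
  also have "\<dots> = (2 * pi) * (M * (norm z0 / (r2 - norm z0) + r1 / (norm z0 - r1)))"
  proof -
    have "M * norm z0 / (r2 * (r2 - norm z0)) * (2 * pi * r2) = (2 * pi) * (M * (norm z0 / (r2 - norm z0)))"
      using r by simp
    then show ?thesis by (simp add: distrib_left mult_ac)
  qed
  finally have "(2 * pi) * norm (p z0 - 1 / (2 * pi * \<i>) * contour_integral (circlepath 0 r2) (\<lambda>z. p z / z))
      \<le> (2 * pi) * (M * (norm z0 / (r2 - norm z0) + r1 / (norm z0 - r1)))"
    by (simp add: norm_mult)
  then show ?thesis by (simp only: mult_le_cancel_left_pos pi_gt_zero zero_less_mult_iff zero_less_numeral simp_thms)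
qed

lemma psum_Ln_exp: "psum G (Ln (exp w)) = psum G w"
proof -
  have "exp (Ln (exp w)) = exp w" by simp
  then obtain m where "Ln (exp w) = shift w m" unfolding exp_eq by auto
  then show ?thesis by (simp only: psum_periodic)
qed

abbreviation vline :: "real \<Rightarrow> real \<Rightarrow> complex"
  where "vline l t \<equiv> of_real l + 2 * pi * \<i> * of_real t"

lemma circle_mean_psum:
  assumes r: "r > 0"
  shows "1 / (2 * pi * \<i>) * contour_integral (circlepath 0 r) (\<lambda>z. psum G (Ln z) / z) =
    integral {0..1} (\<lambda>t. psum G (vline (ln r) t))"
proof -
  have *: "psum G (Ln (circlepath 0 r t)) / circlepath 0 r t * vector_derivative (circlepath 0 r) (at t) =
      (2 * pi * \<i>) * psum G (vline (ln r) t)" for t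
  proof -
    have e: "circlepath 0 r t = exp (vline (ln r) t)"
      using r by (simp add: circlepath exp_add exp_of_real)
    have "vector_derivative (circlepath 0 r) (at t) = 2 * pi * \<i> * circlepath 0 r t"
      unfolding vector_derivative_circlepath by (simp add: circlepath mult_ac)
    moreover have "circlepath 0 r t \<noteq> 0" unfolding e by simp
    ultimately show ?thesis unfolding e by (simp add: psum_Ln_exp)
  qed
  show ?thesis
    unfolding contour_integral_integral * by simp
qed

lemma integral_count_space_if:
  fixes f :: "'a \<Rightarrow> 'b :: {banach, second_countable_topology}"
  assumes "finite K"
  shows "integrable (count_space UNIV) (\<lambda>k. if k \<in> K then f k else 0)"
    and "(LINT k|count_space UNIV. (if k \<in> K then f k else 0)) = sum f K"
proof -
  have fin: "finite {a. (if a \<in> K then f a else 0) \<noteq> 0}"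
    by (rule finite_subset[OF _ assms]) auto
  then show "integrable (count_space UNIV) (\<lambda>k. if k \<in> K then f k else 0)"
    using abs_summable_on_restrict'[of K UNIV f] abs_summable_on_finite[OF assms, of f]
    by (simp add: abs_summable_on_def)
  show "(LINT k|count_space UNIV. (if k \<in> K then f k else 0)) = sum f K"
    using fin by (subst lebesgue_integral_count_space_finite_support)
      (auto intro!: sum.mono_neutral_cong_left assms)
qed

lemma sum_telescope_symmetric:
  fixes g :: "real \<Rightarrow> 'a :: ab_group_add"
  shows "(\<Sum>k = - int N..int N. g (of_int k + 1) - g (of_int k)) = g (of_nat N + 1) - g (- of_nat N)"
proof (induction N)
  case 0
  then show ?case by simp
next
  case (Suc N)
  have "{- int (Suc N)..int (Suc N)} = insert (- int (Suc N)) (insert (int (Suc N)) {- int N..int N})" by auto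
  then have "(\<Sum>k = - int (Suc N)..int (Suc N). g (of_int k + 1) - g (of_int k)) =
      (g (- of_nat N) - g (- of_nat (Suc N))) + ((g (of_nat (Suc N) + 1) - g (of_nat (Suc N))) +
       (\<Sum>k = - int N..int N. g (of_int k + 1) - g (of_int k)))"
    by (simp add: algebra_simps)
  also have "\<dots> = g (of_nat (Suc N) + 1) - g (- of_nat (Suc N))"
    unfolding Suc.IH by (simp add: algebra_simps)
  finally show ?case .
qed

text \<open>Unfolding: averaging a periodisation over one period integrates G along the whole line.
  With a primitive P the partial sums telescope, and the value appears as a limit of increments of
  P, so no integral over an unbounded contour has to be formed.\<close>

lemma psum_mean_telescope:
  fixes G :: "complex \<Rightarrow> complex" and P :: "real \<Rightarrow> complex"
  assumes G: "strip_decay \<beta> l1 l2 c G" and \<beta>: "0 < \<beta>" "\<beta> \<le> 1" and l: "- l2 \<le> l" "l \<le> - l1" and c: "c \<ge> 0"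
    and P: "\<And>t. (P has_vector_derivative G (vline l t)) (at t)"
  shows "(\<lambda>N. P (of_nat N + 1) - P (- of_nat N))
    \<longlonglongrightarrow> integral {0..1} (\<lambda>t. psum G (vline l t))"
proof -
  define w where "w t = vline l t" for t :: real
  define s where "s N t = (\<Sum>k = - int N..int N. G (shift (w t) k))" for N t
  have wk: "shift (w t) k = w (of_int k + t)" for t k
    by (simp add: w_def algebra_simps)
  have Rew: "Re (w t) = l" "Im (w t) = 2 * pi * t" for t by (simp_all add: w_def)
  have int_k: "((\<lambda>t. G (shift (w t) k)) has_integral (P (of_int k + 1) - P (of_int k))) {0..1}" for k
  proof -
    have "((\<lambda>t. G (w (of_int k + t))) has_integral (P (of_int k + 1) - P (of_int k + 0))) {0..1}"
    proof (rule fundamental_theorem_of_calculus)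
      fix t :: real assume "t \<in> {0..1}"
      have "((\<lambda>t. of_int k + t) has_vector_derivative 1) (at t)"
        using has_vector_derivative_add[OF has_vector_derivative_const has_vector_derivative_id] by simp
      moreover have "(P has_vector_derivative G (w (of_int k + t))) (at (of_int k + t))"
        using P by (simp only: w_def)
      ultimately have "(P \<circ> (\<lambda>t. of_int k + t) has_vector_derivative 1 *\<^sub>R G (w (of_int k + t))) (at t within {0..1})"
        using vector_diff_chain_at has_vector_derivative_at_within by blast
      then show "((\<lambda>t. P (of_int k + t)) has_vector_derivative G (w (of_int k + t))) (at t within {0..1})"
        by (simp add: o_def)
    qed simp
    then show ?thesis by (simp only: wk add_0_right)
  qed
  \<comment> \<open>The unit intervals for k = - N to N cover the interval from - N to N +
    1.\<close>
  have s_int: "(s N has_integral (P (of_nat N + 1) - P (- of_nat N))) {0..1}" for N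
  proof -
    have "(s N has_integral (\<Sum>k = - int N..int N. P (of_int k + 1) - P (of_int k))) {0..1}"
      unfolding s_def by (intro has_integral_sum int_k) auto
    then show ?thesis by (simp only: sum_telescope_symmetric)
  qed
  have le: "norm (G (shift (w t) k)) \<le> c * exp (- \<beta> * \<bar>2 * pi * t + 2 * pi * of_int k\<bar>)" for t k
    using strip_decayD[OF G, of "w t" k] l by (simp add: Rew)
  have dom: "integrable (count_space UNIV) (\<lambda>k::int. c * exp (- \<beta> * \<bar>2 * pi * t + 2 * pi * of_int k\<bar>))" for t
    using lattice_sum(1)[OF \<beta>(1)] by simp
  have s_bd: "norm (s N t) \<le> c * (4 * exp pi / \<beta>)" for N t
  proof -
    have "norm (s N t) \<le> (\<Sum>k = - int N..int N. c * exp (- \<beta> * \<bar>2 * pi * t + 2 * pi * of_int k\<bar>))"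
      unfolding s_def by (rule order_trans[OF norm_sum sum_mono[OF le]])
    also have "\<dots> = (LINT k|count_space UNIV. (if k \<in> {- int N..int N} then c * exp (- \<beta> * \<bar>2 * pi * t + 2 * pi * of_int k\<bar>) else 0))"
      by (subst integral_count_space_if) auto
    also have "\<dots> \<le> (LINT k|all_ints. c * exp (- \<beta> * \<bar>2 * pi * t + 2 * pi * of_int k\<bar>))"
      using c by (intro integral_mono integral_count_space_if dom) auto
    also have "\<dots> = c * (LINT k|all_ints. exp (- \<beta> * \<bar>2 * pi * t + 2 * pi * of_int k\<bar>))" by simp
    also have "\<dots> \<le> c * (4 * exp pi / \<beta>)"
      using lattice_sum(2)[OF \<beta>, of "2 * pi * t"] \<beta> by (intro mult_left_mono c) (simp add: field_simps)
    finally show ?thesis .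
  qed
  have s_lim: "(\<lambda>N. s N t) \<longlonglongrightarrow> psum G (w t)" for t
  proof -
    have "(\<lambda>N. LINT k|count_space UNIV. (if k \<in> {- int N..int N} then G (shift (w t) k) else 0))
      \<longlonglongrightarrow> (LINT k|count_space UNIV. G (shift (w t) k))"
    proof (rule integral_dominated_convergence[OF _ _ dom[of t]])
      show "AE k in count_space UNIV. (\<lambda>N. if k \<in> {- int N..int N} then G (shift (w t) k) else 0)
          \<longlonglongrightarrow> G (shift (w t) k)"
      proof (rule AE_I2)
        fix k :: int
        have "\<forall>\<^sub>F N in sequentially. (if k \<in> {- int N..int N} then G (shift (w t) k) else 0)
          = G (shift (w t) k)"
          using eventually_ge_at_top[of "nat \<bar>k\<bar>"] by eventually_elim auto
        then show "(\<lambda>N. if k \<in> {- int N..int N} then G (shift (w t) k) else 0)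
          \<longlonglongrightarrow> G (shift (w t) k)" by (rule tendsto_eventually)
      qed
      show "AE k in count_space UNIV. norm (if k \<in> {- int N..int N} then G (shift (w t) k) else 0)
          \<le> c * exp (- \<beta> * \<bar>2 * pi * t + 2 * pi * of_int k\<bar>)" for N
        using le c by (intro AE_I2) auto
    qed auto
    then show ?thesis
      by (simp only: psum_def s_def integral_count_space_if(2)[OF finite_atLeastAtMost_int])
  qed
  have "(\<lambda>N. integral {0..1} (s N)) \<longlonglongrightarrow> integral {0..1} (\<lambda>t. psum G (w t))"
    by (rule dominated_convergence(2)[where h = "\<lambda>_. c * (4 * exp pi / \<beta>)"])
       (use s_int s_bd s_lim in \<open>auto simp: integrable_on_def\<close>)
  moreover have "integral {0..1} (s N) = P (of_nat N + 1) - P (- of_nat N)" for N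
    using s_int by (rule integral_unique)
  ultimately show ?thesis by (simp add: w_def)
qed

section \<open>The Airy function\<close>

text \<open>The phase v^3 / 3 - y v of the usual contour integral for the Airy function at v = - u,
  so that the contour lies in the left half-plane, like the roots.\<close>

definition airy_exponent :: "real \<Rightarrow> complex \<Rightarrow> complex"
  where "airy_exponent y u = - (u ^ 3) / 3 + of_real y * u"

lemma Re_airy_exponent:
  "Re (airy_exponent y u) = (- ((Re u) ^ 3) / 3 + Re u * (Im u)\<^sup>2) + y * Re u"
  by (simp add: airy_exponent_def power3_eq_cube power2_eq_square field_simps)

text \<open>With \<kappa> = 2 l + |x0| this is the value of \<kappa> a + a^2 at a = 3 +
  \<kappa>.\<close>

definition growth_const :: "real \<Rightarrow> real \<Rightarrow> real"
  where "growth_const l x0 = (3 + 2 * l + \<bar>x0\<bar>) * (3 + 2 * (2 * l + \<bar>x0\<bar>))"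

(* With u = - a + i b, the real part of - u^3 / 3 is a^3 / 3 - a b^2, and b^2 = a^2 - 2 L on the hyperbola. *)
lemma airy_exponent_bound:
  assumes l: "0 < l1" "l1 \<le> L" "L \<le> l2" and u: "Re u < 0" "(Re u)\<^sup>2 - (Im u)\<^sup>2 = 2 * L" and y: "x0 \<le> y"
  shows "Re (airy_exponent y u) \<le> growth_const l2 x0 - (Re u)\<^sup>2 - sqrt (2 * l1) * (y - x0)"
    and "sqrt (2 * l1) \<le> - Re u"
proof -
  define a where "a = - Re u"
  define \<kappa> where "\<kappa> = 2 * l2 + \<bar>x0\<bar>"
  have a: "a > 0" and \<kappa>: "\<kappa> \<ge> 0" using u l by (auto simp: a_def \<kappa>_def)
  have b2: "(Im u)\<^sup>2 = a\<^sup>2 - 2 * L" using u(2) by (simp add: a_def)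
  have "2 * l1 \<le> a\<^sup>2" using b2 l zero_le_power2[of "Im u"] by linarith
  then have sa: "sqrt (2 * l1) \<le> a" using a real_le_lsqrt by (meson less_imp_le)
  then show "sqrt (2 * l1) \<le> - Re u" by (simp add: a_def)
  have "Re (airy_exponent y u) = (a ^ 3 / 3 - a * (a\<^sup>2 - 2 * L)) - y * a"
    unfolding Re_airy_exponent b2 by (simp add: a_def)
  also have "\<dots> = 2 * L * a - x0 * a - 2 / 3 * a ^ 3 - a * (y - x0)"
    by (simp add: power3_eq_cube power2_eq_square algebra_simps)
  also have "\<dots> \<le> \<kappa> * a - 2 / 3 * a ^ 3 - sqrt (2 * l1) * (y - x0)"
  proof -
    have "2 * L * a \<le> 2 * l2 * a" using a l by (intro mult_right_mono) auto
    moreover have "- x0 * a \<le> \<bar>x0\<bar> * a" using a by (intro mult_right_mono) auto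
    moreover have "sqrt (2 * l1) * (y - x0) \<le> a * (y - x0)" using sa y by (intro mult_right_mono) auto
    ultimately show ?thesis by (simp add: \<kappa>_def algebra_simps)
  qed
  \<comment> \<open>Up to a = 3 + \<kappa> the quantity \<kappa> a + a^2 is at most its value at
    that end point; beyond it, \<kappa> a + a^2 \<le> 2 a^2 \<le> 2 a^3 / 3, because a exceeds both
    \<kappa> and 3.\<close>
  also have "\<kappa> * a - 2 / 3 * a ^ 3 \<le> growth_const l2 x0 - a\<^sup>2"
  proof (cases "a \<le> 3 + \<kappa>")
    case True
    have "\<kappa> * a + a\<^sup>2 \<le> \<kappa> * (3 + \<kappa>) + (3 + \<kappa>)\<^sup>2"
      using True a \<kappa> by (intro add_mono mult_left_mono power_mono) auto
    also have "\<dots> = growth_const l2 x0"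
      by (simp add: growth_const_def \<kappa>_def power2_eq_square algebra_simps)
    finally have "\<kappa> * a + a\<^sup>2 \<le> growth_const l2 x0" .
    moreover have "0 \<le> 2 / 3 * a ^ 3" using a by simp
    ultimately show ?thesis by linarith
  next
    case False
    have "\<kappa> * a \<le> a * a" using False a by (intro mult_right_mono) auto
    moreover have "2 * (a * a) \<le> 2 / 3 * a ^ 3"
      using False \<kappa> a by (simp add: power3_eq_cube)
    moreover have "0 \<le> growth_const l2 x0" using l by (simp add: growth_const_def)
    ultimately show ?thesis by (simp add: power2_eq_square)
  qed
  finally show "Re (airy_exponent y u) \<le> growth_const l2 x0 - (Re u)\<^sup>2 - sqrt (2 * l1) * (y - x0)"
    by (simp add: a_def)
qed

text \<open>Since \<open>xi\<close> has derivative - 1 / \<open>xi\<close>, the factor \<delta> / (-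
  \<xi>) is du / dw for u = \<delta> \<xi>: integrating \<open>airy_G\<close> in w is integrating
  exp (airy_exponent y u) in u.\<close>

definition airy_G :: "real \<Rightarrow> real \<Rightarrow> complex \<Rightarrow> complex"
  where "airy_G \<delta> y w = of_real \<delta> * exp (airy_exponent y (of_real \<delta> * xi w)) / (- xi w)"

lemma airy_G_holomorphic: "airy_G \<delta> y holomorphic_on {w. Re w < 0}"
  unfolding airy_G_def airy_exponent_def
  by (intro holomorphic_intros xi_holomorphic) (use xi_nonzero in auto)

text \<open>The scaled root moves on a hyperbola that depends only on \<delta>^2 Re w. The last
  inequality converts the decay exp (- (Re u)^2) of the Airy integrand into exponential decay in Im
  w at rate \<delta>^2.\<close>

lemma xi_scaled:
  assumes w: "Re w < 0" and \<delta>: "\<delta> > 0"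
  defines "u \<equiv> of_real \<delta> * xi w"
  shows "Re u < 0" "(Re u)\<^sup>2 - (Im u)\<^sup>2 = 2 * (- \<delta>\<^sup>2 * Re w)" "Re u * Im u = - \<delta>\<^sup>2 * Im w"
    "\<delta>\<^sup>2 * \<bar>Im w\<bar> \<le> (Re u)\<^sup>2"
proof -
  show Reu: "Re u < 0" using Re_xi_neg[OF w] \<delta> by (simp add: u_def mult_pos_neg)
  have "u\<^sup>2 = of_real (\<delta>\<^sup>2) * (- 2 * w)" by (simp add: u_def power_mult_distrib xi_square)
  then have "Re (u\<^sup>2) = \<delta>\<^sup>2 * (- 2 * Re w)" "Im (u\<^sup>2) = \<delta>\<^sup>2 * (- 2 * Im w)" by (simp_all del: of_real_power)
  then have 1: "(Re u)\<^sup>2 - (Im u)\<^sup>2 = 2 * (- \<delta>\<^sup>2 * Re w)" and 2: "Re u * Im u = - \<delta>\<^sup>2 * Im w"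
    by (simp_all add: power2_eq_square mult.commute)
  show "(Re u)\<^sup>2 - (Im u)\<^sup>2 = 2 * (- \<delta>\<^sup>2 * Re w)" "Re u * Im u = - \<delta>\<^sup>2 * Im w" by fact+
  have "(Im u)\<^sup>2 \<le> (Re u)\<^sup>2" using 1 w \<delta> mult_nonneg_nonpos[of "\<delta>\<^sup>2" "Re w"] by simp
  then have "\<bar>Im u\<bar> \<le> \<bar>Re u\<bar>" by (simp add: abs_le_square_iff)
  then have "\<bar>Re u\<bar> * \<bar>Im u\<bar> \<le> \<bar>Re u\<bar> * \<bar>Re u\<bar>" by (intro mult_left_mono) auto
  moreover have "\<bar>Re u\<bar> * \<bar>Im u\<bar> = \<delta>\<^sup>2 * \<bar>Im w\<bar>" by (simp add: abs_mult[symmetric] 2 abs_mult)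
  ultimately show "\<delta>\<^sup>2 * \<bar>Im w\<bar> \<le> (Re u)\<^sup>2" by (simp add: power2_eq_square)
qed

definition decay_const :: "real \<Rightarrow> real \<Rightarrow> real \<Rightarrow> real"
  where "decay_const l1 l2 x0 = exp (growth_const l2 x0) / sqrt (2 * l1)"

text \<open>In this strip L = - \<delta>^2 Re w ranges over [l1, l2], so \<open>decay_const\<close>
  is free of \<delta>; its factor 1 / sqrt (2 l1) bounds 1 / |u|.\<close>

lemma airy_G_decay:
  assumes l: "0 < l1" and \<delta>: "\<delta> > 0" and y: "x0 \<le> y"
  shows "strip_decay (\<delta>\<^sup>2) (l1 / \<delta>\<^sup>2) (l2 / \<delta>\<^sup>2)
    (\<delta>\<^sup>2 * (decay_const l1 l2 x0 * exp (- sqrt (2 * l1) * (y - x0)))) (airy_G \<delta> y)"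
  unfolding strip_decay_def
proof (intro allI impI)
  fix w assume w: "- (l2 / \<delta>\<^sup>2) \<le> Re w \<and> Re w \<le> - (l1 / \<delta>\<^sup>2)"
  define L where "L = - \<delta>\<^sup>2 * Re w"
  define u where "u = of_real \<delta> * xi w"
  have L: "l1 \<le> L" "L \<le> l2" using w \<delta> by (auto simp: L_def field_simps)
  have w0: "Re w < 0" using w l \<delta> by (smt (verit) divide_pos_pos zero_less_power)
  note u = xi_scaled[OF w0 \<delta>, folded u_def L_def]
  note b = airy_exponent_bound[OF l L u(1,2) y]
  have un: "sqrt (2 * l1) \<le> norm u" using b(2) abs_Re_le_cmod[of u] u(1) by linarith
  have sl: "sqrt (2 * l1) > 0" using l by simp
  have "airy_G \<delta> y w = of_real (\<delta>\<^sup>2) * exp (airy_exponent y u) / (- u)"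
    using \<delta> xi_nonzero[OF w0] by (simp add: airy_G_def u_def power2_eq_square)
  then have "norm (airy_G \<delta> y w) = \<delta>\<^sup>2 * exp (Re (airy_exponent y u)) / norm u"
    by (simp add: norm_mult norm_divide norm_power)
  also have "\<dots> \<le> \<delta>\<^sup>2 * exp (growth_const l2 x0 - \<delta>\<^sup>2 * \<bar>Im w\<bar> - sqrt (2 * l1) * (y - x0)) / sqrt (2 * l1)"
    using un sl b(1) u(4) by (intro frac_le mult_left_mono iffD2[OF exp_le_cancel_iff]) (auto intro: order_trans)
  also have "\<dots> = \<delta>\<^sup>2 * (decay_const l1 l2 x0 * exp (- sqrt (2 * l1) * (y - x0))) * exp (- \<delta>\<^sup>2 * \<bar>Im w\<bar>)"
    by (simp add: decay_const_def exp_diff exp_minus divide_inverse mult_ac flip: exp_add)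
  finally show "norm (airy_G \<delta> y w) \<le> \<delta>\<^sup>2 * (decay_const l1 l2 x0 * exp (- sqrt (2 * l1) * (y - x0))) * exp (- \<delta>\<^sup>2 * \<bar>Im w\<bar>)" .
qed

section \<open>A primitive of the Airy integrand and its limits at infinity\<close>

lemma convergent_of_exp_bounded_derivative:
  fixes g :: "real \<Rightarrow> complex"
  assumes g: "\<And>b. b > 0 \<Longrightarrow> (g has_vector_derivative g' b) (at b)"
    and bd: "\<And>b. b > 0 \<Longrightarrow> norm (g' b) \<le> C * exp (- b)"
  shows "\<exists>l. (g \<longlongrightarrow> l) at_top"
proof -
  have C: "C \<ge> 0"
    using order_trans[OF norm_ge_zero bd[of 1]] by (simp add: zero_le_mult_iff)
  have le: "norm (g s - g t) \<le> C * exp (- t)" if "0 < t" "t \<le> s" for s t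
  proof (cases "t = s")
    case False
    have "norm (g s - g t) \<le> - C * exp (- s) - (- C * exp (- t))"
    proof (rule differentiable_bound_general)
      show "continuous_on {t..s} g"
        using that by (intro continuous_at_imp_continuous_on ballI has_vector_derivative_continuous[OF g]) auto
      show "((\<lambda>x. - C * exp (- x)) has_vector_derivative C * exp (- x)) (at x)" for x
        unfolding has_real_derivative_iff_has_vector_derivative[symmetric]
        by (auto intro!: derivative_eq_intros)
    qed (use that False in \<open>auto intro!: continuous_intros g bd\<close>)
    also have "\<dots> \<le> C * exp (- t)" using C by simp
    finally show ?thesis .
  qed (use C in auto)
  have small: "\<exists>T>0. \<forall>t\<ge>T. C * exp (- t) < e" if "e > 0" for e
  proof -
    have "((\<lambda>t. C * exp (- t)) \<longlongrightarrow> C * 0) at_top"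
      by (intro tendsto_intros filterlim_compose[OF exp_at_bot filterlim_uminus_at_bot_at_top])
    then have "\<forall>\<^sub>F t in at_top. C * exp (- t) < e" using that by (intro order_tendstoD) auto
    then obtain T where "\<And>t. t \<ge> T \<Longrightarrow> C * exp (- t) < e" by (auto simp: eventually_at_top_linorder)
    then show ?thesis by (intro exI[of _ "max T 1"]) auto
  qed
  have "Cauchy (\<lambda>n. g (of_nat n))"
  proof (rule metric_CauchyI)
    fix e :: real assume "e > 0"
    then obtain T where T: "T > 0" "\<And>t. t \<ge> T \<Longrightarrow> C * exp (- t) < e" using small by blast
    obtain N :: nat where N: "real N > T" using reals_Archimedean2 by blast
    have *: "dist (g (real m)) (g (real n)) < e" if "N \<le> n" "n \<le> m" for m n
      using le[of "real n" "real m"] T(2)[of "real n"] T(1) N that by (auto simp: dist_norm)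
    show "\<exists>M. \<forall>m\<ge>M. \<forall>n\<ge>M. dist (g (real m)) (g (real n)) < e"
      by (rule exI[of _ N]) (metis * dist_commute nle_le)
  qed
  then obtain l where l: "(\<lambda>n. g (of_nat n)) \<longlonglongrightarrow> l" using Cauchy_convergent convergent_def by blast
  have lim: "norm (l - g t) \<le> C * exp (- t)" if "0 < t" for t
  proof (rule Lim_bounded)
    show "(\<lambda>n. norm (g (real n) - g t)) \<longlonglongrightarrow> norm (l - g t)" by (intro tendsto_intros l)
    show "\<forall>n\<ge>nat \<lceil>t\<rceil>. norm (g (real n) - g t) \<le> C * exp (- t)"
      using that by (auto intro!: le simp: nat_le_iff ceiling_le_iff)
  qed
  have "(g \<longlongrightarrow> l) at_top"
    unfolding tendsto_iff
  proof (intro allI impI)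
    fix e :: real assume "e > 0"
    then obtain T where T: "T > 0" "\<And>t. t \<ge> T \<Longrightarrow> C * exp (- t) < e" using small by blast
    show "\<forall>\<^sub>F x in at_top. dist (g x) l < e"
      using eventually_ge_at_top[of T]
    proof eventually_elim
      case (elim x)
      then show ?case using lim[of x] T by (force simp: dist_norm norm_minus_commute)
    qed
  qed
  then show ?thesis by blast
qed

definition hyp :: "real \<Rightarrow> real \<Rightarrow> complex"
  where "hyp L b = of_real (- sqrt (2 * L + b\<^sup>2)) + \<i> * of_real b"

lemma hyp_eqI:
  assumes "Re u < 0" "(Re u)\<^sup>2 - (Im u)\<^sup>2 = 2 * L"
  shows "u = hyp L (Im u)"
proof -
  have "2 * L + (Im u)\<^sup>2 = (- Re u)\<^sup>2" using assms(2) by simp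
  then have "sqrt (2 * L + (Im u)\<^sup>2) = - Re u" using assms(1) by (simp only: real_sqrt_abs)
  then show ?thesis by (simp add: hyp_def complex_eq_iff)
qed

text \<open>At distance s from the imaginary axis on the horizontal segment to the hyperbola, s^2
  \<le> 2 L + b^2 bounds the real part of the exponent by - \<kappa> s; integrating exp (- \<kappa>
  s) gives 1 / \<kappa>.\<close>

lemma airy_primitive_horizontal:
  assumes P: "\<And>u. (P has_field_derivative exp (airy_exponent y u)) (at u)"
    and L: "L > 0" and \<kappa>: "\<kappa> = 2 / 3 * b\<^sup>2 - 2 / 3 * L + y" "\<kappa> > 0"
  shows "norm (P (hyp L b) - P (\<i> * of_real b)) \<le> 1 / \<kappa>"
proof -
  define a where "a = sqrt (2 * L + b\<^sup>2)"
  have a: "a > 0" "a\<^sup>2 = 2 * L + b\<^sup>2" using L by (auto simp: a_def add_pos_nonneg)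
  define c where "c s = of_real (- s) + \<i> * of_real b" for s
  have c: "(c has_vector_derivative - 1) (at s)" for s
    unfolding c_def by (auto intro!: derivative_eq_intros simp: has_vector_derivative_def scaleR_conv_of_real fun_eq_iff)
  have d: "((P \<circ> c) has_vector_derivative - 1 * exp (airy_exponent y (c s))) (at s)" for s
    by (rule field_vector_diff_chain_at[OF c P])
  have "norm ((P \<circ> c) a - (P \<circ> c) 0) \<le> - exp (- \<kappa> * a) / \<kappa> - (- exp (- \<kappa> * 0) / \<kappa>)"
  proof (rule differentiable_bound_general[OF a(1)])
    show "continuous_on {0..a} (P \<circ> c)"
      by (intro continuous_at_imp_continuous_on ballI has_vector_derivative_continuous[OF d])
    show "((P \<circ> c) has_vector_derivative - 1 * exp (airy_exponent y (c s))) (at s)" for s by (rule d)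
    show "((\<lambda>s. - exp (- \<kappa> * s) / \<kappa>) has_vector_derivative exp (- \<kappa> * s)) (at s)" for s
      unfolding has_real_derivative_iff_has_vector_derivative[symmetric]
      using \<kappa>(2) by (auto intro!: derivative_eq_intros)
    fix s assume s: "0 < s" "s < a"
    have "s\<^sup>2 \<le> 2 * L + b\<^sup>2" using power_mono[of s a 2] s a by simp
    then have "s * \<kappa> \<le> s * (b\<^sup>2 - s\<^sup>2 / 3 + y)" unfolding \<kappa> using s by (intro mult_left_mono) auto
    then have "Re (airy_exponent y (c s)) \<le> - \<kappa> * s"
      unfolding Re_airy_exponent by (simp add: c_def power2_eq_square power3_eq_cube algebra_simps)
    then show "norm (- 1 * exp (airy_exponent y (c s))) \<le> exp (- \<kappa> * s)" by simp
  qed (use \<kappa>(2) in \<open>auto intro!: continuous_intros\<close>)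
  also have "\<dots> \<le> 1 / \<kappa>" using \<kappa>(2) by simp
  finally show ?thesis by (simp add: c_def hyp_def a_def)
qed

text \<open>Moves an end of the contour from the hyperbola, where the integrand decays
  exponentially, to the imaginary axis, where the integral defining \<open>Airy\<close> converges
  only conditionally. The sign s selects the upper or the lower end.\<close>

lemma airy_primitive_limits:
  assumes P: "\<And>u. (P has_field_derivative exp (airy_exponent y u)) (at u)"
    and L: "L > 0" and s: "s = 1 \<or> s = - 1"
  obtains l where "((\<lambda>b. P (hyp L (s * b))) \<longlongrightarrow> l) at_top"
    and "((\<lambda>b. P (\<i> * of_real (s * b))) \<longlongrightarrow> l) at_top"
proof -
  have s2: "(s * b)\<^sup>2 = b\<^sup>2" "s * s = 1" for b using s by (auto simp: power2_eq_square)
  define h where "h b = of_real (- (s * b / sqrt (2 * L + b\<^sup>2)) * s) + \<i> * of_real s" for b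
  have pos: "2 * L + b\<^sup>2 > 0" for b using L by (simp add: add_pos_nonneg)
  have h: "((\<lambda>b. hyp L (s * b)) has_vector_derivative h b) (at b)" for b
  proof -
    have "((\<lambda>b. - sqrt (2 * L + b\<^sup>2)) has_real_derivative - (b / sqrt (2 * L + b\<^sup>2))) (at b)"
      using pos[of b] by (auto intro!: derivative_eq_intros simp: field_simps)
    moreover have "- (b / sqrt (2 * L + b\<^sup>2)) = - (s * b / sqrt (2 * L + b\<^sup>2)) * s" using s by auto
    ultimately have "((\<lambda>b. - sqrt (2 * L + (s * b)\<^sup>2)) has_real_derivative - (s * b / sqrt (2 * L + b\<^sup>2)) * s) (at b)"
      by (simp only: s2)
    then show ?thesis
      unfolding hyp_def h_def
      by (intro has_vector_derivative_add has_vector_derivative_of_real has_vector_derivative_mult_right)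
         (auto simp: has_real_derivative_iff_has_vector_derivative[symmetric] intro!: derivative_eq_intros)
  qed
  have hn: "norm (h b) \<le> 2" for b
  proof -
    have "\<bar>b\<bar> \<le> sqrt (2 * L + b\<^sup>2)" using L by (intro real_le_rsqrt) simp
    then have "\<bar>s * b / sqrt (2 * L + b\<^sup>2) * s\<bar> \<le> 1"
      using pos[of b] s by (auto simp: abs_mult abs_divide)
    then have "norm (complex_of_real (- (s * b / sqrt (2 * L + b\<^sup>2)) * s)) \<le> 1" by (simp only: norm_of_real abs_mult abs_minus_cancel)
    moreover have "norm (\<i> * complex_of_real s) \<le> 1" using s by (auto simp: norm_mult)
    ultimately show ?thesis unfolding h_def by (intro order_trans[OF norm_triangle_ineq]) simp
  qed
  have "\<exists>l. ((P \<circ> (\<lambda>b. hyp L (s * b))) \<longlongrightarrow> l) at_top"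
  proof (rule convergent_of_exp_bounded_derivative)
    fix b :: real assume b: "b > 0"
    show "(P \<circ> (\<lambda>b. hyp L (s * b)) has_vector_derivative h b * exp (airy_exponent y (hyp L (s * b)))) (at b)"
      by (rule field_vector_diff_chain_at[OF h P])
    have sq: "(sqrt (2 * L + b\<^sup>2))\<^sup>2 = 2 * L + b\<^sup>2" using pos[of b] by simp
    have "Re (airy_exponent y (hyp L (s * b))) \<le> growth_const L y - (2 * L + b\<^sup>2)"
      using airy_exponent_bound(1)[of L L L "hyp L (s * b)" y y] L pos[of b] sq by (simp add: hyp_def s2)
    also have "\<dots> \<le> growth_const L y + 1 - b"
    proof -
      have "0 \<le> (b - 1)\<^sup>2 + b" using b by simp
      then show ?thesis using L by (simp add: power2_eq_square algebra_simps)
    qed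
    finally have "norm (h b) * norm (exp (airy_exponent y (hyp L (s * b)))) \<le> 2 * exp (growth_const L y + 1 - b)"
      using hn by (intro mult_mono) auto
    also have "\<dots> = 2 * exp (growth_const L y + 1) * exp (- b)"
      by (simp add: exp_add exp_diff exp_minus divide_inverse)
    finally show "norm (h b * exp (airy_exponent y (hyp L (s * b)))) \<le> 2 * exp (growth_const L y + 1) * exp (- b)"
      by (simp add: norm_mult)
  qed
  then obtain l where l: "((\<lambda>b. P (hyp L (s * b))) \<longlongrightarrow> l) at_top" by (auto simp: o_def)
  have "((\<lambda>b. P (hyp L (s * b)) - P (\<i> * of_real (s * b))) \<longlongrightarrow> 0) at_top"
  proof (rule Lim_null_comparison)
    define c where "c = y - 2 / 3 * L"
    show "\<forall>\<^sub>F b in at_top. norm (P (hyp L (s * b)) - P (\<i> * of_real (s * b))) \<le> 1 / b"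
      using eventually_ge_at_top[of "3 + \<bar>c\<bar>"]
    proof eventually_elim
      case (elim b)
      have "3 * b \<le> b * b" using elim by (intro mult_right_mono) auto
      then have \<kappa>: "b \<le> 2 / 3 * b\<^sup>2 + c" using elim by (simp add: power2_eq_square)
      have "norm (P (hyp L (s * b)) - P (\<i> * of_real (s * b))) \<le> 1 / (2 / 3 * b\<^sup>2 + c)"
        using airy_primitive_horizontal[OF P L, of "2 / 3 * b\<^sup>2 + c" "s * b"] elim \<kappa>
        by (auto simp: s2 c_def)
      also have "\<dots> \<le> 1 / b" using \<kappa> elim by (intro frac_le) auto
      finally show ?case .
    qed
    show "((\<lambda>b::real. 1 / b) \<longlongrightarrow> 0) at_top"
      using tendsto_inverse_0_at_top[OF filterlim_ident] by (simp add: inverse_eq_divide)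
  qed
  from tendsto_diff[OF l this] have "((\<lambda>b. P (\<i> * of_real (s * b))) \<longlongrightarrow> l) at_top" by simp
  with l show ?thesis by (rule that)
qed

lemma airy_exponent_imag: "airy_exponent y (\<i> * of_real t) = \<i> * of_real (t ^ 3 / 3 + y * t)"
proof -
  have "(\<i> * complex_of_real t) ^ 3 = - \<i> * of_real (t ^ 3)"
    by (simp add: power3_eq_cube complex_eq_iff)
  then show ?thesis by (simp add: airy_exponent_def algebra_simps)
qed

text \<open>The increment of P from - \<i> T to \<i> T is 2 \<i> times the integral of the cosine
  over {0..T}. Hence the limit in the definition of \<open>Airy\<close> exists, and
  \<open>Lim\<close> has its intended value.\<close>

lemma Airy_eq_limit:
  assumes P: "\<And>u. (P has_field_derivative exp (airy_exponent y u)) (at u)"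
    and lp: "((\<lambda>b. P (\<i> * of_real (1 * b))) \<longlongrightarrow> lp) at_top"
    and lm: "((\<lambda>b. P (\<i> * of_real (- 1 * b))) \<longlongrightarrow> lm) at_top"
  shows "complex_of_real (Airy y) = (lp - lm) / (2 * pi * \<i>)"
proof -
  define h where "h b = (P (\<i> * of_real (1 * b)) - P (\<i> * of_real (- 1 * b))) / (2 * \<i>)" for b :: real
  define X where "X = (lp - lm) / (2 * \<i>)"
  have lin: "((\<lambda>b. \<i> * complex_of_real (s * b)) has_vector_derivative \<i> * of_real s) (at b)" for s b
    by (intro has_vector_derivative_mult_right has_vector_derivative_of_real)
       (auto intro!: derivative_eq_intros simp: has_real_derivative_iff_has_vector_derivative[symmetric])
  have Pd: "((\<lambda>b. P (\<i> * of_real (s * b))) has_vector_derivative (\<i> * of_real s) * exp (airy_exponent y (\<i> * of_real (s * b)))) (at b)"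
    for s b
    using field_vector_diff_chain_at[OF lin P] by (simp add: o_def)
  have hd: "(h has_vector_derivative complex_of_real (cos (t ^ 3 / 3 + y * t))) (at t)" for t
  proof -
    define \<theta> where "\<theta> = t ^ 3 / 3 + y * t"
    have "airy_exponent y (\<i> * of_real (1 * t)) = \<i> * of_real \<theta>"
      unfolding airy_exponent_imag by (simp add: \<theta>_def)
    moreover have "airy_exponent y (\<i> * of_real (- 1 * t)) = \<i> * of_real (- \<theta>)"
      unfolding airy_exponent_imag by (simp add: \<theta>_def power3_eq_cube)
    moreover have "exp (\<i> * complex_of_real \<theta>) = of_real (cos \<theta>) + \<i> * of_real (sin \<theta>)"
      "exp (\<i> * complex_of_real (- \<theta>)) = of_real (cos \<theta>) - \<i> * of_real (sin \<theta>)"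
      unfolding cis_conv_exp[symmetric] by (simp_all add: complex_eq_iff)
    ultimately have "((\<i> * of_real 1) * exp (airy_exponent y (\<i> * of_real (1 * t))) -
        (\<i> * of_real (- 1)) * exp (airy_exponent y (\<i> * of_real (- 1 * t)))) / (2 * \<i>) = complex_of_real (cos \<theta>)"
      by (simp only:) (simp add: field_simps)
    moreover have "(h has_vector_derivative ((\<i> * of_real 1) * exp (airy_exponent y (\<i> * of_real (1 * t))) -
        (\<i> * of_real (- 1)) * exp (airy_exponent y (\<i> * of_real (- 1 * t)))) / (2 * \<i>)) (at t)"
      unfolding h_def by (intro has_vector_derivative_divide has_vector_derivative_diff Pd)
    ultimately show ?thesis by (simp add: \<theta>_def)
  qed
  have h_real: "h T = of_real (integral {0..T} (\<lambda>t. cos (t ^ 3 / 3 + y * t)))" if "T \<ge> 0" for T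
  proof -
    have "((\<lambda>t. complex_of_real (cos (t ^ 3 / 3 + y * t))) has_integral (h T - h 0)) {0..T}"
      by (rule fundamental_theorem_of_calculus[OF that has_vector_derivative_at_within[OF hd]])
    moreover have "((\<lambda>t. cos (t ^ 3 / 3 + y * t)) has_integral integral {0..T} (\<lambda>t. cos (t ^ 3 / 3 + y * t))) {0..T}"
      by (intro integrable_integral integrable_continuous_real continuous_intros) auto
    from has_integral_linear[OF this bounded_linear_of_real, unfolded o_def]
    have "((\<lambda>t. complex_of_real (cos (t ^ 3 / 3 + y * t))) has_integral of_real (integral {0..T} (\<lambda>t. cos (t ^ 3 / 3 + y * t)))) {0..T}" .
    ultimately have "h T - h 0 = of_real (integral {0..T} (\<lambda>t. cos (t ^ 3 / 3 + y * t)))"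
      by (rule has_integral_unique)
    then show ?thesis by (simp add: h_def)
  qed
  have hX: "(h \<longlongrightarrow> X) at_top"
    unfolding h_def X_def by (rule tendsto_divide[OF tendsto_diff[OF lp lm] tendsto_const]) simp
  have ev: "\<forall>\<^sub>F T in at_top. integral {0..T} (\<lambda>t. cos (t ^ 3 / 3 + y * t)) = Re (h T)"
    using eventually_ge_at_top[of 0] by eventually_elim (simp add: h_real)
  have lim: "((\<lambda>T. integral {0..T} (\<lambda>t. cos (t ^ 3 / 3 + y * t))) \<longlongrightarrow> Re X) at_top"
    unfolding tendsto_cong[OF ev] by (rule tendsto_Re[OF hX])
  \<comment> \<open>So far only the real part of X is identified; as a limit of real numbers X is
    real.\<close>
  have "\<forall>\<^sub>F T in at_top. Im (h T) = 0"
    using eventually_ge_at_top[of 0] by eventually_elim (simp add: h_real)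
  then have "((\<lambda>T. Im (h T)) \<longlongrightarrow> 0) at_top" by (rule tendsto_eventually)
  then have "Im X = 0" by (rule tendsto_unique[OF trivial_limit_at_top_linorder tendsto_Im[OF hX]])
  then have X: "X = of_real (Re X)" by (simp add: complex_eq_iff)
  have "Airy y = 1 / pi * Re X"
    unfolding Airy_def using tendsto_Lim[OF _ lim] by simp
  then have "complex_of_real (Airy y) = 1 / pi * X" by (subst X) simp
  then show ?thesis by (simp add: X_def field_simps)
qed

text \<open>If b were below K, then a \<le> b + sqrt (2 L) would keep a b at most K (K + sqrt (2
  L)). So a large product of the coordinates forces a point far out on the hyperbola; this shows
  that w on a vertical line reaches both ends.\<close>

lemma hyperbola_Im_ge:
  fixes a b v L K :: real
  assumes "a > 0" "a\<^sup>2 - b\<^sup>2 = 2 * L" "L > 0" "a * b = v" "v > K * (K + sqrt (2 * L))" "K \<ge> 0"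
  shows "K \<le> b"
proof (rule ccontr)
  assume "\<not> K \<le> b"
  then have bK: "b < K" by simp
  have "v > 0" using assms by (intro le_less_trans[OF _ assms(5)]) auto
  then have b: "b > 0" using assms(1,4) by (metis zero_less_mult_pos)
  have "a \<le> b + sqrt (2 * L)"
  proof (rule power2_le_imp_le)
    have "a\<^sup>2 = b\<^sup>2 + (sqrt (2 * L))\<^sup>2" using assms(2,3) by simp
    also have "\<dots> \<le> (b + sqrt (2 * L))\<^sup>2" using b assms(3) by (simp add: power2_sum)
    finally show "a\<^sup>2 \<le> (b + sqrt (2 * L))\<^sup>2" .
  qed (use b assms(3) in simp)
  then have "a * b \<le> (K + sqrt (2 * L)) * K" using bK b assms by (intro mult_mono) auto
  then show False using assms(4,5) by (simp add: mult.commute)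
qed

text \<open>After unfolding, w on a vertical line sweeps the whole hyperbola, and the increment of
  the primitive between its ends is the Airy integral. So the mean is exact; an error arises only at
  a single z.\<close>

lemma airy_G_mean:
  assumes \<delta>: "0 < \<delta>" "\<delta> \<le> 1" and l: "l < 0"
  shows "integral {0..1} (\<lambda>t. psum (airy_G \<delta> y) (vline l t)) = of_real (Airy y)"
proof -
  have "(\<lambda>u. exp (airy_exponent y u)) holomorphic_on UNIV"
    unfolding airy_exponent_def by (intro holomorphic_intros) auto
  then obtain P where P: "\<And>u. (P has_field_derivative exp (airy_exponent y u)) (at u)"
    using holomorphic_convex_primitive'[of UNIV "\<lambda>u. exp (airy_exponent y u)"] by auto
  define L where "L = - \<delta>\<^sup>2 * l"
  have L: "L > 0" using l \<delta> by (simp add: L_def mult_pos_neg)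
  obtain lp where lp: "((\<lambda>b. P (hyp L (1 * b))) \<longlongrightarrow> lp) at_top" "((\<lambda>b. P (\<i> * of_real (1 * b))) \<longlongrightarrow> lp) at_top"
    using airy_primitive_limits[OF P L, of 1] by blast
  obtain lm where lm: "((\<lambda>b. P (hyp L (- 1 * b))) \<longlongrightarrow> lm) at_top" "((\<lambda>b. P (\<i> * of_real (- 1 * b))) \<longlongrightarrow> lm) at_top"
    using airy_primitive_limits[OF P L, of "- 1"] by blast
  define w where "w t = vline l t" for t :: real
  define u where "u t = of_real \<delta> * xi (w t)" for t
  have Rew: "Re (w t) = l" "Im (w t) = 2 * pi * t" for t by (simp_all add: w_def)
  have u: "Re (u t) < 0" "(Re (u t))\<^sup>2 - (Im (u t))\<^sup>2 = 2 * L" "Re (u t) * Im (u t) = - \<delta>\<^sup>2 * (2 * pi * t)" for t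
    using xi_scaled(1-3)[of "w t" \<delta>] \<delta> l by (simp_all add: u_def Rew L_def)
  have uh: "u t = hyp L (Im (u t))" for t by (rule hyp_eqI[OF u(1,2)])
  define R where "R t = P (u t) / (2 * pi * \<i>)" for t
  have Rd: "(R has_vector_derivative airy_G \<delta> y (w t)) (at t)" for t
  proof -
    have "(w has_vector_derivative 2 * pi * \<i>) (at t)"
      unfolding w_def by (auto intro!: derivative_eq_intros simp: has_vector_derivative_def scaleR_conv_of_real fun_eq_iff)
    moreover have "((\<lambda>w. of_real \<delta> * xi w) has_field_derivative of_real \<delta> * (- 1 / xi (w t))) (at (w t))"
      by (intro DERIV_cmult xi_deriv) (simp add: Rew l)
    ultimately have "((\<lambda>w. of_real \<delta> * xi w) \<circ> w has_vector_derivative 2 * pi * \<i> * (of_real \<delta> * (- 1 / xi (w t)))) (at t)"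
      by (rule field_vector_diff_chain_at)
    then have "(u has_vector_derivative 2 * pi * \<i> * (of_real \<delta> * (- 1 / xi (w t)))) (at t)"
      by (simp add: o_def u_def[abs_def])
    from field_vector_diff_chain_at[OF this P]
    have "((\<lambda>t. P (u t)) has_vector_derivative (2 * pi * \<i> * (of_real \<delta> * (- 1 / xi (w t)))) * exp (airy_exponent y (u t))) (at t)"
      by (simp add: o_def)
    from has_vector_derivative_divide[OF this, of "2 * pi * \<i>"]
    show ?thesis by (simp add: R_def[abs_def] airy_G_def u_def mult_ac)
  qed
  have "(\<lambda>N. R (of_nat N + 1) - R (- of_nat N)) \<longlonglongrightarrow> integral {0..1} (\<lambda>t. psum (airy_G \<delta> y) (vline l t))"
  proof (rule psum_mean_telescope)
    \<comment> \<open>Only the line Re w = l matters, so the strip is degenerate, and the choice x0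
      = y removes the exponential factor.\<close>
    show "strip_decay (\<delta>\<^sup>2) (L / \<delta>\<^sup>2) (L / \<delta>\<^sup>2) (\<delta>\<^sup>2 * (decay_const L L y * exp (- sqrt (2 * L) * (y - y)))) (airy_G \<delta> y)"
      by (rule airy_G_decay) (use L \<delta> in auto)
    show "- (L / \<delta>\<^sup>2) \<le> l" "l \<le> - (L / \<delta>\<^sup>2)" using \<delta> by (auto simp: L_def)
    show "(R has_vector_derivative airy_G \<delta> y (vline l t)) (at t)" for t
      using Rd by (simp only: w_def)
    show "0 \<le> \<delta>\<^sup>2 * (decay_const L L y * exp (- sqrt (2 * L) * (y - y)))"
      using L by (simp add: decay_const_def)
  qed (use \<delta> l in \<open>auto simp: power_le_one\<close>)
  moreover have "(\<lambda>N. R (of_nat N + 1) - R (- of_nat N)) \<longlonglongrightarrow> lp / (2 * pi * \<i>) - lm / (2 * pi * \<i>)"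
  proof -
    \<comment> \<open>As Re u Im u = - 2 pi \<delta>^2 t with Re u < 0, Im u has the sign of t. The
      instances s = 1, c = 1 and s = - 1, c = 0 treat the ends t = N + 1 and t = - N.\<close>
    have grow: "filterlim (\<lambda>N::nat. s * Im (u (s * (of_nat N + c)))) at_top sequentially" if s: "s = 1 \<or> s = - 1" and c: "c \<ge> 0" for s c
    proof (subst filterlim_at_top_gt[where c = 0], intro allI impI)
      fix K :: real assume K: "K > 0"
      have "filterlim (\<lambda>N. \<delta>\<^sup>2 * (2 * pi * of_nat N)) at_top sequentially"
        using \<delta> by (intro filterlim_tendsto_pos_mult_at_top[OF tendsto_const] filterlim_real_sequentially) auto
      then have "\<forall>\<^sub>F N in sequentially. \<delta>\<^sup>2 * (2 * pi * of_nat N) > K * (K + sqrt (2 * L))"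
        by (auto simp: filterlim_at_top_dense)
      then show "\<forall>\<^sub>F N in sequentially. K \<le> s * Im (u (s * (of_nat N + c)))"
      proof eventually_elim
        case (elim N)
        let ?t = "s * (of_nat N + c)"
        have "\<delta>\<^sup>2 * (2 * pi * of_nat N) \<le> \<delta>\<^sup>2 * (2 * pi * (of_nat N + c))" using c by (intro mult_left_mono) auto
        then have v: "\<delta>\<^sup>2 * (2 * pi * (of_nat N + c)) > K * (K + sqrt (2 * L))" using elim by linarith
        have ss: "s * s = 1" using s by auto
        have "(- Re (u ?t)) * (s * Im (u ?t)) = - s * (Re (u ?t) * Im (u ?t))" by (simp only: mult_ac mult_minus_left)
        also have "\<dots> = (s * s) * (\<delta>\<^sup>2 * (2 * pi * (of_nat N + c)))"
          unfolding u(3) by (simp only: mult_ac mult_minus_left mult_minus_right minus_minus)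
        finally have prod: "(- Re (u ?t)) * (s * Im (u ?t)) = \<delta>\<^sup>2 * (2 * pi * (of_nat N + c))"
          by (simp only: ss mult_1)
        have "(s * Im (u ?t))\<^sup>2 = (s * s) * (Im (u ?t))\<^sup>2" by (simp only: power2_eq_square mult_ac)
        then have sq: "(- Re (u ?t))\<^sup>2 - (s * Im (u ?t))\<^sup>2 = 2 * L"
          using u(2)[of ?t] by (simp only: ss mult_1 power2_minus)
        have "- Re (u ?t) > 0" using u(1)[of ?t] by simp
        then show ?case using sq L prod v less_imp_le[OF K] by (rule hyperbola_Im_ge)
      qed
    qed
    have "(\<lambda>N. P (u (of_nat N + 1))) \<longlonglongrightarrow> lp"
      using filterlim_compose[OF lp(1) grow[of 1 1]] by (subst uh) simp
    moreover have "(\<lambda>N. P (u (- of_nat N))) \<longlonglongrightarrow> lm"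
      using filterlim_compose[OF lm(1) grow[of "- 1" 0]] by (subst uh) simp
    ultimately show ?thesis unfolding R_def by (intro tendsto_intros) auto
  qed
  ultimately have "integral {0..1} (\<lambda>t. psum (airy_G \<delta> y) (vline l t)) = lp / (2 * pi * \<i>) - lm / (2 * pi * \<i>)"
    by (rule LIMSEQ_unique)
  then show ?thesis using Airy_eq_limit[OF P lp(2) lm(2)] by (simp add: diff_divide_distrib)
qed

section \<open>Polylogarithms and the function Q\<close>

abbreviation halfline :: "real measure"
  where "halfline \<equiv> restrict_space lborel {0<..}"

lemma integrable_halfline_iff:
  fixes f :: "real \<Rightarrow> 'a :: {banach, second_countable_topology}"
  shows "integrable halfline f \<longleftrightarrow> set_integrable lborel {0<..} f"
  by (simp add: integrable_restrict_space set_integrable_def)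

lemma integral_halfline:
  fixes f :: "real \<Rightarrow> 'a :: {banach, second_countable_topology}"
  shows "(LINT x|halfline. f x) = (LINT x:{0<..}|lborel. f x)"
  by (simp add: integral_restrict_space set_lebesgue_integral_def)

lemma halfline_exp:
  fixes c :: real
  assumes c: "c > 0"
  shows "integrable halfline (\<lambda>s. exp (- c * s))" "(LINT s|halfline. exp (- c * s)) = 1 / c"
proof -
  have lim: "((\<lambda>s. - exp (- c * s) / c) \<longlongrightarrow> - 0 / c) at_top"
    using c by (intro tendsto_intros filterlim_compose[OF exp_at_bot]
      filterlim_tendsto_neg_mult_at_bot[OF tendsto_const _ filterlim_ident]) auto
  have lim0: "((\<lambda>s. - exp (- c * s) / c) \<longlongrightarrow> - exp (- c * 0) / c) (at_right 0)"
    using c by (intro tendsto_intros) auto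
  note ftc = interval_integral_FTC_nonneg[of "ereal 0" \<infinity> "\<lambda>s. - exp (- c * s) / c" "\<lambda>s. exp (- c * s)" "- exp (- c * 0) / c" "- 0 / c"]
  have d: "((\<lambda>s. - exp (- c * s) / c) has_real_derivative exp (- c * s)) (at s)" for s
    using c by (auto intro!: derivative_eq_intros)
  have set: "set_integrable lborel (einterval (ereal 0) \<infinity>) (\<lambda>s. exp (- c * s))"
    by (rule ftc(1)) (use d lim lim0 in \<open>auto simp: ereal_tendsto_simps simp del: zero_ereal_def intro!: continuous_intros\<close>)
  then show "integrable halfline (\<lambda>s. exp (- c * s))" by (simp add: integrable_halfline_iff)
  have "(LBINT s=ereal 0..\<infinity>. exp (- c * s)) = - 0 / c - - exp (- c * 0) / c"
    by (rule ftc(2)) (use d lim lim0 in \<open>auto simp: ereal_tendsto_simps intro!: continuous_intros\<close>)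
  then show "(LINT s|halfline. exp (- c * s)) = 1 / c"
    by (simp add: integral_halfline interval_lebesgue_integral_def)
qed

lemma halfline_exp_complex:
  fixes c :: complex
  assumes c: "Re c < 0"
  shows "(LINT s|halfline. exp (c * of_real s)) = - 1 / c"
proof -
  have c0: "c \<noteq> 0" using c by auto
  have "integrable halfline (\<lambda>s. exp (- (- Re c) * s))" using halfline_exp(1)[of "- Re c"] c by simp
  then have "integrable halfline (\<lambda>s. exp (c * of_real s))"
  proof (rule Bochner_Integration.integrable_bound)
    show "(\<lambda>s. exp (c * of_real s)) \<in> borel_measurable halfline"
      by (intro measurable_restrict_space1) measurable
  qed (intro AE_I2, simp)
  then have int: "set_integrable lborel (einterval (ereal 0) \<infinity>) (\<lambda>s. exp (c * of_real s))"
    by (simp add: integrable_halfline_iff)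
  have d: "((\<lambda>s. exp (c * of_real s) / c) has_vector_derivative exp (c * of_real s)) (at s)" for s
  proof -
    have "((\<lambda>u. exp (c * u) / c) has_field_derivative exp (c * of_real s)) (at (of_real s))"
      using c0 by (auto intro!: derivative_eq_intros)
    then show ?thesis by (rule has_vector_derivative_real_field)
  qed
  have "((\<lambda>s. exp (Re c * s) / norm c) \<longlongrightarrow> 0 / norm c) at_top"
    by (intro tendsto_divide tendsto_const filterlim_compose[OF exp_at_bot]
        filterlim_tendsto_neg_mult_at_bot[OF tendsto_const c filterlim_ident]) (use c0 in simp)
  then have "((\<lambda>s. norm (exp (c * of_real s) / c)) \<longlongrightarrow> 0) at_top" by (simp add: norm_divide)
  then have lim: "((\<lambda>s. exp (c * of_real s) / c) \<longlongrightarrow> 0) at_top" by (rule tendsto_norm_zero_cancel)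
  have lim0: "((\<lambda>s. exp (c * of_real s) / c) \<longlongrightarrow> exp (c * of_real 0) / c) (at_right 0)"
    by (intro tendsto_intros c0)
  have "(LBINT s=ereal 0..\<infinity>. exp (c * of_real s)) = 0 - exp (c * of_real 0) / c"
    by (rule interval_integral_FTC_integrable)
       (use d int lim lim0 in \<open>auto simp: ereal_tendsto_simps intro!: continuous_intros\<close>)
  then show ?thesis by (simp add: integral_halfline interval_lebesgue_integral_def)
qed

text \<open>exp (t + 1/2) majorises the Gaussian exp (- t^2 / 2) because (t + 1)^2 \<ge> 0, and its
  primitive is elementary. The open half-line t < 1 contains the range t \<le> 0 of the integral in
  \<open>Q\<close>.\<close>

lemma gauss_majorant:
  shows "set_integrable lborel {..<1} (\<lambda>t::real. exp (t + 1/2))"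
    and "(LINT t:{..<1}|lborel. exp (t + 1/2 :: real)) = exp (3/2)"
proof -
  have lim: "((\<lambda>t::real. exp (t + 1/2)) \<longlongrightarrow> 0) at_bot"
    using tendsto_mult[OF exp_at_bot tendsto_const[of "exp (1/2 :: real)"]] by (simp only: exp_add mult_zero_left)
  note ftc = interval_integral_FTC_nonneg[of "- \<infinity>" "ereal 1" "\<lambda>t. exp (t + 1/2)" "\<lambda>t. exp (t + 1/2)" 0 "exp (1 + 1/2)"]
  have d: "((\<lambda>t::real. exp (t + 1/2)) has_real_derivative exp (t + 1/2)) (at t)" for t
    by (auto intro!: derivative_eq_intros)
  have lim1: "((\<lambda>t::real. exp (t + 1/2)) \<longlongrightarrow> exp (1 + 1/2)) (at_left 1)"
    by (intro tendsto_intros)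
  have set: "set_integrable lborel (einterval (- \<infinity>) (ereal 1)) (\<lambda>t. exp (t + 1/2))"
    by (rule ftc(1)) (use d lim lim1 in \<open>auto simp: ereal_tendsto_simps intro!: continuous_intros\<close>)
  then show "set_integrable lborel {..<1} (\<lambda>t::real. exp (t + 1/2))" by simp
  have "(LBINT t=-\<infinity>..ereal 1. exp (t + 1/2)) = exp (1 + 1/2) - 0"
    by (rule ftc(2)) (use d lim lim1 in \<open>auto simp: ereal_tendsto_simps intro!: continuous_intros\<close>)
  then show "(LINT t:{..<1}|lborel. exp (t + 1/2 :: real)) = exp (3/2)"
    by (simp add: interval_lebesgue_integral_def)
qed

section \<open>Polylogarithms in the unit disc and the size of Q\<close>

lemma polylog_term_bound:
  fixes z :: complex
  assumes "s \<ge> 0"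
  shows "norm (z ^ Suc k / of_real (real (Suc k) powr s)) \<le> norm z ^ Suc k"
proof -
  have "1 \<le> real (Suc k) powr s" using assms by (intro ge_one_powr_ge_zero) auto
  then have "norm z ^ Suc k / (real (Suc k) powr s) \<le> norm z ^ Suc k / 1" by (intro divide_left_mono) auto
  then show ?thesis by (simp add: norm_divide norm_mult norm_power)
qed

lemma polylog_bound:
  assumes "s \<ge> 0" "norm z < 1"
  shows "norm (polylog s z) \<le> norm z / (1 - norm z)"
proof -
  have sm: "summable (\<lambda>k. norm z ^ Suc k)" using assms(2) by (simp add: summable_mult summable_geometric)
  have "norm (polylog s z) \<le> (\<Sum>k. norm z ^ Suc k)"
    using assms(2) unfolding polylog_def polylog_series_def
    by (simp only: if_True) (rule norm_suminf_le[OF polylog_term_bound[OF assms(1)] sm])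
  also have "\<dots> = norm z / (1 - norm z)"
    using assms(2) by (simp add: suminf_mult summable_geometric suminf_geometric)
  finally show ?thesis .
qed

lemma polylog_holomorphic:
  assumes s: "s \<ge> 0"
  shows "polylog s holomorphic_on ball 0 1"
proof (rule holomorphic_transform)
  show "(\<lambda>z. LINT k|count_space UNIV. z ^ Suc k / of_real (real (Suc k) powr s)) holomorphic_on ball (0::complex) 1"
  proof (rule holomorphic_on_integral)
    fix k :: nat
    show "(\<lambda>z. z ^ Suc k / of_real (real (Suc k) powr s)) holomorphic_on ball 0 1"
      by (intro holomorphic_intros) auto
  next
    fix z :: complex assume z: "z \<in> ball 0 1"
    define r where "r = (1 - norm z) / 2"
    have r: "r > 0" using z by (simp add: r_def)
    have wr: "norm w \<le> norm z + r" if "w \<in> cball z r" for w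
      using that norm_triangle_ineq[of z "w - z"] by (simp add: dist_norm norm_minus_commute)
    have r1: "norm z + r < 1" using z by (simp add: r_def field_simps)
    show "\<exists>r>0. \<exists>g. cball z r \<subseteq> ball 0 1 \<and> integrable (count_space UNIV) g \<and>
        (\<forall>w\<in>cball z r. \<forall>k\<in>space (count_space UNIV). norm (w ^ Suc k / of_real (real (Suc k) powr s)) \<le> g k)"
    proof (intro exI[of _ r] exI[of _ "\<lambda>k. (norm z + r) ^ Suc k"] conjI r ballI)
      show "cball z r \<subseteq> ball 0 1" using wr r1 by fastforce
      show "integrable (count_space UNIV) (\<lambda>k. (norm z + r) ^ Suc k)"
        using r r1 by (simp add: integrable_count_space_nat_iff summable_mult summable_geometric abs_mult)
      fix w k assume w: "w \<in> cball z r"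
      show "norm (w ^ Suc k / of_real (real (Suc k) powr s)) \<le> (norm z + r) ^ Suc k"
        by (rule order_trans[OF polylog_term_bound[OF s] power_mono[OF wr[OF w]]]) simp
    qed
  qed auto
  fix z :: complex assume z: "z \<in> ball 0 1"
  then have sm: "summable (\<lambda>k. norm z ^ Suc k)" by (simp add: summable_mult summable_geometric)
  have "summable (\<lambda>k. norm (z ^ Suc k / of_real (real (Suc k) powr s)))"
    by (rule summable_comparison_test'[OF sm]) (use polylog_term_bound[OF s] in auto)
  then have "(LINT k|count_space UNIV. z ^ Suc k / of_real (real (Suc k) powr s)) = (\<Sum>k. z ^ Suc k / of_real (real (Suc k) powr s))"
    by (intro integral_count_space_nat) (simp add: integrable_count_space_nat_iff)
  then show "(LINT k|count_space UNIV. z ^ Suc k / of_real (real (Suc k) powr s)) = polylog s z"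
    using z by (simp add: polylog_def polylog_series_def)
qed

definition Qint :: "complex \<Rightarrow> real \<Rightarrow> complex"
  where "Qint \<xi> t = indicator {..0} t *\<^sub>R polylog (1/2) (exp (- (\<xi> + of_real t)\<^sup>2 / 2))"

lemma Q_eq: "Q \<xi> = of_real (sqrt (2 / pi)) * (LINT t|lborel. Qint \<xi> t)"
  by (simp add: Q_def Qint_def set_lebesgue_integral_def)

text \<open>Geometric series bound for a polylogarithm of nonnegative order at modulus exp r; it is
  of order exp r as r tends to minus infinity.\<close>

definition geo :: "real \<Rightarrow> real"
  where "geo r = exp r / (1 - exp r)"

lemma geo_mono: "r \<le> r' \<Longrightarrow> r' < 0 \<Longrightarrow> geo r \<le> geo r'"
  unfolding geo_def by (intro frac_le) auto

lemma geo_nonneg: "r < 0 \<Longrightarrow> geo r \<ge> 0"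
  by (simp add: geo_def)

text \<open>The exponent expands to w - t \<xi> - t^2 / 2, where t \<le> 0 and Re \<xi> < 0, so
  moving left from the root only shrinks the modulus.\<close>

lemma norm_exp_xi_shift:
  assumes w: "Re w < 0" and t: "t \<le> 0"
  shows "norm (exp (- (xi w + of_real t)\<^sup>2 / 2)) \<le> exp (Re w) * exp (t + 1/2)"
    and "norm (exp (- (xi w + of_real t)\<^sup>2 / 2)) \<le> exp (Re w)"
proof -
  have "- (xi w + of_real t)\<^sup>2 / 2 = w - of_real t * xi w - of_real (t\<^sup>2 / 2)"
    using xi_square[of w] by (simp add: power2_sum field_simps)
  then have "Re (- (xi w + of_real t)\<^sup>2 / 2) = Re w - t * Re (xi w) - t\<^sup>2 / 2" by simp
  moreover have "t * Re (xi w) \<ge> 0" using t Re_xi_neg[OF w] by (simp add: mult_nonpos_nonpos)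
  ultimately have le: "Re (- (xi w + of_real t)\<^sup>2 / 2) \<le> Re w - t\<^sup>2 / 2" by linarith
  have "0 \<le> (t + 1)\<^sup>2" by simp
  then have "- (t\<^sup>2 / 2) \<le> t + 1 / 2" by (simp add: power2_sum)
  then show "norm (exp (- (xi w + of_real t)\<^sup>2 / 2)) \<le> exp (Re w) * exp (t + 1/2)"
    using le unfolding norm_exp_eq_Re exp_add[symmetric] by (subst exp_le_cancel_iff) linarith
  show "norm (exp (- (xi w + of_real t)\<^sup>2 / 2)) \<le> exp (Re w)"
    using le unfolding norm_exp_eq_Re by (subst exp_le_cancel_iff) (smt (verit) zero_le_power2 divide_nonneg_nonneg)
qed

lemma norm_exp_xi_shift_less:
  assumes "Re w < 0" "t \<le> 0"
  shows "norm (exp (- (xi w + of_real t)\<^sup>2 / 2)) < 1"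
  by (rule le_less_trans[OF norm_exp_xi_shift(2)[OF assms]]) (use assms(1) in simp)

lemma Qint_bound:
  assumes w: "Re w < 0"
  shows "norm (Qint (xi w) t) \<le> geo (Re w) * (indicator {..<1} t * exp (t + 1/2))"
proof (cases "t \<le> 0")
  case True
  let ?v = "exp (- (xi w + of_real t)\<^sup>2 / 2)"
  note v = norm_exp_xi_shift[OF w True]
  have e: "exp (Re w) < 1" using w by simp
  have "norm (polylog (1/2) ?v) \<le> norm ?v / (1 - norm ?v)"
    using v(2) e by (intro polylog_bound) auto
  also have "\<dots> \<le> (exp (Re w) * exp (t + 1/2)) / (1 - exp (Re w))"
    using v e by (intro frac_le) auto
  finally show ?thesis using True by (simp add: Qint_def geo_def)
qed (use geo_nonneg[OF w] in \<open>simp add: Qint_def\<close>)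

lemma Qint_measurable:
  assumes w: "Re w < 0"
  shows "Qint (xi w) \<in> borel_measurable borel"
  unfolding Qint_def
proof (rule borel_measurable_continuous_on_indicator)
  have "continuous_on {..0} (\<lambda>t. exp (- (xi w + of_real t)\<^sup>2 / 2))" by (intro continuous_intros) auto
  then show "continuous_on {..0} (\<lambda>t. polylog (1/2) (exp (- (xi w + of_real t)\<^sup>2 / 2)))"
  proof (rule continuous_on_compose2[OF holomorphic_on_imp_continuous_on[OF polylog_holomorphic], rotated])
    show "(\<lambda>t. exp (- (xi w + of_real t)\<^sup>2 / 2)) ` {..0} \<subseteq> ball 0 1"
      using norm_exp_xi_shift_less[OF w] by (auto simp only: mem_ball_0 atMost_iff)
  qed simp
qed simp

text \<open>So Q is of the order of |z| = exp (Re w) on small circles, an exponentially small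
  perturbation of the Airy exponent.\<close>

lemma Q_xi_bound:
  assumes w: "Re w < 0"
  shows "norm (Q (xi w)) \<le> exp (3/2) * geo (Re w)"
proof -
  have "norm (LINT t|lborel. Qint (xi w) t) \<le> (LINT t|lborel. geo (Re w) * (indicator {..<1} t * exp (t + 1/2)))"
    using gauss_majorant(1) by (intro norm_integral_le Qint_bound w) (simp add: set_integrable_def)
  also have "\<dots> = geo (Re w) * exp (3/2)"
    using gauss_majorant(2) by (simp add: set_lebesgue_integral_def)
  finally have "norm (Q (xi w)) \<le> sqrt (2 / pi) * (geo (Re w) * exp (3/2))"
    unfolding Q_eq norm_mult by (intro mult_mono) auto
  also have "\<dots> \<le> 1 * (geo (Re w) * exp (3/2))"
    using pi_gt3 geo_nonneg[OF w] by (intro mult_right_mono) auto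
  finally show ?thesis by (simp add: mult.commute)
qed

lemma Q_xi_holomorphic: "(\<lambda>w. Q (xi w)) holomorphic_on {w. Re w < 0}"
  unfolding Q_eq
proof (intro holomorphic_intros holomorphic_on_integral[OF open_left_half_plane])
  fix t :: real
  show "(\<lambda>w. Qint (xi w) t) holomorphic_on {w. Re w < 0}"
  proof (cases "t \<le> 0")
    case True
    have "(\<lambda>w. exp (- (xi w + of_real t)\<^sup>2 / 2)) holomorphic_on {w. Re w < 0}"
      by (intro holomorphic_intros xi_holomorphic) auto
    then have "(\<lambda>w. polylog (1/2) (exp (- (xi w + of_real t)\<^sup>2 / 2))) holomorphic_on {w. Re w < 0}"
      by (rule holomorphic_on_compose_gen[OF _ polylog_holomorphic, unfolded o_def])
         (use norm_exp_xi_shift_less[OF _ True] in \<open>auto simp only: mem_ball_0 mem_Collect_eq\<close>)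
    then show ?thesis using True by (simp add: Qint_def)
  qed (simp add: Qint_def)
next
  fix w assume "w \<in> {w. Re w < 0}"
  then have w: "Re w < 0" by simp
  show "Qint (xi w) \<in> borel_measurable lborel" using Qint_measurable[OF w] by simp
  define r where "r = - Re w / 2"
  have r: "r > 0" using w by (simp add: r_def)
  have wr: "Re v \<le> - r" if "v \<in> cball w r" for v
    using that abs_Re_le_cmod[of "w - v"] by (auto simp: dist_norm r_def)
  show "\<exists>r>0. \<exists>g. cball w r \<subseteq> {w. Re w < 0} \<and> integrable lborel g \<and>
      (\<forall>v\<in>cball w r. \<forall>t\<in>space lborel. norm (Qint (xi v) t) \<le> g t)"
  proof (intro exI[of _ r] exI[of _ "\<lambda>t. geo (- r) * (indicator {..<1} t * exp (t + 1/2))"] conjI r ballI)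
    show "cball w r \<subseteq> {w. Re w < 0}" using wr r by fastforce
    show "integrable lborel (\<lambda>t. geo (- r) * (indicator {..<1} t * exp (t + 1/2)))"
      using gauss_majorant(1) by (simp add: set_integrable_def)
    fix v t assume v: "v \<in> cball w r"
    have "norm (Qint (xi v) t) \<le> geo (Re v) * (indicator {..<1} t * exp (t + 1/2))"
      using wr[OF v] r by (intro Qint_bound) auto
    also have "\<dots> \<le> geo (- r) * (indicator {..<1} t * exp (t + 1/2))"
      using wr[OF v] r by (intro mult_right_mono geo_mono) auto
    finally show "norm (Qint (xi v) t) \<le> geo (- r) * (indicator {..<1} t * exp (t + 1/2))" .
  qed
qed

section \<open>The Hankel symbol of the periodic TASEP\<close>

text \<open>The exact summand of the symbol, with \<tau> = \<delta>^3; \<open>airy_G\<close> is what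
  remains when Q is omitted.\<close>

definition tasep_G :: "real \<Rightarrow> real \<Rightarrow> complex \<Rightarrow> complex"
  where "tasep_G \<delta> y w = airy_G \<delta> y w * exp (- Q (xi w))"

definition hz :: "real \<Rightarrow> real \<Rightarrow> complex \<Rightarrow> complex"
  where "hz \<delta> y z = psum (tasep_G \<delta> y) (Ln z)"

lemma tasep_G_holomorphic: "tasep_G \<delta> y holomorphic_on {w. Re w < 0}"
  unfolding tasep_G_def by (intro holomorphic_intros airy_G_holomorphic Q_xi_holomorphic)

definition tasep_const :: "real \<Rightarrow> real \<Rightarrow> real \<Rightarrow> real"
  where "tasep_const l1 l2 x0 = decay_const l1 l2 x0 * exp (exp (3/2) * geo (- l1))"

lemma decay_const_nonneg: "0 < l1 \<Longrightarrow> 0 \<le> decay_const l1 l2 x0"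
  by (simp add: decay_const_def)

lemma tasep_const_nonneg: "0 < l1 \<Longrightarrow> 0 \<le> tasep_const l1 l2 x0"
  by (simp add: tasep_const_def decay_const_nonneg)

lemma tasep_G_decay:
  assumes l: "0 < l1" and \<delta>: "0 < \<delta>" "\<delta> \<le> 1" and y: "x0 \<le> y"
  shows "strip_decay (\<delta>\<^sup>2) (l1 / \<delta>\<^sup>2) (l2 / \<delta>\<^sup>2)
    (\<delta>\<^sup>2 * (tasep_const l1 l2 x0 * exp (- sqrt (2 * l1) * (y - x0)))) (tasep_G \<delta> y)"
  unfolding strip_decay_def
proof (intro allI impI)
  fix w assume w: "- (l2 / \<delta>\<^sup>2) \<le> Re w \<and> Re w \<le> - (l1 / \<delta>\<^sup>2)"
  \<comment> \<open>\<delta> \<le> 1 keeps the strip to the left of Re w = - l1, so the bound for Q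
    is free of \<delta>.\<close>
  have "l1 \<le> l1 / \<delta>\<^sup>2" using \<delta> l by (simp add: le_divide_eq mult_left_le power_le_one)
  then have wl: "Re w \<le> - l1" using w by linarith
  then have w0: "Re w < 0" using l by simp
  have "norm (Q (xi w)) \<le> exp (3/2) * geo (- l1)"
    using wl l by (intro order_trans[OF Q_xi_bound[OF w0]] mult_left_mono geo_mono) auto
  then have q: "norm (exp (- Q (xi w))) \<le> exp (exp (3/2) * geo (- l1))"
    using abs_Re_le_cmod[of "Q (xi w)"] unfolding norm_exp_eq_Re by (subst exp_le_cancel_iff) simp
  have "norm (airy_G \<delta> y w) \<le> \<delta>\<^sup>2 * (decay_const l1 l2 x0 * exp (- sqrt (2 * l1) * (y - x0))) * exp (- \<delta>\<^sup>2 * \<bar>Im w\<bar>)"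
    using airy_G_decay[OF l \<delta>(1) y, of l2] w unfolding strip_decay_def by blast
  then have "norm (tasep_G \<delta> y w) \<le> (\<delta>\<^sup>2 * (decay_const l1 l2 x0 * exp (- sqrt (2 * l1) * (y - x0))) * exp (- \<delta>\<^sup>2 * \<bar>Im w\<bar>))
      * exp (exp (3/2) * geo (- l1))"
    unfolding tasep_G_def norm_mult using q l by (intro mult_mono) (auto simp: decay_const_nonneg)
  then show "norm (tasep_G \<delta> y w) \<le> \<delta>\<^sup>2 * (tasep_const l1 l2 x0 * exp (- sqrt (2 * l1) * (y - x0))) * exp (- \<delta>\<^sup>2 * \<bar>Im w\<bar>)"
    by (simp add: tasep_const_def mult_ac)
qed

lemma psum_Ln_holomorphic:
  assumes "G holomorphic_on {w. Re w < 0}" "\<beta> > 0"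
    and "\<And>l1 l2. 0 < l1 \<Longrightarrow> \<exists>c. strip_decay \<beta> l1 l2 c G"
  shows "(\<lambda>z. psum G (Ln z)) holomorphic_on ball 0 1 - {0}"
  by (rule periodic_Ln_holomorphic[OF psum_holomorphic[OF assms] psum_periodic])

lemma hz_holomorphic:
  assumes \<delta>: "0 < \<delta>" "\<delta> \<le> 1"
  shows "hz \<delta> y holomorphic_on ball 0 1 - {0}"
  unfolding hz_def
proof (rule psum_Ln_holomorphic[OF tasep_G_holomorphic, of "\<delta>\<^sup>2"])
  fix l1 l2 :: real assume "0 < l1"
  then show "\<exists>c. strip_decay (\<delta>\<^sup>2) l1 l2 c (tasep_G \<delta> y)"
    using tasep_G_decay[of "l1 * \<delta>\<^sup>2" \<delta> y y "l2 * \<delta>\<^sup>2"] \<delta> by auto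
qed (use \<delta> in auto)

lemma airy_psum_holomorphic:
  assumes \<delta>: "0 < \<delta>"
  shows "(\<lambda>z. psum (airy_G \<delta> y) (Ln z)) holomorphic_on ball 0 1 - {0}"
proof (rule psum_Ln_holomorphic[OF airy_G_holomorphic, of "\<delta>\<^sup>2"])
  fix l1 l2 :: real assume "0 < l1"
  then show "\<exists>c. strip_decay (\<delta>\<^sup>2) l1 l2 c (airy_G \<delta> y)"
    using airy_G_decay[of "l1 * \<delta>\<^sup>2" \<delta> y y "l2 * \<delta>\<^sup>2"] \<delta> by auto
qed (use \<delta> in auto)

lemma hz_bound:
  assumes l: "0 < l1" and \<delta>: "0 < \<delta>" "\<delta> \<le> 1" and y: "x0 \<le> y"
    and z: "z \<noteq> 0" "- (l2 / \<delta>\<^sup>2) \<le> ln (norm z)" "ln (norm z) \<le> - (l1 / \<delta>\<^sup>2)"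
  shows "norm (hz \<delta> y z) \<le> 4 * exp pi * tasep_const l1 l2 x0 * exp (- sqrt (2 * l1) * (y - x0))"
  using psum_bound[OF tasep_G_decay[OF l \<delta> y, of l2], of "Ln z"] z \<delta> l
  by (simp add: hz_def power_le_one tasep_const_nonneg)

lemma airy_psum_bound:
  assumes l: "0 < l1" and \<delta>: "0 < \<delta>" "\<delta> \<le> 1" and y: "x0 \<le> y"
    and z: "z \<noteq> 0" "- (l2 / \<delta>\<^sup>2) \<le> ln (norm z)" "ln (norm z) \<le> - (l1 / \<delta>\<^sup>2)"
  shows "norm (psum (airy_G \<delta> y) (Ln z)) \<le> 4 * exp pi * decay_const l1 l2 x0 * exp (- sqrt (2 * l1) * (y - x0))"
  using psum_bound[OF airy_G_decay[OF l \<delta>(1) y, of l2], of "Ln z"] z \<delta> l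
  by (simp add: power_le_one decay_const_nonneg)

section \<open>The symbol is exponentially close to the Airy function\<close>

lemma exp_half_le: "exp (- (1/2) :: real) \<le> 2 / 3"
proof -
  have "3 / 2 \<le> exp (1/2 :: real)" using exp_ge_add_one_self[of "1/2 :: real"] by simp
  then show ?thesis by (simp add: exp_minus field_simps)
qed

lemma exp_minus_one_le: "exp (- 1 :: real) \<le> 1 / 2"
  using exp_ge_add_one_self[of "1 :: real"] by (simp add: exp_minus field_simps)

(* The circles of radii exp (- 1 / (2 \<delta>^2)) and exp (- 3 / (2 \<delta>^2)) enclose |z| = exp (- 1 / \<delta>^2); this is the
   exponential accuracy of the trapezoidal rule for functions analytic in a strip. *)
lemma airy_psum_approx:
  assumes \<delta>: "0 < \<delta>" "\<delta> \<le> 1" and y: "x0 \<le> y" and z: "norm z = exp (- 1 / \<delta>\<^sup>2)"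
  shows "norm (psum (airy_G \<delta> y) (Ln z) - of_real (Airy y))
    \<le> 24 * exp pi * decay_const (1/2) (3/2) x0 * exp (- 1 / (2 * \<delta>\<^sup>2)) * exp (- (y - x0))"
proof -
  \<comment> \<open>|z| = \<rho>^2, and the enclosing circles have radii \<rho>^3 and \<rho>. Both
    belong to the strip with l1 = 1/2 and l2 = 3/2, where the decay rate sqrt (2 l1) is 1.\<close>
  define \<rho> where "\<rho> = exp (- 1 / (2 * \<delta>\<^sup>2))"
  define M where "M = 4 * exp pi * decay_const (1/2) (3/2) x0 * exp (- (y - x0))"
  have M0: "M \<ge> 0" by (simp add: M_def decay_const_nonneg)
  have d2: "0 < \<delta>\<^sup>2" "\<delta>\<^sup>2 \<le> 1" using \<delta> by (auto simp: power_le_one)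
  have "- 1 / (2 * \<delta>\<^sup>2) \<le> - (1/2)" using d2 by (simp add: field_simps)
  then have \<rho>: "0 < \<rho>" "\<rho> \<le> 2 / 3" using exp_half_le unfolding \<rho>_def by (auto intro: order_trans[rotated])
  have lnr: "ln \<rho> = - 1 / (2 * \<delta>\<^sup>2)" by (simp add: \<rho>_def)
  have r0: "norm z = \<rho>\<^sup>2" by (simp add: z \<rho>_def power2_eq_square exp_add[symmetric])
  have r1: "\<rho> ^ 3 < \<rho>\<^sup>2" using \<rho> by (simp add: power3_eq_cube power2_eq_square)
  have r2: "\<rho>\<^sup>2 < \<rho>" using \<rho> by (simp add: power2_eq_square)
  have bd: "norm (psum (airy_G \<delta> y) (Ln v)) \<le> M" if v: "norm v = \<rho> ^ 3 \<or> norm v = \<rho>" for v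
  proof -
    have v0: "v \<noteq> 0" using v \<rho> by auto
    have "ln (norm v) = 3 * ln \<rho> \<or> ln (norm v) = ln \<rho>" using v \<rho> ln_realpow[of \<rho> 3] by auto
    then have "- ((3/2) / \<delta>\<^sup>2) \<le> ln (norm v)" "ln (norm v) \<le> - ((1/2) / \<delta>\<^sup>2)"
      using d2 by (auto simp: lnr field_simps)
    from airy_psum_bound[OF _ \<delta> y v0 this] show ?thesis by (simp add: M_def)
  qed
  have "1 / (2 * pi * \<i>) * contour_integral (circlepath 0 \<rho>) (\<lambda>z. psum (airy_G \<delta> y) (Ln z) / z)
      = integral {0..1} (\<lambda>t. psum (airy_G \<delta> y) (vline (ln \<rho>) t))"
    by (rule circle_mean_psum[OF \<rho>(1)])
  also have "\<dots> = of_real (Airy y)"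
    by (rule airy_G_mean[OF \<delta>]) (use d2 lnr in simp)
  finally have mean: "1 / (2 * pi * \<i>) * contour_integral (circlepath 0 \<rho>) (\<lambda>z. psum (airy_G \<delta> y) (Ln z) / z) = of_real (Airy y)" .
  have "norm (psum (airy_G \<delta> y) (Ln z) - of_real (Airy y)) \<le> M * (\<rho>\<^sup>2 / (\<rho> - \<rho>\<^sup>2) + \<rho> ^ 3 / (\<rho>\<^sup>2 - \<rho> ^ 3))"
    using circle_mean_bound[OF airy_psum_holomorphic[OF \<delta>(1)], of "\<rho> ^ 3" z \<rho> y M] r0 r1 r2 \<rho> bd
    unfolding mean by simp
  \<comment> \<open>Both fractions equal \<rho> / (1 - \<rho>), at most 3 \<rho> since \<rho> \<le>
    2/3. With the 4 in M this makes the constant 24.\<close>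
  also have "\<rho>\<^sup>2 / (\<rho> - \<rho>\<^sup>2) + \<rho> ^ 3 / (\<rho>\<^sup>2 - \<rho> ^ 3) = 2 * (\<rho> / (1 - \<rho>))"
  proof -
    have "\<rho> - \<rho>\<^sup>2 = \<rho> * (1 - \<rho>)" "\<rho>\<^sup>2 - \<rho> ^ 3 = \<rho>\<^sup>2 * (1 - \<rho>)"
      by (simp_all add: power2_eq_square power3_eq_cube algebra_simps)
    then show ?thesis using \<rho> by (simp add: power2_eq_square power3_eq_cube)
  qed
  also have "\<rho> / (1 - \<rho>) \<le> \<rho> / (1 / 3)" using \<rho> by (intro divide_left_mono) auto
  finally have "norm (psum (airy_G \<delta> y) (Ln z) - of_real (Airy y)) \<le> M * (2 * (\<rho> / (1 / 3)))"
    using M0 by (simp add: mult_left_mono)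
  then show ?thesis by (simp add: M_def \<rho>_def mult_ac)
qed

lemma norm_exp_minus_one_le:
  fixes v :: complex
  shows "norm (exp v - 1) \<le> exp (norm v) * norm v"
proof -
  have "norm (exp v - exp 0) \<le> exp (norm v) * norm (v - 0)"
  proof (rule field_differentiable_bound[of "cball 0 (norm v)" exp exp])
    fix u :: complex assume "u \<in> cball 0 (norm v)"
    then show "norm (exp u) \<le> exp (norm v)"
      using complex_Re_le_cmod[of u] by (simp add: order_trans)
    show "(exp has_field_derivative exp u) (at u within cball 0 (norm v))"
      by (rule DERIV_exp[THEN has_field_derivative_at_within])
  qed auto
  then show ?thesis by simp
qed

text \<open>The first summand is the error of the trapezoidal rule, the second the contribution of
  Q: exp (3/2) comes from \<open>Q_xi_bound\<close>, and exp (exp (3/2)) from bounding exp (- Q) -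
  1.\<close>

definition approx_const :: "real \<Rightarrow> real"
  where "approx_const x0 = 24 * exp pi * decay_const (1/2) (3/2) x0
    + 8 * exp pi * exp (3/2) * exp (exp (3/2)) * decay_const 1 1 x0"

lemma approx_const_pos: "approx_const x0 > 0"
  by (simp add: approx_const_def decay_const_def add_pos_pos)

lemma hz_approx:
  assumes \<delta>: "0 < \<delta>" "\<delta> \<le> 1" and y: "x0 \<le> y" and z: "norm z = exp (- 1 / \<delta>\<^sup>2)"
  shows "norm (hz \<delta> y z - of_real (Airy y)) \<le> approx_const x0 * exp (- 1 / (2 * \<delta>\<^sup>2)) * exp (- (y - x0))"
proof -
  have d2: "0 < \<delta>\<^sup>2" "\<delta>\<^sup>2 \<le> 1" using \<delta> by (auto simp: power_le_one)
  define e where "e = exp (- 1 / \<delta>\<^sup>2)"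
  have "- 1 / \<delta>\<^sup>2 \<le> - 1" using d2 by (simp add: field_simps)
  then have e: "0 < e" "e \<le> 1 / 2" using exp_minus_one_le unfolding e_def by (auto intro: order_trans[rotated])
  have z0: "z \<noteq> 0" using z by auto
  have lnz: "Re (Ln z) = - (1 / \<delta>\<^sup>2)" using z z0 by simp
  \<comment> \<open>Only the line Re w = - 1 / \<delta>^2 enters, so l1 = l2 = 1. Since e \<le> 1/2,
    \<open>geo\<close> is at most 2 e there, and 2 e \<le> 1 bounds Q by exp (3/2).\<close>
  define c where "c = decay_const 1 1 x0 * exp (- (y - x0)) * (2 * exp (3/2) * exp (exp (3/2)) * e)"
  have c0: "c \<ge> 0" using e by (simp add: c_def decay_const_nonneg)
  have dG: "strip_decay (\<delta>\<^sup>2) (1 / \<delta>\<^sup>2) (1 / \<delta>\<^sup>2) (\<delta>\<^sup>2 * c) (\<lambda>w. tasep_G \<delta> y w - airy_G \<delta> y w)"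
    unfolding strip_decay_def
  proof (intro allI impI)
    fix w assume "- (1 / \<delta>\<^sup>2) \<le> Re w \<and> Re w \<le> - (1 / \<delta>\<^sup>2)"
    then have w: "Re w = - 1 / \<delta>\<^sup>2" by simp
    have w0: "Re w < 0" using w d2 by simp
    have "exp (Re w) = e" by (simp add: w e_def)
    then have "geo (Re w) = e / (1 - e)" by (simp add: geo_def)
    also have "\<dots> \<le> e / (1 / 2)" using e by (intro divide_left_mono) auto
    finally have ge: "geo (Re w) \<le> 2 * e" by simp
    have q: "norm (Q (xi w)) \<le> exp (3/2) * (2 * e)"
      by (rule order_trans[OF Q_xi_bound[OF w0]]) (intro mult_left_mono ge, simp)
    also have "\<dots> \<le> exp (3/2) * 1" using e by (intro mult_left_mono) auto
    finally have q1: "norm (Q (xi w)) \<le> exp (3/2)" by simp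
    have "norm (exp (- Q (xi w)) - 1) \<le> exp (norm (Q (xi w))) * norm (Q (xi w))"
      using norm_exp_minus_one_le[of "- Q (xi w)"] by simp
    also have "\<dots> \<le> exp (exp (3/2)) * (exp (3/2) * (2 * e))" using q q1 by (intro mult_mono) auto
    finally have qe: "norm (exp (- Q (xi w)) - 1) \<le> exp (exp (3/2)) * (exp (3/2) * (2 * e))" .
    have "norm (airy_G \<delta> y w) \<le> \<delta>\<^sup>2 * (decay_const 1 1 x0 * exp (- sqrt (2 * 1) * (y - x0))) * exp (- \<delta>\<^sup>2 * \<bar>Im w\<bar>)"
      using airy_G_decay[of 1 \<delta> x0 y 1] \<delta> y w unfolding strip_decay_def by simp
    also have "\<dots> \<le> \<delta>\<^sup>2 * (decay_const 1 1 x0 * exp (- (y - x0))) * exp (- \<delta>\<^sup>2 * \<bar>Im w\<bar>)"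
    proof -
      have "1 * (y - x0) \<le> sqrt (2 * 1) * (y - x0)" using y by (intro mult_right_mono) auto
      then show ?thesis by (intro mult_right_mono mult_left_mono) (auto simp: decay_const_nonneg)
    qed
    finally have ga: "norm (airy_G \<delta> y w) \<le> \<delta>\<^sup>2 * (decay_const 1 1 x0 * exp (- (y - x0))) * exp (- \<delta>\<^sup>2 * \<bar>Im w\<bar>)" .
    have "norm (tasep_G \<delta> y w - airy_G \<delta> y w) = norm (airy_G \<delta> y w) * norm (exp (- Q (xi w)) - 1)"
      unfolding norm_mult[symmetric] by (simp add: tasep_G_def algebra_simps)
    also have "\<dots> \<le> (\<delta>\<^sup>2 * (decay_const 1 1 x0 * exp (- (y - x0))) * exp (- \<delta>\<^sup>2 * \<bar>Im w\<bar>)) * (exp (exp (3/2)) * (exp (3/2) * (2 * e)))"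
      using ga qe by (intro mult_mono) (auto simp: decay_const_nonneg)
    also have "\<dots> = \<delta>\<^sup>2 * c * exp (- \<delta>\<^sup>2 * \<bar>Im w\<bar>)" by (simp add: c_def mult_ac)
    finally show "norm (tasep_G \<delta> y w - airy_G \<delta> y w) \<le> \<delta>\<^sup>2 * c * exp (- \<delta>\<^sup>2 * \<bar>Im w\<bar>)" .
  qed
  have "psum (\<lambda>w. tasep_G \<delta> y w - airy_G \<delta> y w) (Ln z) = hz \<delta> y z - psum (airy_G \<delta> y) (Ln z)"
    unfolding hz_def psum_def
    using psum_summable[OF tasep_G_decay[of 1 \<delta> y y 1], of "Ln z"] psum_summable[OF airy_G_decay[of 1 \<delta> y y 1], of "Ln z"]
      lnz \<delta> d2 by (intro Bochner_Integration.integral_diff) auto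
  then have "norm (hz \<delta> y z - psum (airy_G \<delta> y) (Ln z)) \<le> 4 * exp pi * c"
    using psum_bound[OF dG d2, of "Ln z"] lnz c0 by simp
  also have "\<dots> = 8 * exp pi * exp (3/2) * exp (exp (3/2)) * decay_const 1 1 x0 * exp (- (y - x0)) * e"
    by (simp add: c_def mult_ac)
  \<comment> \<open>Q contributes exp (- 1 / \<delta>^2), the square of the trapezoidal rate, so the
    latter determines the result.\<close>
  also have "\<dots> \<le> 8 * exp pi * exp (3/2) * exp (exp (3/2)) * decay_const 1 1 x0 * exp (- (y - x0)) * exp (- 1 / (2 * \<delta>\<^sup>2))"
  proof (intro mult_left_mono)
    show "e \<le> exp (- 1 / (2 * \<delta>\<^sup>2))" unfolding e_def using d2 by (simp add: field_simps)
  qed (auto simp: decay_const_nonneg)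
  finally have 1: "norm (hz \<delta> y z - psum (airy_G \<delta> y) (Ln z)) \<le>
    8 * exp pi * exp (3/2) * exp (exp (3/2)) * decay_const 1 1 x0 * exp (- (y - x0)) * exp (- 1 / (2 * \<delta>\<^sup>2))" .
  have "norm (hz \<delta> y z - of_real (Airy y)) \<le>
      norm (hz \<delta> y z - psum (airy_G \<delta> y) (Ln z)) + norm (psum (airy_G \<delta> y) (Ln z) - of_real (Airy y))"
    using norm_triangle_ineq[of "hz \<delta> y z - psum (airy_G \<delta> y) (Ln z)" "psum (airy_G \<delta> y) (Ln z) - of_real (Airy y)"] by simp
  also have "\<dots> \<le> approx_const x0 * exp (- 1 / (2 * \<delta>\<^sup>2)) * exp (- (y - x0))"
    using add_mono[OF 1 airy_psum_approx[OF \<delta> y z]] by (simp add: approx_const_def algebra_simps)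
  finally show ?thesis .
qed

text \<open>One constant that majorises both \<open>hz\<close> and \<open>Airy\<close>, so that the
  two Hankel kernels share their domination bound.\<close>

definition airy_const :: "real \<Rightarrow> real"
  where "airy_const x0 = approx_const x0 + 4 * exp pi * tasep_const (1/2) (3/2) x0"

lemma hz_bound_main:
  assumes \<delta>: "0 < \<delta>" "\<delta> \<le> 1" and y: "x0 \<le> y" and z: "norm z = exp (- 1 / \<delta>\<^sup>2)"
  shows "norm (hz \<delta> y z) \<le> airy_const x0 * exp (- (y - x0))"
proof -
  have z0: "z \<noteq> 0" using z by auto
  have d2: "0 < \<delta>\<^sup>2" using \<delta> by simp
  have "norm (hz \<delta> y z) \<le> 4 * exp pi * tasep_const (1/2) (3/2) x0 * exp (- sqrt (2 * (1/2)) * (y - x0))"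
    by (rule hz_bound) (use \<delta> y z z0 d2 in \<open>auto simp: field_simps\<close>)
  also have "\<dots> \<le> airy_const x0 * exp (- (y - x0))"
    using approx_const_pos[of x0] by (simp add: airy_const_def distrib_right)
  finally show ?thesis .
qed

lemma airy_const_pos: "airy_const x0 > 0"
  by (simp add: airy_const_def approx_const_pos tasep_const_nonneg add_pos_nonneg)

text \<open>The decay is read off from the symbol at \<delta> = 1 and its distance to the Airy
  function; no asymptotics of the defining integral enter.\<close>

lemma Airy_bound:
  assumes y: "x0 \<le> y"
  shows "\<bar>Airy y\<bar> \<le> airy_const x0 * exp (- (y - x0))"
proof -
  define z :: complex where "z = of_real (exp (- 1))"
  have z: "norm z = exp (- 1 / 1\<^sup>2)" by (simp add: z_def)
  have z0: "z \<noteq> 0" by (simp add: z_def)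
  have "norm (complex_of_real (Airy y)) \<le> norm (hz 1 y z) + norm (hz 1 y z - of_real (Airy y))"
    using norm_triangle_ineq4[of "hz 1 y z" "hz 1 y z - of_real (Airy y)"] by simp
  also have "norm (hz 1 y z) \<le> 4 * exp pi * tasep_const (1/2) (3/2) x0 * exp (- sqrt (2 * (1/2)) * (y - x0))"
    by (rule hz_bound) (use y z z0 in auto)
  also have "norm (hz 1 y z - of_real (Airy y)) \<le> approx_const x0 * exp (- 1 / (2 * 1\<^sup>2)) * exp (- (y - x0))"
    by (rule hz_approx) (use y z in auto)
  also have "\<dots> \<le> approx_const x0 * 1 * exp (- (y - x0))"
    using approx_const_pos[of x0] by (intro mult_right_mono mult_left_mono) auto
  finally show ?thesis by (simp add: airy_const_def distrib_right add.commute)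
qed

lemma measurable_hz: "(\<lambda>y. hz \<delta> y z) \<in> borel_measurable borel"
proof -
  have sf: "sigma_finite_measure (all_ints)"
    by (rule sigma_finite_measure_count_space_countable) simp
  let ?f = "\<lambda>y (k::int). tasep_G \<delta> y (shift (Ln z) k)"
  have f: "(\<lambda>y. ?f y k) \<in> borel_measurable borel" for k
    unfolding tasep_G_def airy_G_def airy_exponent_def
    by measurable
  have "(\<lambda>p. case p of (k, y) \<Rightarrow> ?f y k) \<in> borel_measurable (count_space UNIV \<Otimes>\<^sub>M borel)"
    by (rule measurable_pair_measure_countable1) (use f in auto)
  from measurable_compose[OF measurable_pair_swap' this]
  have "(\<lambda>(y, k). ?f y k) \<in> borel_measurable (borel \<Otimes>\<^sub>M count_space UNIV)" by (simp add: split_beta')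
  from sigma_finite_measure.borel_measurable_lebesgue_integral[OF sf this]
  show ?thesis by (simp add: hz_def psum_def)
qed

text \<open>For fixed y the symbols with \<delta> = 1 / (n + 1) converge to \<open>Airy y\<close>,
  and each is measurable in y as a sum of explicit functions.\<close>

lemma measurable_Airy: "Airy \<in> borel_measurable borel"
proof -
  define z where "z n = complex_of_real (exp (- 1 / (1 / real (Suc n))\<^sup>2))" for n
  have lim: "(\<lambda>n. hz (1 / real (Suc n)) y (z n)) \<longlonglongrightarrow> of_real (Airy y)" for y
  proof (rule LIM_zero_cancel, rule Lim_null_comparison)
    show "\<forall>\<^sub>F n in sequentially. norm (hz (1 / real (Suc n)) y (z n) - of_real (Airy y)) \<le> approx_const y * exp (- (1/2) * real n)"
    proof (intro always_eventually allI)
      fix n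
      have "norm (hz (1 / real (Suc n)) y (z n) - of_real (Airy y))
          \<le> approx_const y * exp (- 1 / (2 * (1 / real (Suc n))\<^sup>2)) * exp (- (y - y))"
        by (rule hz_approx) (auto simp: z_def)
      also have "- 1 / (2 * (1 / real (Suc n))\<^sup>2) = - (1/2) * (real (Suc n))\<^sup>2" by (simp add: power_divide)
      also have "approx_const y * exp (- (1/2) * (real (Suc n))\<^sup>2) * exp (- (y - y)) \<le> approx_const y * exp (- (1/2) * real n)"
      proof -
        have "real n \<le> (real (Suc n))\<^sup>2" by (simp add: power2_eq_square algebra_simps)
        then show ?thesis using approx_const_pos[of y] by simp
      qed
      finally show "norm (hz (1 / real (Suc n)) y (z n) - of_real (Airy y)) \<le> approx_const y * exp (- (1/2) * real n)" .
    qed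
    have "(\<lambda>n. exp (- (1/2) * real n)) \<longlonglongrightarrow> 0"
      by (intro filterlim_compose[OF exp_at_bot] filterlim_tendsto_neg_mult_at_bot[OF tendsto_const _ filterlim_real_sequentially]) simp
    then show "(\<lambda>n. approx_const y * exp (- (1/2) * real n)) \<longlonglongrightarrow> 0" by (rule tendsto_mult_right_zero)
  qed
  have "(\<lambda>y. complex_of_real (Airy y)) \<in> borel_measurable borel"
    by (rule borel_measurable_LIMSEQ_metric[OF measurable_hz lim])
  then have "(\<lambda>y. Re (complex_of_real (Airy y))) \<in> borel_measurable borel" by measurable
  then show ?thesis by simp
qed

section \<open>From S-minus to the half-line\<close>

lemma fredholm_term_cong:
  assumes "\<And>x y. x \<in> space M \<Longrightarrow> y \<in> space M \<Longrightarrow> K x y = L x y"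
  shows "fredholm_term n M K = fredholm_term n M L"
  unfolding fredholm_term_def
proof (intro Bochner_Integration.integral_cong refl)
  fix x assume x: "x \<in> space (PiM {..<n} (\<lambda>_. M))"
  have "mat n n (\<lambda>(i, j). K (x i) (x j)) = mat n n (\<lambda>(i, j). L (x i) (x j))"
    using x by (intro cong_mat) (auto simp: space_PiM intro!: assms)
  then show "point_det n K x = point_det n L x"
    by simp
qed

lemma fubini_dominated:
  fixes f :: "'a \<Rightarrow> 'b \<Rightarrow> 'c :: {real_normed_field, banach, second_countable_topology}"
  assumes X: "sigma_finite_measure X" and Y: "sigma_finite_measure Y"
    and f: "(\<lambda>(x, y). f x y) \<in> borel_measurable (X \<Otimes>\<^sub>M Y)"
    and g: "integrable X g" and h: "integrable Y h"
    and le: "\<And>x y. x \<in> space X \<Longrightarrow> y \<in> space Y \<Longrightarrow> norm (f x y) \<le> g x * h y"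
  shows "(LINT y|Y. LINT x|X. f x y) = (LINT x|X. LINT y|Y. f x y)"
proof -
  interpret X: sigma_finite_measure X by fact
  interpret Y: sigma_finite_measure Y by fact
  interpret pair_sigma_finite X Y ..
  have "integrable (X \<Otimes>\<^sub>M Y) (\<lambda>(x, y). f x y)"
    by (rule Bochner_Integration.integrable_bound[OF integrable_prod_mult[OF X Y g h] f])
       (use le in \<open>auto simp: space_pair_measure intro!: AE_I2 order_trans[OF _ abs_ge_self] simp del: abs_mult\<close>)
  then show ?thesis by (rule Fubini_integral)
qed

text \<open>In operator notation a = V V^T and h = V^T V. With W = V^T V V^T one has a a = V W and h
  h = W V, so \<open>fredholm_term_commute\<close> applies. The second part is the absolute
  convergence that allows the product on X to be read as an unordered sum.\<close>

lemma fredholm_term_square: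
  fixes V :: "'a \<Rightarrow> 'b \<Rightarrow> 'c :: {real_normed_field, banach, second_countable_topology}"
  assumes X: "sigma_finite_measure X" and Y: "sigma_finite_measure Y"
    and V [measurable]: "(\<lambda>(x, y). V x y) \<in> borel_measurable (X \<Otimes>\<^sub>M Y)"
    and p: "integrable X (\<lambda>x. (p x)\<^sup>2)" and q: "integrable Y (\<lambda>y. (q y)\<^sup>2)"
    and p0: "\<And>x. x \<in> space X \<Longrightarrow> p x \<ge> 0" and q0: "\<And>y. y \<in> space Y \<Longrightarrow> q y \<ge> 0"
    and Vb: "\<And>x y. x \<in> space X \<Longrightarrow> y \<in> space Y \<Longrightarrow> norm (V x y) \<le> p x * q y"
  defines "a \<equiv> \<lambda>x x'. LINT y|Y. V x y * V x' y" and "h \<equiv> \<lambda>y y'. LINT x|X. V x y * V x y'"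
  shows "fredholm_term n X (\<lambda>x x'. LINT u|X. a x u * a u x') = fredholm_term n Y (\<lambda>y y'. LINT u|Y. h y u * h u y')"
    and "\<And>x x'. x \<in> space X \<Longrightarrow> x' \<in> space X \<Longrightarrow> integrable X (\<lambda>u. a x u * a u x')"
proof -
  interpret X: sigma_finite_measure X by fact
  interpret Y: sigma_finite_measure Y by fact
  define c where "c = (LINT x|X. (p x)\<^sup>2)"
  define d where "d = (LINT y|Y. (q y)\<^sup>2)"
  have cd: "c \<ge> 0" "d \<ge> 0" by (simp_all add: c_def d_def)
  note Vc [measurable (raw)] = measurable_kernel_compose[OF V]
  have h_meas: "(\<lambda>(y, u). h y u) \<in> borel_measurable (Y \<Otimes>\<^sub>M Y)"
    unfolding h_def by measurable
  have a_meas: "(\<lambda>(x, x'). a x x') \<in> borel_measurable (X \<Otimes>\<^sub>M X)"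
    unfolding a_def by measurable
  note hc = measurable_kernel_compose[OF h_meas] and ac = measurable_kernel_compose[OF a_meas]
  have h_bd: "norm (h y y') \<le> c * (q y * q y')" if "y \<in> space Y" "y' \<in> space Y" for y y'
  proof -
    have "norm (h y y') \<le> (LINT x|X. (q y * q y') * (p x)\<^sup>2)"
      unfolding h_def
    proof (rule norm_integral_le)
      fix x assume x: "x \<in> space X"
      have "norm (V x y * V x y') \<le> (p x * q y) * (p x * q y')"
        unfolding norm_mult using x that p0 q0 by (intro mult_mono Vb) auto
      then show "norm (V x y * V x y') \<le> (q y * q y') * (p x)\<^sup>2" by (simp add: power2_eq_square mult_ac)
    qed (use p in simp)
    then show ?thesis by (simp add: c_def mult.commute)
  qed
  have a_bd: "norm (a x x') \<le> d * (p x * p x')" if "x \<in> space X" "x' \<in> space X" for x x'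
  proof -
    have "norm (a x x') \<le> (LINT y|Y. (p x * p x') * (q y)\<^sup>2)"
      unfolding a_def
    proof (rule norm_integral_le)
      fix y assume y: "y \<in> space Y"
      have "norm (V x y * V x' y) \<le> (p x * q y) * (p x' * q y)"
        unfolding norm_mult using y that p0 q0 by (intro mult_mono Vb) auto
      then show "norm (V x y * V x' y) \<le> (p x * p x') * (q y)\<^sup>2" by (simp add: power2_eq_square mult_ac)
    qed (use q in simp)
    then show ?thesis by (simp add: d_def mult.commute)
  qed
  show "integrable X (\<lambda>u. a x u * a u x')" if x: "x \<in> space X" "x' \<in> space X" for x x'
  proof (rule Bochner_Integration.integrable_bound)
    show "integrable X (\<lambda>u. (d * d * p x * p x') * (p u)\<^sup>2)" using p by simp
    show "(\<lambda>u. a x u * a u x') \<in> borel_measurable X"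
      using x by (intro borel_measurable_times ac measurable_ident_sets measurable_const) auto
    show "AE u in X. norm (a x u * a u x') \<le> norm ((d * d * p x * p x') * (p u)\<^sup>2)"
    proof (rule AE_I2)
      fix u assume u: "u \<in> space X"
      have "norm (a x u * a u x') \<le> (d * (p x * p u)) * (d * (p u * p x'))"
        unfolding norm_mult using x u p0 cd by (intro mult_mono a_bd) auto
      also have "\<dots> = (d * d * p x * p x') * (p u)\<^sup>2" by (simp add: power2_eq_square mult_ac)
      finally show "norm (a x u * a u x') \<le> norm ((d * d * p x * p x') * (p u)\<^sup>2)" by simp
    qed
  qed
  define W where "W y x = (LINT u|Y. h y u * V x u)" for y x
  have W_meas: "(\<lambda>(y, x). W y x) \<in> borel_measurable (Y \<Otimes>\<^sub>M X)"
  proof -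
    have "(\<lambda>z. h (fst (fst z)) (snd z) * V (snd (fst z)) (snd z)) \<in> borel_measurable ((Y \<Otimes>\<^sub>M X) \<Otimes>\<^sub>M Y)"
      by (intro borel_measurable_times hc Vc) measurable
    then show ?thesis unfolding W_def split_beta' by (intro Y.borel_measurable_lebesgue_integral) (simp add: split_beta')
  qed
  have W_bd: "norm (W y x) \<le> (c * d) * (p x * q y)" if "x \<in> space X" "y \<in> space Y" for x y
  proof -
    have "norm (W y x) \<le> (LINT u|Y. (c * q y * p x) * (q u)\<^sup>2)"
      unfolding W_def
    proof (rule norm_integral_le)
      fix u assume u: "u \<in> space Y"
      have "norm (h y u * V x u) \<le> (c * (q y * q u)) * (p x * q u)"
        unfolding norm_mult using u that p0 q0 cd by (intro mult_mono Vb h_bd) auto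
      then show "norm (h y u * V x u) \<le> (c * q y * p x) * (q u)\<^sup>2" by (simp add: power2_eq_square mult_ac)
    qed (use q in simp)
    then show ?thesis by (simp add: d_def mult_ac)
  qed
  \<comment> \<open>Associativity by Fubini: (V^T V) V^T = V^T (V V^T).\<close>
  have W_alt: "W y x' = (LINT u|X. V u y * a u x')" if y: "y \<in> space Y" and x': "x' \<in> space X" for y x'
  proof -
    have "W y x' = (LINT u|Y. LINT \<eta>|X. V \<eta> y * V \<eta> u * V x' u)" by (simp add: W_def h_def)
    also have "\<dots> = (LINT \<eta>|X. LINT u|Y. V \<eta> y * V \<eta> u * V x' u)"
    proof (rule fubini_dominated[OF X Y _ p])
      have "(\<lambda>z. V (fst z) y * V (fst z) (snd z) * V x' (snd z)) \<in> borel_measurable (X \<Otimes>\<^sub>M Y)"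
        using y x' by (intro borel_measurable_times Vc) measurable
      then show "(\<lambda>(\<eta>, u). V \<eta> y * V \<eta> u * V x' u) \<in> borel_measurable (X \<Otimes>\<^sub>M Y)" by (simp add: split_beta')
      show "integrable Y (\<lambda>u. (q y * p x') * (q u)\<^sup>2)" using q by simp
      fix \<eta> u assume eu: "\<eta> \<in> space X" "u \<in> space Y"
      have "norm (V \<eta> y * V \<eta> u * V x' u) \<le> ((p \<eta> * q y) * (p \<eta> * q u)) * (p x' * q u)"
        unfolding norm_mult using eu y x' p0 q0 by (intro mult_mono Vb) auto
      then show "norm (V \<eta> y * V \<eta> u * V x' u) \<le> (p \<eta>)\<^sup>2 * ((q y * p x') * (q u)\<^sup>2)"
        by (simp add: power2_eq_square mult_ac)
    qed
    also have "\<dots> = (LINT \<eta>|X. V \<eta> y * a \<eta> x')" by (simp add: a_def mult.assoc)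
    finally show ?thesis .
  qed
  have eqX: "(LINT u|X. a x u * a u x') = (LINT y|Y. V x y * W y x')" if x: "x \<in> space X" and x': "x' \<in> space X" for x x'
  proof -
    have "(LINT y|Y. V x y * W y x') = (LINT y|Y. LINT \<eta>|X. V x y * V \<eta> y * a \<eta> x')"
      using x' by (intro Bochner_Integration.integral_cong refl) (simp add: W_alt mult.assoc)
    also have "\<dots> = (LINT \<eta>|X. LINT y|Y. V x y * V \<eta> y * a \<eta> x')"
    proof (rule fubini_dominated[OF X Y _ p])
      have "(\<lambda>z. V x (snd z) * V (fst z) (snd z) * a (fst z) x') \<in> borel_measurable (X \<Otimes>\<^sub>M Y)"
        using x x' by (intro borel_measurable_times Vc ac) measurable
      then show "(\<lambda>(\<eta>, y). V x y * V \<eta> y * a \<eta> x') \<in> borel_measurable (X \<Otimes>\<^sub>M Y)" by (simp add: split_beta')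
      show "integrable Y (\<lambda>y. (d * p x * p x') * (q y)\<^sup>2)" using q by simp
      fix \<eta> y assume ey: "\<eta> \<in> space X" "y \<in> space Y"
      have "norm (V x y * V \<eta> y * a \<eta> x') \<le> ((p x * q y) * (p \<eta> * q y)) * (d * (p \<eta> * p x'))"
        unfolding norm_mult using ey x x' p0 q0 cd by (intro mult_mono Vb a_bd) auto
      then show "norm (V x y * V \<eta> y * a \<eta> x') \<le> (p \<eta>)\<^sup>2 * ((d * p x * p x') * (q y)\<^sup>2)"
        by (simp add: power2_eq_square mult_ac)
    qed
    also have "\<dots> = (LINT \<eta>|X. a x \<eta> * a \<eta> x')" by (simp add: a_def)
    finally show ?thesis by simp
  qed
  have eqY: "(LINT x|X. W y x * V x y') = (LINT u|Y. h y u * h u y')" if y: "y \<in> space Y" and y': "y' \<in> space Y" for y y'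
  proof -
    have "(LINT x|X. W y x * V x y') = (LINT x|X. LINT u|Y. h y u * (V x u * V x y'))"
      by (simp add: W_def mult.assoc[symmetric])
    also have "\<dots> = (LINT u|Y. LINT x|X. h y u * (V x u * V x y'))"
    proof (rule fubini_dominated[OF X Y _ p, symmetric])
      have "(\<lambda>z. h y (snd z) * (V (fst z) (snd z) * V (fst z) y')) \<in> borel_measurable (X \<Otimes>\<^sub>M Y)"
        using y y' by (intro borel_measurable_times Vc hc) measurable
      then show "(\<lambda>(x, u). h y u * (V x u * V x y')) \<in> borel_measurable (X \<Otimes>\<^sub>M Y)" by (simp add: split_beta')
      show "integrable Y (\<lambda>u. (c * q y * q y') * (q u)\<^sup>2)" using q by simp
      fix x u assume xu: "x \<in> space X" "u \<in> space Y"
      have "norm (h y u * (V x u * V x y')) \<le> (c * (q y * q u)) * ((p x * q u) * (p x * q y'))"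
        unfolding norm_mult using xu y y' p0 q0 cd by (intro mult_mono Vb h_bd) auto
      then show "norm (h y u * (V x u * V x y')) \<le> (p x)\<^sup>2 * ((c * q y * q y') * (q u)\<^sup>2)"
        by (simp add: power2_eq_square mult_ac)
    qed
    also have "\<dots> = (LINT u|Y. h y u * h u y')" by (simp add: h_def)
    finally show ?thesis .
  qed
  have "fredholm_term n X (\<lambda>x x'. LINT u|X. a x u * a u x') = fredholm_term n X (\<lambda>x x'. LINT y|Y. V x y * W y x')"
    by (rule fredholm_term_cong) (rule eqX)
  also have "\<dots> = fredholm_term n Y (\<lambda>y y'. LINT x|X. W y x * V x y')"
    by (rule fredholm_term_commute[OF X Y V W_meas p q p0 q0, where c = 1 and d = "c * d"])
       (use Vb W_bd cd in auto)
  also have "\<dots> = fredholm_term n Y (\<lambda>y y'. LINT u|Y. h y u * h u y')"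
    by (rule fredholm_term_cong) (rule eqY)
  finally show "fredholm_term n X (\<lambda>x x'. LINT u|X. a x u * a u x') = fredholm_term n Y (\<lambda>y y'. LINT u|Y. h y u * h u y')" .
qed

definition hz_kernel :: "real \<Rightarrow> real \<Rightarrow> complex \<Rightarrow> real \<Rightarrow> real \<Rightarrow> complex"
  where "hz_kernel \<delta> x z s t = (LINT u|halfline. hz \<delta> (s + x + u) z * hz \<delta> (u + x + t) z)"

text \<open>The factor V of the kernel: products of two modes at one root sum over the roots to
  \<open>hz\<close>, and products at two roots integrate over s to the Cauchy factor 1 / (\<xi> +
  \<eta>). The sqrt \<delta> balances the scaling \<delta> s in the exponent.\<close>

definition mode :: "real \<Rightarrow> real \<Rightarrow> complex \<Rightarrow> real \<Rightarrow> complex"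
  where "mode \<delta> x \<xi> s = of_real (sqrt \<delta>) * exp (1/2 * Phi (\<delta> ^ 3) (\<delta> * x) \<xi> + of_real (\<delta> * s) * \<xi>) / csqrt (- \<xi>)"

lemma sigma_finite_halfline: "sigma_finite_measure halfline"
  by (rule sigma_finite_measure_restrict_space[OF sigma_finite_lborel]) simp

lemma space_halfline: "space halfline = {0<..}"
  by (simp add: space_restrict_space)

lemma mode_mult:
  assumes v: "Re v < 0" and \<delta>: "0 < \<delta>"
  shows "mode \<delta> x (xi v) s * mode \<delta> x (xi v) t = tasep_G \<delta> (s + x + t) v"
proof -
  let ?\<xi> = "xi v"
  have c: "csqrt (- ?\<xi>) * csqrt (- ?\<xi>) = - ?\<xi>"
    using power2_csqrt[of "- ?\<xi>"] by (simp only: power2_eq_square)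
  have d: "complex_of_real (sqrt \<delta>) * of_real (sqrt \<delta>) = of_real \<delta>"
    using \<delta> by (simp flip: of_real_mult)
  have e: "(1/2 * Phi (\<delta> ^ 3) (\<delta> * x) ?\<xi> + of_real (\<delta> * s) * ?\<xi>) + (1/2 * Phi (\<delta> ^ 3) (\<delta> * x) ?\<xi> + of_real (\<delta> * t) * ?\<xi>)
      = airy_exponent (s + x + t) (of_real \<delta> * ?\<xi>) + (- Q ?\<xi>)"
    by (simp add: Phi_def airy_exponent_def algebra_simps power_mult_distrib)
  have "mode \<delta> x ?\<xi> s * mode \<delta> x ?\<xi> t = (complex_of_real (sqrt \<delta>) * of_real (sqrt \<delta>)) *
      (exp (1/2 * Phi (\<delta> ^ 3) (\<delta> * x) ?\<xi> + of_real (\<delta> * s) * ?\<xi>) * exp (1/2 * Phi (\<delta> ^ 3) (\<delta> * x) ?\<xi> + of_real (\<delta> * t) * ?\<xi>))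
      / (csqrt (- ?\<xi>) * csqrt (- ?\<xi>))"
    by (simp add: mode_def)
  also have "\<dots> = of_real \<delta> * exp (airy_exponent (s + x + t) (of_real \<delta> * ?\<xi>) + (- Q ?\<xi>)) / (- ?\<xi>)"
    unfolding c d exp_add[symmetric] e ..
  finally show ?thesis by (simp add: tasep_G_def airy_G_def exp_diff exp_minus divide_inverse mult_ac)
qed

lemma mode_shift: "mode \<delta> x \<xi> s = mode \<delta> x \<xi> 0 * exp (of_real (\<delta> * s) * \<xi>)"
  by (simp add: mode_def exp_add)

text \<open>The two factors sqrt \<delta> cancel the 1 / \<delta> from the integral. The minus sign
  disappears later, since the kernel on the roots contains two such integrals.\<close>

lemma mode_integral:
  assumes \<xi>: "Re \<xi> < 0" "Re \<eta> < 0" and \<delta>: "0 < \<delta>"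
  shows "(LINT s|halfline. mode \<delta> x \<xi> s * mode \<delta> x \<eta> s) =
    - (exp (1/2 * Phi (\<delta> ^ 3) (\<delta> * x) \<xi> + 1/2 * Phi (\<delta> ^ 3) (\<delta> * x) \<eta>) / (csqrt (- \<xi>) * csqrt (- \<eta>) * (\<xi> + \<eta>)))"
proof -
  have c: "Re (of_real \<delta> * (\<xi> + \<eta>)) < 0" using \<xi> \<delta> by (simp add: mult_pos_neg)
  have eq: "mode \<delta> x \<xi> s * mode \<delta> x \<eta> s = mode \<delta> x \<xi> 0 * mode \<delta> x \<eta> 0 * exp (of_real \<delta> * (\<xi> + \<eta>) * of_real s)" for s
  proof -
    have "of_real (\<delta> * s) * \<xi> + of_real (\<delta> * s) * \<eta> = of_real \<delta> * (\<xi> + \<eta>) * of_real s"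
      by (simp add: algebra_simps)
    then show ?thesis
      unfolding mode_shift[of \<delta> x \<xi> s] mode_shift[of \<delta> x \<eta> s]
      by (metis (no_types, lifting) exp_add mult.assoc mult.left_commute)
  qed
  have "(LINT s|halfline. mode \<delta> x \<xi> s * mode \<delta> x \<eta> s) =
      (LINT s|halfline. mode \<delta> x \<xi> 0 * mode \<delta> x \<eta> 0 * exp (of_real \<delta> * (\<xi> + \<eta>) * of_real s))"
    by (intro Bochner_Integration.integral_cong refl eq)
  also have "\<dots> = mode \<delta> x \<xi> 0 * mode \<delta> x \<eta> 0 * (- 1 / (of_real \<delta> * (\<xi> + \<eta>)))"
    by (simp only: Bochner_Integration.integral_mult_right_zero halfline_exp_complex[OF c])
  also have "mode \<delta> x \<xi> 0 * mode \<delta> x \<eta> 0 = of_real \<delta> * exp (1/2 * Phi (\<delta> ^ 3) (\<delta> * x) \<xi> + 1/2 * Phi (\<delta> ^ 3) (\<delta> * x) \<eta>) / (csqrt (- \<xi>) * csqrt (- \<eta>))"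
  proof -
    have d: "complex_of_real (sqrt \<delta>) * of_real (sqrt \<delta>) = of_real \<delta>"
      using \<delta> by (simp flip: of_real_mult)
    show ?thesis unfolding d[symmetric] exp_add by (simp add: mode_def)
  qed
  finally show ?thesis using \<delta> by (simp add: mult_ac)
qed

(* The kernel on S_minus is V V^T V V^T for V = mode, since 1 / (\<xi> + \<eta>) is minus the integral of
   exp ((\<xi> + \<eta>) s) over the half-line; the half-line kernel is (V^T V)^2. *)
lemma fredholm_det_K_kernel:
  assumes \<delta>: "0 < \<delta>" "\<delta> \<le> 1" and z: "z \<in> ball 0 1 - {0}"
  shows "fredholm_det (count_space (S_minus z)) (K_kernel (\<delta> * x) (\<delta> ^ 3) 0 z) = fredholm_det halfline (hz_kernel \<delta> x z)"
proof -
  define w where "w = Ln z"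
  have ew: "exp w = z" and w0: "Re w < 0" using z by (auto simp: w_def)
  define S where "S = S_minus z"
  define v where "v k = shift w k" for k :: int
  have Rev: "Re (v k) = Re w" for k by (simp add: v_def)
  have bij: "bij_betw (\<lambda>k. xi (v k)) UNIV S"
    using S_minus_bij[OF w0] by (simp add: ew S_def v_def)
  have cS: "countable S" using countable_S_minus[OF w0] by (simp add: ew S_def)
  have SX: "\<exists>k. \<xi> = xi (v k)" if "\<xi> \<in> S" for \<xi>
    using bij that by (auto simp: bij_betw_def)
  have ReS: "Re \<xi> < 0" if "\<xi> \<in> S" for \<xi> using that by (simp add: S_def S_minus_def)
  define l where "l = - \<delta>\<^sup>2 * Re w"
  have l: "l > 0" using \<delta> w0 by (simp add: l_def mult_pos_neg)
  have lw: "l / \<delta>\<^sup>2 = - Re w" using \<delta> by (simp add: l_def)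
  define b where "b = sqrt (2 * l)"
  have b: "b > 0" using l by (simp add: b_def)
  \<comment> \<open>All roots keep at least the distance b / \<delta> from the imaginary axis, so
    the one weight exp (- b s) serves them all.\<close>
  have Reb: "\<delta> * Re \<xi> \<le> - b" if "\<xi> \<in> S" for \<xi>
  proof -
    obtain k where k: "\<xi> = xi (v k)" using SX \<open>\<xi> \<in> S\<close> by blast
    have vk: "Re (v k) < 0" using w0 by (simp add: Rev)
    show ?thesis
      using airy_exponent_bound(2)[of l l l "of_real \<delta> * xi (v k)" 0 0] xi_scaled(1,2)[OF vk \<delta>(1)] l
      by (simp add: k b_def l_def Rev)
  qed
  define p where "p \<xi> = norm (mode \<delta> x \<xi> 0)" for \<xi>
  define q where "q s = exp (- b * s)" for s :: real
  have Vb: "norm (mode \<delta> x \<xi> s) \<le> p \<xi> * q s" if "\<xi> \<in> S" "s > 0" for \<xi> s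
  proof -
    have "norm (mode \<delta> x \<xi> s) = p \<xi> * exp (\<delta> * Re \<xi> * s)"
      by (subst mode_shift) (simp add: p_def norm_mult mult_ac)
    also have "\<dots> \<le> p \<xi> * q s"
      using mult_right_mono[OF Reb[OF that(1)], of s] that(2) unfolding q_def p_def by (intro mult_left_mono) auto
    finally show ?thesis .
  qed
  have dec: "strip_decay (\<delta>\<^sup>2) (l / \<delta>\<^sup>2) (l / \<delta>\<^sup>2) (\<delta>\<^sup>2 * (tasep_const l l y * exp (- sqrt (2 * l) * (y - y)))) (tasep_G \<delta> y)" for y
    by (rule tasep_G_decay[OF l \<delta>]) simp
  have sumG: "integrable (all_ints) (\<lambda>k. tasep_G \<delta> y (v k))" for y
    using psum_summable[OF dec, of w] \<delta> lw by (simp add: v_def)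
  have modeG: "mode \<delta> x (xi (v k)) s * mode \<delta> x (xi (v k)) t = tasep_G \<delta> (s + x + t) (v k)" for k s t
    by (rule mode_mult) (use w0 \<delta> in \<open>simp_all add: Rev\<close>)
  \<comment> \<open>By \<open>mode_mult\<close> the squares of p are moduli of summands of the
    symbol, hence summable.\<close>
  have p2: "integrable (count_space S) (\<lambda>\<xi>. (p \<xi>)\<^sup>2)"
  proof -
    have "(p (xi (v k)))\<^sup>2 = norm (tasep_G \<delta> (0 + x + 0) (v k))" for k
      unfolding p_def power2_eq_square norm_mult[symmetric] modeG ..
    then have "integrable (all_ints) (\<lambda>k. (p (xi (v k)))\<^sup>2)"
      using integrable_norm[OF sumG[of "0 + x + 0"]] by simp
    then show ?thesis by (subst (asm) integrable_bij_count_space[OF bij])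
  qed
  have q2: "integrable halfline (\<lambda>s. (q s)\<^sup>2)"
    using halfline_exp(1)[of "2 * b"] b by (simp add: q_def power2_eq_square exp_add[symmetric] mult_ac)
  have Vm: "(\<lambda>(\<xi>, s). mode \<delta> x \<xi> s) \<in> borel_measurable (count_space S \<Otimes>\<^sub>M halfline)"
  proof (rule measurable_pair_measure_countable1[OF cS])
    fix \<xi>
    have "(\<lambda>s. mode \<delta> x \<xi> s) \<in> borel_measurable lborel" unfolding mode_def by measurable
    then show "(\<lambda>s. case (\<xi>, s) of (\<xi>, s) \<Rightarrow> mode \<delta> x \<xi> s) \<in> borel_measurable halfline"
      by (simp add: measurable_restrict_space1)
  qed
  note sq = fredholm_term_square[OF sigma_finite_measure_count_space_countable[OF cS] sigma_finite_halfline Vm p2 q2]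
  define a where "a \<xi> \<eta> = (LINT s|halfline. mode \<delta> x \<xi> s * mode \<delta> x \<eta> s)" for \<xi> \<eta>
  define h where "h s t = (LINT \<xi>|count_space S. mode \<delta> x \<xi> s * mode \<delta> x \<xi> t)" for s t
  have eq: "fredholm_term n (count_space S) (\<lambda>\<xi> \<xi>'. LINT \<eta>|count_space S. a \<xi> \<eta> * a \<eta> \<xi>') = fredholm_term n halfline (\<lambda>s t. LINT u|halfline. h s u * h u t)" for n
    unfolding a_def h_def by (rule sq(1)) (use Vb in \<open>auto simp: p_def q_def space_halfline\<close>)
  have int: "integrable (count_space S) (\<lambda>\<eta>. a \<xi> \<eta> * a \<eta> \<xi>')" if "\<xi> \<in> S" "\<xi>' \<in> S" for \<xi> \<xi>'
    unfolding a_def by (rule sq(2)) (use Vb that in \<open>auto simp: p_def q_def space_halfline\<close>)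
  \<comment> \<open>\<open>K_kernel\<close> is an unordered sum, the product of a with itself an
    integral over counting measure; absolute convergence identifies them.\<close>
  have K: "K_kernel (\<delta> * x) (\<delta> ^ 3) 0 z \<xi> \<xi>' = (LINT \<eta>|count_space S. a \<xi> \<eta> * a \<eta> \<xi>')" if "\<xi> \<in> S" "\<xi>' \<in> S" for \<xi> \<xi>'
  proof -
    have "(LINT \<eta>|count_space S. a \<xi> \<eta> * a \<eta> \<xi>') = (\<Sum>\<^sub>\<infinity>\<eta>\<in>S. a \<xi> \<eta> * a \<eta> \<xi>')"
      using infsetsum_infsum[OF int[OF that, folded abs_summable_on_def]] by (simp add: infsetsum_def)
    also have "\<dots> = K_kernel (\<delta> * x) (\<delta> ^ 3) 0 z \<xi> \<xi>'"
      unfolding K_kernel_def S_def[symmetric]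
    proof (rule infsum_cong)
      fix \<eta> assume \<eta>: "\<eta> \<in> S"
      let ?P = "Phi (\<delta> ^ 3) (\<delta> * x)"
      have c: "csqrt (- \<eta>) * csqrt (- \<eta>) = - \<eta>"
        using power2_csqrt[of "- \<eta>"] by (simp only: power2_eq_square)
      have "(1/2 * ?P \<xi> + 1/2 * ?P \<eta>) + (1/2 * ?P \<eta> + 1/2 * ?P \<xi>') = 1/2 * ?P \<xi> + ?P \<eta> + 1/2 * ?P \<xi>'" by simp
      then have "exp (1/2 * ?P \<xi> + 1/2 * ?P \<eta>) * exp (1/2 * ?P \<eta> + 1/2 * ?P \<xi>') = exp (1/2 * ?P \<xi> + ?P \<eta> + 1/2 * ?P \<xi>')"
        unfolding exp_add[symmetric] by (rule arg_cong)
      then have "a \<xi> \<eta> * a \<eta> \<xi>' = exp (1/2 * ?P \<xi> + ?P \<eta> + 1/2 * ?P \<xi>') /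
          (csqrt (- \<xi>) * (csqrt (- \<eta>) * csqrt (- \<eta>)) * (\<xi> + \<eta>) * (\<eta> + \<xi>') * csqrt (- \<xi>'))"
        unfolding a_def mode_integral[OF ReS[OF that(1)] ReS[OF \<eta>] \<delta>(1)] mode_integral[OF ReS[OF \<eta>] ReS[OF that(2)] \<delta>(1)]
        by (simp add: mult_ac)
      then show "a \<xi> \<eta> * a \<eta> \<xi>' = exp (1/2 * ?P \<xi> + ?P \<eta> + 1/2 * ?P \<xi>' + of_real 0 / 4 * (\<xi>\<^sup>2 - 2 * \<eta>\<^sup>2 + \<xi>'\<^sup>2)) /
          (csqrt (- \<xi>) * (- \<eta>) * (\<xi> + \<eta>) * (\<eta> + \<xi>') * csqrt (- \<xi>'))"
        unfolding c by simp
    qed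
    finally show ?thesis by simp
  qed
  have h: "h s t = hz \<delta> (s + x + t) z" for s t
  proof -
    have "h s t = (LINT k|all_ints. mode \<delta> x (xi (v k)) s * mode \<delta> x (xi (v k)) t)"
      unfolding h_def by (rule integral_bij_count_space[OF bij, symmetric])
    also have "\<dots> = (LINT k|all_ints. tasep_G \<delta> (s + x + t) (v k))" by (simp only: modeG)
    finally show ?thesis by (simp only: hz_def psum_def v_def w_def)
  qed
  have "fredholm_term n (count_space S) (K_kernel (\<delta> * x) (\<delta> ^ 3) 0 z) = fredholm_term n halfline (hz_kernel \<delta> x z)" for n
  proof -
    have "fredholm_term n (count_space S) (K_kernel (\<delta> * x) (\<delta> ^ 3) 0 z) =
      fredholm_term n (count_space S) (\<lambda>\<xi> \<xi>'. LINT \<eta>|count_space S. a \<xi> \<eta> * a \<eta> \<xi>')"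
      by (rule fredholm_term_cong) (simp add: K)
    then show ?thesis unfolding eq h hz_kernel_def[abs_def] .
  qed
  then show ?thesis by (simp add: fredholm_det_terms S_def)
qed

section \<open>Comparison of the two determinants\<close>

lemma halfline_exp_mult: "c > 0 \<Longrightarrow> integrable halfline (\<lambda>u. a * (exp (- c * u) * exp (- c * u)))"
  "c > 0 \<Longrightarrow> (LINT u|halfline. a * (exp (- c * u) * exp (- c * u))) = a / (2 * c)" for a c :: real
  using halfline_exp[of "2 * c"] by (simp_all add: exp_add[symmetric] mult_ac)

lemma exp_weight: "c > 0 \<Longrightarrow> fredholm_weight halfline (\<lambda>s. exp (- c * s))"
  unfolding fredholm_weight_def fredholm_weight_axioms_def
  using sigma_finite_halfline halfline_exp_mult(1)[of c 1] by (simp add: power2_eq_square)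

definition hankel_square :: "real \<Rightarrow> (real \<Rightarrow> complex) \<Rightarrow> real \<Rightarrow> real \<Rightarrow> complex"
  where "hankel_square x g s t = (LINT u|halfline. g (s + x + u) * g (u + x + t))"

lemma hz_kernel_hankel: "hz_kernel \<delta> x z = hankel_square x (\<lambda>y. hz \<delta> y z)"
  by (intro ext) (simp add: hz_kernel_def hankel_square_def)

lemma hankel_exp_bound:
  fixes g g' :: "real \<Rightarrow> complex"
  assumes g: "\<And>y. y \<ge> x \<Longrightarrow> norm (g y) \<le> C * exp (- c * (y - x))"
    and g': "\<And>y. y \<ge> x \<Longrightarrow> norm (g' y) \<le> C' * exp (- c * (y - x))"
    and C: "C \<ge> 0" and s: "s > 0" "t > 0" "u > 0"
  shows "norm (g (s + x + u) * g' (u + x + t)) \<le> C * C' * (exp (- c * s) * exp (- c * t)) * (exp (- c * u) * exp (- c * u))"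
proof -
  have "norm (g (s + x + u) * g' (u + x + t)) \<le> (C * exp (- c * ((s + x + u) - x))) * (C' * exp (- c * ((u + x + t) - x)))"
    unfolding norm_mult using C s by (intro mult_mono g g') auto
  also have "\<dots> = C * C' * (exp (- c * s) * exp (- c * t)) * (exp (- c * u) * exp (- c * u))"
    by (simp add: exp_add[symmetric] algebra_simps)
  finally show ?thesis .
qed

lemma measurable_hankel:
  fixes g :: "real \<Rightarrow> complex"
  assumes g [measurable]: "g \<in> borel_measurable borel"
  shows "(\<lambda>u. g (s + x + u) * g (u + x + t)) \<in> borel_measurable halfline"
    and "(\<lambda>(s, t). hankel_square x g s t) \<in> borel_measurable (halfline \<Otimes>\<^sub>M halfline)"
proof -
  interpret sigma_finite_measure halfline by (rule sigma_finite_halfline)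
  have idm [measurable]: "(\<lambda>u. u) \<in> halfline \<rightarrow>\<^sub>M borel"
    by (simp add: measurable_restrict_space1)
  show "(\<lambda>u. g (s + x + u) * g (u + x + t)) \<in> borel_measurable halfline"
    using measurable_compose[OF idm, of "\<lambda>u. g (s + x + u) * g (u + x + t)" borel] by simp
  have f: "(\<lambda>p. fst (fst p)) \<in> (halfline \<Otimes>\<^sub>M halfline) \<Otimes>\<^sub>M halfline \<rightarrow>\<^sub>M borel"
    "(\<lambda>p. snd (fst p)) \<in> (halfline \<Otimes>\<^sub>M halfline) \<Otimes>\<^sub>M halfline \<rightarrow>\<^sub>M borel"
    "(\<lambda>p. snd p) \<in> (halfline \<Otimes>\<^sub>M halfline) \<Otimes>\<^sub>M halfline \<rightarrow>\<^sub>M borel"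
    by (rule measurable_compose[OF _ idm], measurable)+
  have "(\<lambda>p. g (fst (fst p) + x + snd p) * g (snd p + x + snd (fst p))) \<in> borel_measurable ((halfline \<Otimes>\<^sub>M halfline) \<Otimes>\<^sub>M halfline)"
    by (intro borel_measurable_times measurable_compose[OF _ g] borel_measurable_add borel_measurable_const f)
  then show "(\<lambda>(s, t). hankel_square x g s t) \<in> borel_measurable (halfline \<Otimes>\<^sub>M halfline)"
    unfolding hankel_square_def split_beta' by (intro borel_measurable_lebesgue_integral) (simp add: split_beta')
qed

lemma hankel_dominated:
  fixes g :: "real \<Rightarrow> complex"
  assumes m: "g \<in> borel_measurable borel" and c: "c > 0" and C: "C \<ge> 0"
    and g: "\<And>y. y \<ge> x \<Longrightarrow> norm (g y) \<le> C * exp (- c * (y - x))" and le: "C * C / (2 * c) \<le> M"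
  shows "fredholm_weight.dominated halfline (\<lambda>s. exp (- c * s)) M (hankel_square x g)"
  unfolding fredholm_weight.dominated_def[OF exp_weight[OF c]]
proof (intro conjI ballI measurable_hankel(2)[OF m])
  fix s t assume "s \<in> space halfline" "t \<in> space halfline"
  then have st: "s > 0" "t > 0" by (auto simp: space_halfline)
  have "norm (hankel_square x g s t) \<le> (LINT u|halfline. C * C * (exp (- c * s) * exp (- c * t)) * (exp (- c * u) * exp (- c * u)))"
    unfolding hankel_square_def
    by (intro norm_integral_le halfline_exp_mult(1) c hankel_exp_bound g C st) (auto simp: space_halfline)
  also have "\<dots> = C * C / (2 * c) * (exp (- c * s) * exp (- c * t))" unfolding halfline_exp_mult(2)[OF c] by simp
  also have "\<dots> \<le> M * (exp (- c * s) * exp (- c * t))" by (intro mult_right_mono le) simp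
  finally show "norm (hankel_square x g s t) \<le> M * (exp (- c * s) * exp (- c * t))" .
qed

lemma hankel_integrable:
  fixes g :: "real \<Rightarrow> complex"
  assumes m: "g \<in> borel_measurable borel" and c: "c > 0" and C: "C \<ge> 0"
    and g: "\<And>y. y \<ge> x \<Longrightarrow> norm (g y) \<le> C * exp (- c * (y - x))" and st: "s > 0" "t > 0"
  shows "integrable halfline (\<lambda>u. g (s + x + u) * g (u + x + t))"
proof (rule Bochner_Integration.integrable_bound[OF halfline_exp_mult(1)[OF c] measurable_hankel(1)[OF m]])
  show "AE u in halfline. norm (g (s + x + u) * g (u + x + t)) \<le>
      norm (C * C * (exp (- c * s) * exp (- c * t)) * (exp (- c * u) * exp (- c * u)))"
  proof (rule AE_I2)
    fix u assume "u \<in> space halfline"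
    then have "norm (g (s + x + u) * g (u + x + t)) \<le> C * C * (exp (- c * s) * exp (- c * t)) * (exp (- c * u) * exp (- c * u))"
      by (intro hankel_exp_bound g C st) (auto simp: space_halfline)
    then show "norm (g (s + x + u) * g (u + x + t)) \<le>
      norm (C * C * (exp (- c * s) * exp (- c * t)) * (exp (- c * u) * exp (- c * u)))"
      unfolding real_norm_def by (rule order_trans[OF _ abs_ge_self])
  qed
qed

text \<open>Changing one symbol at a time gives two terms of size C \<eta>; the factor 2 cancels
  against the integral 1 / (2 c) of exp (- 2 c u).\<close>

lemma hankel_diff:
  fixes g g' :: "real \<Rightarrow> complex"
  assumes m: "g \<in> borel_measurable borel" "g' \<in> borel_measurable borel" and c: "c > 0" and C: "C \<ge> 0" and \<eta>: "\<eta> \<ge> 0"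
    and g: "\<And>y. y \<ge> x \<Longrightarrow> norm (g y) \<le> C * exp (- c * (y - x))"
    and g': "\<And>y. y \<ge> x \<Longrightarrow> norm (g' y) \<le> C * exp (- c * (y - x))"
    and d: "\<And>y. y \<ge> x \<Longrightarrow> norm (g y - g' y) \<le> \<eta> * exp (- c * (y - x))"
    and st: "s > 0" "t > 0"
  shows "norm (hankel_square x g s t - hankel_square x g' s t) \<le> C * \<eta> / c * (exp (- c * s) * exp (- c * t))"
proof -
  have eq: "hankel_square x g s t - hankel_square x g' s t =
      (LINT u|halfline. g (s + x + u) * g (u + x + t) - g' (s + x + u) * g' (u + x + t))"
    unfolding hankel_square_def
    by (intro Bochner_Integration.integral_diff[symmetric] hankel_integrable[OF m(1) c C g st] hankel_integrable[OF m(2) c C g' st])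
  have "norm (hankel_square x g s t - hankel_square x g' s t) \<le> (LINT u|halfline. (2 * C * \<eta> * (exp (- c * s) * exp (- c * t))) * (exp (- c * u) * exp (- c * u)))"
    unfolding eq
  proof (intro norm_integral_le halfline_exp_mult(1) c)
    fix u assume "u \<in> space halfline"
    then have u: "u > 0" by (simp add: space_halfline)
    define e where "e = (exp (- c * s) * exp (- c * t)) * (exp (- c * u) * exp (- c * u))"
    have b1: "norm ((g (s + x + u) - g' (s + x + u)) * g (u + x + t)) \<le> \<eta> * C * e"
      using hankel_exp_bound[of x "\<lambda>y. g y - g' y" \<eta> c g C s t u, OF d g \<eta> st u] by (simp only: e_def mult.assoc)
    have b2: "norm (g' (s + x + u) * (g (u + x + t) - g' (u + x + t))) \<le> C * \<eta> * e"
      using hankel_exp_bound[of x g' C c "\<lambda>y. g y - g' y" \<eta> s t u, OF g' d C st u] by (simp only: e_def mult.assoc)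
    have split: "a * b - a' * b' = (a - a') * b + a' * (b - b')" for a b a' b' :: complex
      by (simp add: algebra_simps)
    have "norm (g (s + x + u) * g (u + x + t) - g' (s + x + u) * g' (u + x + t)) =
        norm ((g (s + x + u) - g' (s + x + u)) * g (u + x + t) + g' (s + x + u) * (g (u + x + t) - g' (u + x + t)))"
      by (simp only: split[of "g (s + x + u)" "g (u + x + t)" "g' (s + x + u)" "g' (u + x + t)"])
    also have "\<dots> \<le> \<eta> * C * e + C * \<eta> * e"
      by (rule order_trans[OF norm_triangle_ineq add_mono[OF b1 b2]])
    also have "\<dots> = (2 * C * \<eta> * (exp (- c * s) * exp (- c * t))) * (exp (- c * u) * exp (- c * u))"
      unfolding e_def by simp
    finally show "norm (g (s + x + u) * g (u + x + t) - g' (s + x + u) * g' (u + x + t)) \<le>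
        (2 * C * \<eta> * (exp (- c * s) * exp (- c * t))) * (exp (- c * u) * exp (- c * u))" .
  qed
  also have "\<dots> = C * \<eta> / c * (exp (- c * s) * exp (- c * t))"
  proof -
    have "2 * C * \<eta> * k / (2 * c) = C * \<eta> / c * k" for k by simp
    then show ?thesis unfolding halfline_exp_mult(2)[OF c] .
  qed
  finally show ?thesis .
qed

lemma hz_local_bound:
  assumes \<delta>: "0 < \<delta>" "\<delta> \<le> 1" and z0: "z0 \<in> ball 0 1 - {0}"
  obtains r C c where "r > 0" "cball z0 r \<subseteq> ball 0 1 - {0}" "C \<ge> 0" "c > 0"
    "\<And>z y. z \<in> cball z0 r \<Longrightarrow> y \<ge> x \<Longrightarrow> norm (hz \<delta> y z) \<le> C * exp (- c * (y - x))"
proof -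
  define r where "r = min (norm z0) (1 - norm z0) / 2"
  have r: "r > 0" "r \<le> norm z0 / 2" "r \<le> (1 - norm z0) / 2" using z0 by (auto simp: r_def)
  define ra where "ra = norm z0 - r"
  define rb where "rb = norm z0 + r"
  have rab: "0 < ra" "ra < 1" "0 < rb" "rb < 1" using r z0 by (auto simp: ra_def rb_def field_simps)
  have zr: "ra \<le> norm z \<and> norm z \<le> rb" if "z \<in> cball z0 r" for z
    using that norm_triangle_ineq2[of z0 z] norm_triangle_ineq2[of z z0] by (auto simp: dist_norm norm_minus_commute ra_def rb_def)
  \<comment> \<open>The disc lies in the annulus with radii ra and rb; l1 and l2 are the values of -
    \<delta>^2 ln |z| at its outer and inner edge, so the decay rate sqrt (2 l1) stays positive on
    the disc.\<close>
  define l1 where "l1 = - \<delta>\<^sup>2 * ln rb"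
  define l2 where "l2 = - \<delta>\<^sup>2 * ln ra"
  have l1: "l1 > 0" using \<delta> rab by (simp add: l1_def mult_pos_neg)
  have d2: "\<delta>\<^sup>2 > 0" using \<delta> by simp
  show ?thesis
  proof (rule that[of r "4 * exp pi * tasep_const l1 l2 x" "sqrt (2 * l1)"])
    show "r > 0" by fact
    show "cball z0 r \<subseteq> ball 0 1 - {0}" using zr rab by fastforce
    show "0 \<le> 4 * exp pi * tasep_const l1 l2 x" using l1 by (simp add: tasep_const_nonneg)
    show "0 < sqrt (2 * l1)" using l1 by simp
    fix z y assume z: "z \<in> cball z0 r" and y: "x \<le> y"
    have z0: "norm z > 0" using zr[OF z] rab by linarith
    have "ln ra \<le> ln (norm z)" "ln (norm z) \<le> ln rb" using zr[OF z] rab z0 by auto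
    then show "norm (hz \<delta> y z) \<le> 4 * exp pi * tasep_const l1 l2 x * exp (- sqrt (2 * l1) * (y - x))"
      using z0 d2 by (intro hz_bound[OF l1 \<delta> y]) (auto simp: l1_def l2_def)
  qed
qed

lemma fredholm_det_hz_holomorphic:
  assumes \<delta>: "0 < \<delta>" "\<delta> \<le> 1"
  shows "(\<lambda>z. fredholm_det halfline (hz_kernel \<delta> x z)) holomorphic_on ball 0 1 - {0}"
proof (rule fredholm_det_holomorphic[OF sigma_finite_halfline])
  show op: "open (ball 0 1 - {0 :: complex})" by auto
  show "(\<lambda>z. hz_kernel \<delta> x z s t) holomorphic_on ball 0 1 - {0}" if "s \<in> space halfline" "t \<in> space halfline" for s t
    unfolding hz_kernel_def
  proof (rule holomorphic_on_integral[OF op])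
    show "(\<lambda>z. hz \<delta> (s + x + u) z * hz \<delta> (u + x + t) z) holomorphic_on ball 0 1 - {0}" for u
      by (intro holomorphic_intros hz_holomorphic \<delta>)
    show "(\<lambda>u. hz \<delta> (s + x + u) z * hz \<delta> (u + x + t) z) \<in> borel_measurable halfline" for z
      by (rule measurable_hankel(1)[OF measurable_hz])
    fix z0 :: complex assume "z0 \<in> ball 0 1 - {0}"
    then obtain r C c where r: "r > 0" "cball z0 r \<subseteq> ball 0 1 - {0}" and C: "C \<ge> 0" and c: "c > 0"
      and b: "\<And>z y. z \<in> cball z0 r \<Longrightarrow> y \<ge> x \<Longrightarrow> norm (hz \<delta> y z) \<le> C * exp (- c * (y - x))"
      using hz_local_bound[OF \<delta>] by metis
    show "\<exists>r>0. \<exists>g. cball z0 r \<subseteq> ball 0 1 - {0} \<and> integrable halfline g \<and>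
        (\<forall>z\<in>cball z0 r. \<forall>u\<in>space halfline. norm (hz \<delta> (s + x + u) z * hz \<delta> (u + x + t) z) \<le> g u)"
      using that r
      by (intro exI[of _ r] exI[of _ "\<lambda>u. C * C * (exp (- c * s) * exp (- c * t)) * (exp (- c * u) * exp (- c * u))"] conjI ballI
          halfline_exp_mult(1) c hankel_exp_bound b C) (auto simp: space_halfline)
  qed
  fix z0 :: complex assume "z0 \<in> ball 0 1 - {0}"
  then obtain r C c where r: "r > 0" "cball z0 r \<subseteq> ball 0 1 - {0}" and C: "C \<ge> 0" and c: "c > 0"
    and b: "\<And>z y. z \<in> cball z0 r \<Longrightarrow> y \<ge> x \<Longrightarrow> norm (hz \<delta> y z) \<le> C * exp (- c * (y - x))"
    using hz_local_bound[OF \<delta>] by metis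
  show "\<exists>r>0. \<exists>q c. cball z0 r \<subseteq> ball 0 1 - {0} \<and> fredholm_weight halfline q \<and> c \<ge> 0 \<and>
      (\<forall>w\<in>cball z0 r. fredholm_weight.dominated halfline q c (hz_kernel \<delta> x w))"
    unfolding hz_kernel_hankel using r C c b
    by (intro exI[of _ r] exI[of _ "\<lambda>s. exp (- c * s)"] exI[of _ "C * C / (2 * c)"] conjI ballI exp_weight
        hankel_dominated[OF measurable_hz c C]) auto
qed

lemma of_real_fredholm_term:
  "complex_of_real (fredholm_term n M K) = fredholm_term n M (\<lambda>s t. complex_of_real (K s t))"
  unfolding fredholm_term_def det_leibniz by (simp flip: integral_complex_of_real)

text \<open>\<open>F_GUE\<close> is a real series; its convergence, which rests on the decay of
  \<open>Airy\<close>, is what allows the passage to complex numbers.\<close>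

lemma F_GUE_hankel:
  "complex_of_real (F_GUE x) = fredholm_det halfline (hankel_square x (\<lambda>y. of_real (Airy y)))"
proof -
  define K where "K = kernel_comp halfline (airy_kernel x) (airy_kernel x)"
  have K: "complex_of_real (K s t) = hankel_square x (\<lambda>y. of_real (Airy y)) s t" for s t
    by (simp add: K_def kernel_comp_def airy_kernel_def hankel_square_def flip: integral_complex_of_real)
  have dom: "fredholm_weight.dominated halfline (\<lambda>s. exp (- 1 * s)) (airy_const x * airy_const x / (2 * 1)) (hankel_square x (\<lambda>y. of_real (Airy y)))"
  proof (rule hankel_dominated)
    show "(\<lambda>y. complex_of_real (Airy y)) \<in> borel_measurable borel" using measurable_Airy by measurable
    show "norm (complex_of_real (Airy y)) \<le> airy_const x * exp (- 1 * (y - x))" if "x \<le> y" for y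
      using Airy_bound[OF that] by simp
  qed (use airy_const_pos[of x] in auto)
  have term_eq: "complex_of_real ((-1) ^ n / fact n * fredholm_term n halfline K) =
      (-1) ^ n / fact n * fredholm_term n halfline (hankel_square x (\<lambda>y. of_real (Airy y)))" for n
    by (simp add: of_real_fredholm_term K)
  have "summable (\<lambda>n. complex_of_real ((-1) ^ n / fact n * fredholm_term n halfline K))"
    unfolding term_eq
    by (rule fredholm_weight.summable_fredholm[OF exp_weight dom]) auto
  then have "summable (\<lambda>n. (-1) ^ n / fact n * fredholm_term n halfline K)"
    by (simp only: summable_complex_of_real)
  then have "complex_of_real (\<Sum>n. (-1) ^ n / fact n * fredholm_term n halfline K) =
      (\<Sum>n. complex_of_real ((-1) ^ n / fact n * fredholm_term n halfline K))"
    by (rule suminf_of_real)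
  moreover have "F_GUE x = (\<Sum>n. (-1) ^ n / fact n * fredholm_term n halfline K)"
    by (simp add: F_GUE_def fredholm_det_terms K_def Let_def)
  ultimately show ?thesis by (simp only: term_eq fredholm_det_terms)
qed

text \<open>From \<open>fredholm_det_diff\<close> with c = M^2 / 2 for M =
  \<open>airy_const x0\<close>: M times \<open>approx_const x0\<close> divided by c gives the first
  factor, and 2 c mass becomes M^2 mass.\<close>

definition det_const :: "real \<Rightarrow> real"
  where "det_const x0 = 2 * approx_const x0 / airy_const x0 *
    (\<Sum>n. hadamard_coeff ((airy_const x0)\<^sup>2 * fredholm_weight.mass halfline (\<lambda>s. exp (- 1 * s))) n)"

text \<open>Measuring decay from x instead of x0 gives each symbol a factor a = exp (x0 - x). The
  kernel is quadratic in the symbol, hence a^2, while M a \<le> M keeps the domination constant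
  independent of x.\<close>

lemma fredholm_det_hz_approx:
  assumes \<delta>: "0 < \<delta>" "\<delta> \<le> 1" and x: "x0 \<le> x" and z: "norm z = exp (- 1 / \<delta>\<^sup>2)"
  shows "norm (fredholm_det halfline (hz_kernel \<delta> x z) - of_real (F_GUE x))
    \<le> det_const x0 * exp (- 1 / (2 * \<delta>\<^sup>2)) * exp (- 2 * (x - x0))"
proof -
  define M where "M = airy_const x0"
  define a where "a = exp (- (x - x0))"
  define \<eta> where "\<eta> = approx_const x0 * exp (- 1 / (2 * \<delta>\<^sup>2))"
  have M: "M > 0" by (simp add: M_def airy_const_pos)
  have a: "0 < a" "a \<le> 1" using x by (auto simp: a_def)
  have \<eta>: "\<eta> > 0" by (simp add: \<eta>_def approx_const_pos)
  have ey: "exp (- (y - x0)) = a * exp (- 1 * (y - x))" for y by (simp add: a_def exp_add[symmetric])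
  have g1: "norm (hz \<delta> y z) \<le> M * a * exp (- 1 * (y - x))" if "y \<ge> x" for y
    using hz_bound_main[OF \<delta> _ z, of x0 y] x that unfolding ey M_def by (simp add: mult_ac)
  have g2: "norm (complex_of_real (Airy y)) \<le> M * a * exp (- 1 * (y - x))" if "y \<ge> x" for y
    using Airy_bound[of x0 y] x that unfolding ey M_def by (simp add: mult_ac)
  have g12: "norm (hz \<delta> y z - of_real (Airy y)) \<le> \<eta> * a * exp (- 1 * (y - x))" if "y \<ge> x" for y
    using hz_approx[OF \<delta> _ z, of x0 y] x that unfolding ey \<eta>_def by (simp add: mult_ac)
  interpret fredholm_weight halfline "\<lambda>s. exp (- 1 * s)" by (rule exp_weight) simp
  have mA: "(\<lambda>y. complex_of_real (Airy y)) \<in> borel_measurable borel" using measurable_Airy by measurable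
  have "(M * a) * (M * a) \<le> M * M" using M a by (intro mult_mono) auto
  then have le: "(M * a) * (M * a) / (2 * 1) \<le> M\<^sup>2 / 2" by (simp add: power2_eq_square)
  have Ma: "M * a \<ge> 0" using M a by simp
  have d1: "dominated (M\<^sup>2 / 2) (hankel_square x (\<lambda>y. hz \<delta> y z))"
    by (rule hankel_dominated[OF measurable_hz _ Ma g1 le]) simp_all
  have d2: "dominated (M\<^sup>2 / 2) (hankel_square x (\<lambda>y. of_real (Airy y)))"
    by (rule hankel_dominated[OF mA _ Ma g2 le]) simp_all
  have "norm (fredholm_det halfline (hankel_square x (\<lambda>y. hz \<delta> y z)) - fredholm_det halfline (hankel_square x (\<lambda>y. of_real (Airy y))))
      \<le> ((M * a) * (\<eta> * a) / 1) / (M\<^sup>2 / 2) * (\<Sum>n. hadamard_coeff (2 * (M\<^sup>2 / 2) * mass) n)"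
  proof (rule fredholm_det_diff[OF d1 d2])
    fix s t assume "s \<in> space halfline" "t \<in> space halfline"
    then show "norm (hankel_square x (\<lambda>y. hz \<delta> y z) s t - hankel_square x (\<lambda>y. of_real (Airy y)) s t)
        \<le> (M * a) * (\<eta> * a) / 1 * (exp (- 1 * s) * exp (- 1 * t))"
      using \<eta> a by (intro hankel_diff[OF measurable_hz mA _ Ma _ g1 g2 g12]) (auto simp: space_halfline)
  qed (use M a \<eta> in auto)
  also have "((M * a) * (\<eta> * a) / 1) / (M\<^sup>2 / 2) * (\<Sum>n. hadamard_coeff (2 * (M\<^sup>2 / 2) * mass) n)
      = det_const x0 * exp (- 1 / (2 * \<delta>\<^sup>2)) * (a * a)"
    using M by (simp add: det_const_def M_def[symmetric] \<eta>_def power2_eq_square)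
  also have "a * a = exp (- 2 * (x - x0))" by (simp add: a_def exp_add[symmetric])
  finally show ?thesis by (simp add: hz_kernel_hankel F_GUE_hankel)
qed

section \<open>The contour integral\<close>

lemma polylog_zero: "s \<ge> 0 \<Longrightarrow> polylog s 0 = 0"
  using polylog_bound[of s 0] by simp

text \<open>With f the polylogarithm of order 1/2, the integrand is the product of f and f / y, and
  f / y has a removable singularity at 0. There the product is 0, in agreement with division by
  zero, so a primitive exists on the whole disc.\<close>

lemma B_holomorphic: "B holomorphic_on ball 0 1" and B_zero: "B 0 = 0"
proof -
  let ?f = "polylog (1/2)"
  have f: "?f holomorphic_on ball 0 1" by (rule polylog_holomorphic) simp
  have "(\<lambda>z. ?f z * (if z = 0 then deriv ?f 0 else (?f z - ?f 0) / (z - 0))) holomorphic_on ball 0 1"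
    by (intro holomorphic_intros f pole_lemma_open) auto
  then have g: "(\<lambda>y. (?f y)\<^sup>2 / y) holomorphic_on ball 0 1"
    by (rule holomorphic_transform) (simp add: polylog_zero power2_eq_square)
  obtain P where P0: "\<And>x. x \<in> ball 0 1 \<Longrightarrow> (P has_field_derivative (?f x)\<^sup>2 / x) (at x within ball 0 1)"
    by (rule holomorphic_convex_primitive'[OF convex_ball open_ball g]) (rule that, simp)
  have P: "(P has_field_derivative (?f x)\<^sup>2 / x) (at x)" if "x \<in> ball 0 1" for x
    using P0[OF that] unfolding at_within_open[OF that open_ball] .
  have eq: "B z = 1 / (4 * of_real pi) * (P z - P 0)" if "z \<in> ball 0 1" for z
  proof -
    have sub: "path_image (linepath 0 z) \<subseteq> ball 0 1"
      using that by (simp add: closed_segment_subset)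
    have "((\<lambda>y. (?f y)\<^sup>2 / y) has_contour_integral (P (pathfinish (linepath 0 z)) - P (pathstart (linepath 0 z)))) (linepath 0 z)"
      by (rule contour_integral_primitive[OF has_field_derivative_at_within[OF P] valid_path_linepath sub])
    then show ?thesis by (simp add: B_def contour_integral_unique)
  qed
  have "P holomorphic_on ball 0 1"
    unfolding holomorphic_on_open[OF open_ball] using P by blast
  then have "(\<lambda>z. 1 / (4 * of_real pi) * (P z - P 0)) holomorphic_on ball 0 1" by (intro holomorphic_intros)
  then show "B holomorphic_on ball 0 1" by (rule holomorphic_transform) (simp add: eq)
  show "B 0 = 0" by (simp add: eq)
qed

definition prefactor :: "real \<Rightarrow> real \<Rightarrow> complex \<Rightarrow> complex"
  where "prefactor x \<tau> z = exp (of_real x * A1 z + of_real \<tau> * A2 z + 2 * B z)"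

lemma prefactor_holomorphic: "prefactor x \<tau> holomorphic_on ball 0 1"
proof -
  have "A1 holomorphic_on ball 0 1" "A2 holomorphic_on ball 0 1"
    unfolding A1_def A2_def by (intro holomorphic_intros polylog_holomorphic; simp)+
  then show ?thesis unfolding prefactor_def by (intro holomorphic_intros B_holomorphic)
qed

lemma prefactor_zero: "prefactor x \<tau> 0 = 1"
  by (simp add: prefactor_def A1_def A2_def B_zero polylog_zero)

text \<open>The disc of radius 1/2 contains the circles of radius exp (- 1 / \<delta>^2) with
  \<delta> \<le> 1. The growth exp |x| is later absorbed by the factor exp (- 2 (x - x0)) of the
  determinants.\<close>

lemma prefactor_bound:
  obtains b where "b \<ge> 0" "\<And>x \<tau> z. norm z \<le> 1/2 \<Longrightarrow> norm (prefactor x \<tau> z) \<le> exp (\<bar>x\<bar> + \<bar>\<tau>\<bar> + b)"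
proof -
  have "continuous_on (cball 0 (1/2)) B"
    by (rule continuous_on_subset[OF holomorphic_on_imp_continuous_on[OF B_holomorphic]]) auto
  then have "compact (B ` cball 0 (1/2))" by (intro compact_continuous_image) auto
  then have "bounded (B ` cball 0 (1/2))" by (rule compact_imp_bounded)
  then obtain b0 where b0: "b0 > 0" "\<And>z. z \<in> cball 0 (1/2) \<Longrightarrow> norm (B z) \<le> b0"
    unfolding bounded_pos by blast
  have polylog1: "norm (- (1 / of_real (sqrt (2 * pi))) * polylog s z :: complex) \<le> 1" if "s \<ge> 0" "norm z \<le> 1/2" for s z
  proof -
    have "norm (polylog s z) \<le> norm z / (1 - norm z)" using that by (intro polylog_bound) auto
    also have "\<dots> \<le> 1" using that by (simp add: divide_le_eq)
    finally have p: "norm (polylog s z) \<le> 1" .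
    have "1 \<le> sqrt (2 * pi)" using pi_gt3 by simp
    then have "1 / sqrt (2 * pi) * norm (polylog s z) \<le> 1 * 1" using p by (intro mult_mono) auto
    then show ?thesis by (simp add: norm_mult norm_divide)
  qed
  show ?thesis
  proof (rule that[of "2 * b0"])
    show "0 \<le> 2 * b0" using b0 by simp
    fix x \<tau> and z :: complex assume z: "norm z \<le> 1/2"
    have A: "norm (A1 z) \<le> 1" "norm (A2 z) \<le> 1" unfolding A1_def A2_def by (rule polylog1; use z in simp)+
    have "norm (of_real x * A1 z + of_real \<tau> * A2 z + 2 * B z) \<le> norm (of_real x * A1 z) + norm (of_real \<tau> * A2 z) + norm (2 * B z)"
      by (intro order_trans[OF norm_triangle_ineq] add_right_mono norm_triangle_ineq)
    also have "\<dots> = \<bar>x\<bar> * norm (A1 z) + \<bar>\<tau>\<bar> * norm (A2 z) + 2 * norm (B z)" by (simp add: norm_mult)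
    also have "\<dots> \<le> \<bar>x\<bar> * 1 + \<bar>\<tau>\<bar> * 1 + 2 * b0" using A b0(2)[of z] z by (intro add_mono mult_left_mono) auto
    finally have "norm (of_real x * A1 z + of_real \<tau> * A2 z + 2 * B z) \<le> \<bar>x\<bar> + \<bar>\<tau>\<bar> + 2 * b0" by simp
    then show "norm (prefactor x \<tau> z) \<le> exp (\<bar>x\<bar> + \<bar>\<tau>\<bar> + 2 * b0)"
      unfolding prefactor_def norm_exp_eq_Re exp_le_cancel_iff by (rule order_trans[OF complex_Re_le_cmod])
  qed
qed

text \<open>The passage to the half-line comes first: there the underlying space no longer depends
  on z, and the determinant is known to be analytic, so the circle can be moved.\<close>

lemma F_circle:
  assumes \<delta>: "0 < \<delta>" "\<delta> \<le> 1" and R: "0 < R" "R < 1" and r: "0 < r" "r < 1"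
  shows "F R (\<delta> * x) (\<delta> ^ 3) 0 = contour_integral (circlepath 0 r)
    (\<lambda>z. prefactor (\<delta> * x) (\<delta> ^ 3) z * fredholm_det halfline (hz_kernel \<delta> x z) / (2 * of_real pi * \<i> * z))"
proof -
  let ?f = "\<lambda>z. prefactor (\<delta> * x) (\<delta> ^ 3) z * fredholm_det halfline (hz_kernel \<delta> x z) / (2 * of_real pi * \<i> * z)"
  have hol: "?f holomorphic_on ball 0 1 - {0}"
    by (intro holomorphic_intros fredholm_det_hz_holomorphic \<delta> holomorphic_on_subset[OF prefactor_holomorphic]) auto
  have "F R (\<delta> * x) (\<delta> ^ 3) 0 = contour_integral (circlepath 0 R) ?f"
    unfolding F_def
  proof (intro contour_integral_cong refl)
    fix z assume "z \<in> path_image (circlepath 0 R)"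
    then have z: "z \<in> ball 0 1 - {0}" using R by auto
    show "exp (of_real (\<delta> * x) * A1 z + of_real (\<delta> ^ 3) * A2 z + 2 * B z)
        * fredholm_det (count_space (S_minus z)) (K_kernel (\<delta> * x) (\<delta> ^ 3) 0 z) / (2 * of_real pi * \<i> * z) = ?f z"
      unfolding fredholm_det_K_kernel[OF \<delta> z] prefactor_def ..
  qed
  also have "\<dots> = contour_integral (circlepath 0 r) ?f"
  proof (cases "R \<le> r")
    case True
    show ?thesis
      by (rule contour_integral_circlepath_eq(3)[OF open_ball hol, symmetric]) (use R r True in auto)
  next
    case False
    show ?thesis
      by (rule contour_integral_circlepath_eq(3)[OF open_ball hol]) (use R r False in auto)
  qed
  finally show ?thesis .
qed

lemma F_approx:
  shows "\<exists>C>0. \<forall>\<delta> R x. 0 < \<delta> \<longrightarrow> \<delta> \<le> 1 \<longrightarrow> 0 < R \<longrightarrow> R < 1 \<longrightarrow> x0 \<le> x \<longrightarrow>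
    norm (F R (\<delta> * x) (\<delta> ^ 3) 0 - of_real (F_GUE x)) \<le> C * exp (- 1 / (2 * \<delta>\<^sup>2)) * exp (- (x - x0))"
proof -
  obtain b where b: "b \<ge> 0" "\<And>x \<tau> z. norm z \<le> 1/2 \<Longrightarrow> norm (prefactor x \<tau> z) \<le> exp (\<bar>x\<bar> + \<bar>\<tau>\<bar> + b)"
    using prefactor_bound by metis
  \<comment> \<open>|\<delta> x| \<le> x - x0 + |x0| and \<delta>^3 \<le> 1 lead to the exponent
    |x0| + 1 + b; the last summand makes C positive.\<close>
  define C where "C = exp (\<bar>x0\<bar> + 1 + b) * \<bar>det_const x0\<bar> + 1"
  show ?thesis
  proof (intro exI[of _ C] conjI allI impI)
    show "C > 0" by (simp add: C_def add_nonneg_pos)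
    fix \<delta> R x :: real assume \<delta>: "0 < \<delta>" "\<delta> \<le> 1" and R: "0 < R" "R < 1" and x: "x0 \<le> x"
    define r where "r = exp (- 1 / \<delta>\<^sup>2)"
    have "- 1 / \<delta>\<^sup>2 \<le> - 1" using \<delta> by (simp add: power_le_one)
    then have r: "0 < r" "r \<le> 1/2" using exp_minus_one_le by (auto simp: r_def intro: order_trans[rotated])
    let ?E = "prefactor (\<delta> * x) (\<delta> ^ 3)"
    let ?D = "\<lambda>z. fredholm_det halfline (hz_kernel \<delta> x z)"
    define c where "c = complex_of_real (F_GUE x)"
    define e1 where "e1 = exp (x - x0 + \<bar>x0\<bar> + 1 + b)"
    define e2 where "e2 = \<bar>det_const x0\<bar> * exp (- 1 / (2 * \<delta>\<^sup>2)) * exp (- 2 * (x - x0))"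
    have e: "e1 \<ge> 0" "e2 \<ge> 0" by (simp_all add: e1_def e2_def)
    have cE: "continuous_on (sphere 0 r) ?E"
      by (rule continuous_on_subset[OF holomorphic_on_imp_continuous_on[OF prefactor_holomorphic]]) (use r in auto)
    have cD: "continuous_on (sphere 0 r) ?D"
      by (rule continuous_on_subset[OF holomorphic_on_imp_continuous_on[OF fredholm_det_hz_holomorphic[OF \<delta>]]]) (use r in auto)
    have i1: "(\<lambda>z. ?E z * ?D z / (2 * of_real pi * \<i> * z)) contour_integrable_on circlepath 0 r"
      using r by (intro contour_integrable_continuous_circlepath continuous_intros) (auto intro: cE cD)
    have i2: "(\<lambda>z. ?E z * c / (2 * of_real pi * \<i> * z)) contour_integrable_on circlepath 0 r"
      using r by (intro contour_integrable_continuous_circlepath continuous_intros) (auto intro: cE)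
    have "((\<lambda>z. ?E z / (z - 0)) has_contour_integral (2 * of_real pi * \<i> * ?E 0)) (circlepath 0 r)"
      using r by (intro Cauchy_integral_circlepath_simple holomorphic_on_subset[OF prefactor_holomorphic]) auto
    from has_contour_integral_lmul[OF this, of "c / (2 * of_real pi * \<i>)"]
    have "((\<lambda>z. ?E z * c / (2 * of_real pi * \<i> * z)) has_contour_integral c) (circlepath 0 r)"
      by (simp add: prefactor_zero mult_ac)
    then have ic: "contour_integral (circlepath 0 r) (\<lambda>z. ?E z * c / (2 * of_real pi * \<i> * z)) = c"
      by (rule contour_integral_unique)
    have "F R (\<delta> * x) (\<delta> ^ 3) 0 - c = contour_integral (circlepath 0 r)
        (\<lambda>z. ?E z * ?D z / (2 * of_real pi * \<i> * z) - ?E z * c / (2 * of_real pi * \<i> * z))"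
      using r by (simp add: F_circle[OF \<delta> R, of r] contour_integral_diff[OF i1 i2] ic)
    also have "norm \<dots> \<le> e1 * e2 / (2 * pi * r) * (2 * pi * r)"
    proof (rule contour_integral_bound_circlepath[OF contour_integrable_diff[OF i1 i2]])
      fix z :: complex assume "norm (z - 0) = r"
      then have z: "norm z = r" by simp
      have dx: "\<bar>\<delta> * x\<bar> \<le> x - x0 + \<bar>x0\<bar>"
      proof -
        have "\<bar>\<delta> * x\<bar> \<le> 1 * \<bar>x\<bar>" unfolding abs_mult using \<delta> by (intro mult_right_mono) auto
        then show ?thesis using x by linarith
      qed
      have "norm (?E z) \<le> exp (\<bar>\<delta> * x\<bar> + \<bar>\<delta> ^ 3\<bar> + b)" using z r by (intro b(2)) simp
      also have "\<dots> \<le> e1"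
        unfolding e1_def using dx \<delta> power_le_one[of \<delta> 3] by (subst exp_le_cancel_iff) (intro add_mono, auto)
      finally have nE: "norm (?E z) \<le> e1" .
      have "norm (?D z - c) \<le> det_const x0 * exp (- 1 / (2 * \<delta>\<^sup>2)) * exp (- 2 * (x - x0))"
        unfolding c_def using z by (intro fredholm_det_hz_approx[OF \<delta> x]) (simp add: r_def)
      also have "\<dots> \<le> e2"
        unfolding e2_def by (intro mult_right_mono) auto
      finally have nD: "norm (?D z - c) \<le> e2" .
      have "norm (?E z * ?D z / (2 * of_real pi * \<i> * z) - ?E z * c / (2 * of_real pi * \<i> * z)) = norm (?E z) * norm (?D z - c) / (2 * pi * r)"
        unfolding diff_divide_distrib[symmetric] right_diff_distrib[symmetric] norm_divide norm_mult by (simp add: z)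
      also have "\<dots> \<le> e1 * e2 / (2 * pi * r)"
        using r e by (intro divide_right_mono mult_mono nE nD) auto
      finally show "norm (?E z * ?D z / (2 * of_real pi * \<i> * z) - ?E z * c / (2 * of_real pi * \<i> * z))
        \<le> e1 * e2 / (2 * pi * r)" .
    qed (use r e in auto)
    also have "\<dots> = exp (\<bar>x0\<bar> + 1 + b) * \<bar>det_const x0\<bar> * exp (- 1 / (2 * \<delta>\<^sup>2)) * (exp (x - x0) * exp (- 2 * (x - x0)))"
      using r by (simp add: e1_def e2_def exp_add mult_ac)
    \<comment> \<open>One decaying factor pays for the growth of the prefactor; the other gives the
      rate c = 1.\<close>
    also have "exp (x - x0) * exp (- 2 * (x - x0)) = exp (- (x - x0))" by (simp add: exp_add[symmetric])
    also have "exp (\<bar>x0\<bar> + 1 + b) * \<bar>det_const x0\<bar> * exp (- 1 / (2 * \<delta>\<^sup>2)) * exp (- (x - x0)) \<le> C * exp (- 1 / (2 * \<delta>\<^sup>2)) * exp (- (x - x0))"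
      by (intro mult_right_mono) (auto simp: C_def)
    finally show "norm (F R (\<delta> * x) (\<delta> ^ 3) 0 - of_real (F_GUE x)) \<le> C * exp (- 1 / (2 * \<delta>\<^sup>2)) * exp (- (x - x0))"
      by (simp add: c_def)
  qed
qed

theorem theorem1p6:
  fixes x0 :: real
  shows "(\<exists>C c \<epsilon> \<tau>0 :: real. C > 0 \<and> c > 0 \<and> \<epsilon> > 0 \<and> \<tau>0 > 0 \<and>
            (\<forall>R \<tau> x. 0 < R \<and> R < 1 \<and> 0 < \<tau> \<and> \<tau> < \<tau>0 \<and> x \<ge> x0 \<longrightarrow>
               norm (F R (\<tau> powr (1/3) * x) \<tau> 0 - complex_of_real (F_GUE x))
                 \<le> C * exp (- \<epsilon> * \<tau> powr (- (2/3))) * exp (- c * (x - x0)))) \<and>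
         (\<forall>R. 0 < R \<and> R < 1 \<longrightarrow>
            uniform_limit {x0..} (\<lambda>\<tau> x. F R (\<tau> powr (1/3) * x) \<tau> 0)
              (\<lambda>x. complex_of_real (F_GUE x)) (at_right 0))"
proof -
  obtain C where C: "C > 0" and Cb: "\<forall>\<delta> R x. 0 < \<delta> \<longrightarrow> \<delta> \<le> 1 \<longrightarrow> 0 < R \<longrightarrow> R < 1 \<longrightarrow> x0 \<le> x \<longrightarrow>
    norm (F R (\<delta> * x) (\<delta> ^ 3) 0 - of_real (F_GUE x)) \<le> C * exp (- 1 / (2 * \<delta>\<^sup>2)) * exp (- (x - x0))"
    using F_approx[of x0] by (elim exE conjE)
  have bound: "norm (F R (\<tau> powr (1/3) * x) \<tau> 0 - complex_of_real (F_GUE x))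
      \<le> C * exp (- (1/2) * \<tau> powr (- (2/3))) * exp (- 1 * (x - x0))"
    if "0 < R" "R < 1" "0 < \<tau>" "\<tau> < 1" "x0 \<le> x" for R \<tau> x
  proof -
    define \<delta> where "\<delta> = \<tau> powr (1/3)"
    have \<delta>: "0 < \<delta>" "\<delta> \<le> 1" using that powr_le1[of "1/3" \<tau>] by (auto simp: \<delta>_def)
    have d3: "\<delta> ^ 3 = \<tau>" using that by (simp add: \<delta>_def powr_power)
    have d2: "\<delta>\<^sup>2 = \<tau> powr (2/3)" using that by (simp add: \<delta>_def powr_power)
    have e: "- 1 / (2 * \<delta>\<^sup>2) = - (1/2) * \<tau> powr (- (2/3))"
      unfolding d2 powr_minus_divide by simp
    have "norm (F R (\<delta> * x) (\<delta> ^ 3) 0 - of_real (F_GUE x)) \<le> C * exp (- 1 / (2 * \<delta>\<^sup>2)) * exp (- (x - x0))"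
      using Cb \<delta> that by simp
    then show ?thesis unfolding d3 e unfolding \<delta>_def by simp
  qed
  have unif: "uniform_limit {x0..} (\<lambda>\<tau> x. F R (\<tau> powr (1/3) * x) \<tau> 0) (\<lambda>x. complex_of_real (F_GUE x)) (at_right 0)"
    if R: "0 < R" "R < 1" for R
  proof (rule uniform_limitI)
    fix e :: real assume e: "e > 0"
    have "((\<lambda>\<tau>::real. \<tau> powr (2/3)) \<longlongrightarrow> 0) (at_right 0)"
    proof (rule tendsto_zero_powrI)
      show "\<forall>\<^sub>F \<tau> in at_right 0. 0 \<le> (\<tau> :: real)" by (rule eventually_at_rightI[of 0 1]) auto
    qed (auto intro!: tendsto_ident_at)
    then have "((\<lambda>\<tau>::real. C * (2 * \<tau> powr (2/3))) \<longlongrightarrow> 0) (at_right 0)"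
      by (intro tendsto_mult_right_zero)
    then have "\<forall>\<^sub>F \<tau> in at_right 0. C * (2 * \<tau> powr (2/3)) < e" using e by (rule order_tendstoD)
    moreover have "\<forall>\<^sub>F \<tau> in at_right (0::real). \<tau> \<in> {0<..<1}" by (rule eventually_at_right_real) simp
    ultimately show "\<forall>\<^sub>F \<tau> in at_right 0. \<forall>x\<in>{x0..}. dist (F R (\<tau> powr (1/3) * x) \<tau> 0) (complex_of_real (F_GUE x)) < e"
    proof eventually_elim
      case (elim \<tau>)
      define v where "v = 1/2 * \<tau> powr (- (2/3))"
      have v: "v > 0" using elim by (simp add: v_def)
      \<comment> \<open>This turns the exponential bound into a multiple of \<tau> powr (2/3), which
        tends to 0 independently of x.\<close>
      have "exp (- v) \<le> 1 / v"
      proof -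
        have "v \<le> exp v" using exp_ge_add_one_self[of v] by linarith
        then show ?thesis using v by (simp add: exp_minus field_simps)
      qed
      also have "1 / v = 2 * \<tau> powr (2/3)" unfolding v_def powr_minus_divide by simp
      finally have ev: "exp (- v) \<le> 2 * \<tau> powr (2/3)" .
      show ?case
      proof
        fix x assume "x \<in> {x0..}"
        then have x: "x0 \<le> x" by simp
        have "dist (F R (\<tau> powr (1/3) * x) \<tau> 0) (complex_of_real (F_GUE x)) \<le> C * exp (- v) * exp (- 1 * (x - x0))"
          using bound[OF R _ _ x, of \<tau>] elim by (simp add: dist_norm v_def)
        also have "\<dots> \<le> C * exp (- v) * 1" using C x by (intro mult_left_mono) auto
        also have "\<dots> \<le> C * (2 * \<tau> powr (2/3))" using C ev by simp
        finally show "dist (F R (\<tau> powr (1/3) * x) \<tau> 0) (complex_of_real (F_GUE x)) < e" using elim by linarith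
      qed
    qed
  qed
  show ?thesis
  proof (intro conjI)
    show "\<exists>C c \<epsilon> \<tau>0 :: real. C > 0 \<and> c > 0 \<and> \<epsilon> > 0 \<and> \<tau>0 > 0 \<and>
            (\<forall>R \<tau> x. 0 < R \<and> R < 1 \<and> 0 < \<tau> \<and> \<tau> < \<tau>0 \<and> x \<ge> x0 \<longrightarrow>
               norm (F R (\<tau> powr (1/3) * x) \<tau> 0 - complex_of_real (F_GUE x))
                 \<le> C * exp (- \<epsilon> * \<tau> powr (- (2/3))) * exp (- c * (x - x0)))"
    \<comment> \<open>\<epsilon> = 1/2 is the exponent of the trapezoidal error, and \<tau>0 = 1
      ensures \<delta> \<le> 1.\<close>
    proof (rule exI[of _ C], rule exI[of _ 1], rule exI[of _ "1/2"], rule exI[of _ 1], intro conjI allI impI)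
      fix R \<tau> x :: real
      assume "0 < R \<and> R < 1 \<and> 0 < \<tau> \<and> \<tau> < 1 \<and> x0 \<le> x"
      then show "norm (F R (\<tau> powr (1/3) * x) \<tau> 0 - complex_of_real (F_GUE x))
          \<le> C * exp (- (1/2) * \<tau> powr (- (2/3))) * exp (- 1 * (x - x0))"
        by (intro bound) simp_all
    qed (use C in simp_all)
  qed (use unif in simp)
qed

end
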